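(* Let $\Omega \subset \mathbb{R}^n$ be a connected bounded domain with $\mathcal{C}^1$ boundary. Let $C = \lambda_1^{-1/2}$ be the optimal Poincaré constant on $\Omega$, where $\lambda_1>0$ is the smallest eigenvalue of $-\Delta$ on $H_0^1(\Omega)$. Assume that $F_1:\mathbb{C}\to\mathbb{C}$ and $F_2:\mathbb{C}^n\to\mathbb{C}$ are globally Lipschitz functions with Lipschitz constants $C_1$ and $C_2$, respectively, such that $C_1C^2+C_2C<1$. Let $f\in L^2(\Omega)$. Then the Dirichlet problem for the nonlinear elliptic equation $$-\Delta u + F_1(u)+F_2(\nabla u) = f \ \text{ in } \Omega, \qquad u|_{\partial\Omega}=0,$$ has a unique weak solution $u\in H_0^1(\Omega)$.
   Context: All function spaces consist of complex-valued functions. A domain is an open subset of $\mathbb{R}^n$. $H^1_0(\Omega)$ is the completion of $\mathcal{C}_c^\infty(\Omega,\mathbb{C})$ in the norm induced by $\langle f,h\rangle_{H^1}=\int_\Omega f\bar h\,dx+\int_\Omega\nabla f\cdot\nabla\bar h\,dx$. The sign convention is that $-\Delta$ has positive eigenvalues. $\mathbb{C}^n$ carries its Euclidean norm. A weak solution is a function $u\in H_0^1(\Omega)$ such that $\int_\Omega \nabla u\cdot\nabla v\,dx+\int_\Omega (F_1(u)+F_2(\nabla u))\,v\,dx=\int_\Omega f\,v\,dx$ for all $v\in H_0^1(\Omega)$. *)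

theory Defs
  imports "HOL-Analysis.Analysis"
begin

fun Ck :: "nat \<Rightarrow> ('a::euclidean_space \<Rightarrow> 'b::real_normed_vector) \<Rightarrow> bool" where
  "Ck 0 \<phi> \<longleftrightarrow> continuous_on UNIV \<phi>"
| "Ck (Suc k) \<phi> \<longleftrightarrow> (\<forall>x. \<phi> differentiable (at x)) \<and>
     (\<forall>v. Ck k (\<lambda>x. frechet_derivative \<phi> (at x) v))"

text \<open>Near each boundary point, after an orthogonal change of coordinates taking \<open>e\<close> to the last
  coordinate direction, the set is the region strictly above the graph of a \<open>C\<^sup>1\<close> function of the
  remaining coordinates. The orthogonal projection \<open>x - (x \<bullet> e) *\<^sub>R e\<close> stands for those
  coordinates, and a \<open>C\<^sup>1\<close> function on the hyperplane orthogonal to \<open>e\<close> is the same thing as the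
  restriction of a \<open>C\<^sup>1\<close> function on the whole space.\<close>

definition C1_boundary :: "'a::euclidean_space set \<Rightarrow> bool" where
  "C1_boundary \<Omega> \<longleftrightarrow>
     (\<forall>x0 \<in> frontier \<Omega>. \<exists>r>0. \<exists>e. \<exists>\<gamma>::'a \<Rightarrow> real. norm e = 1 \<and> Ck 1 \<gamma> \<and>
        \<Omega> \<inter> ball x0 r = {x \<in> ball x0 r. \<gamma> (x - (x \<bullet> e) *\<^sub>R e) < x \<bullet> e})"

text \<open>Elements of the function spaces are represented by functions on the whole space of which only
  the values on \<open>\<Omega>\<close> matter, up to equality almost everywhere.\<close>

definition L2 :: "'a::euclidean_space set \<Rightarrow> ('a \<Rightarrow> 'b::euclidean_space) set" where
  "L2 \<Omega> = {u. u \<in> borel_measurable (lebesgue_on \<Omega>) \<and>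
              integrable (lebesgue_on \<Omega>) (\<lambda>x. (norm (u x))\<^sup>2)}"

definition test_functions :: "(real^'n) set \<Rightarrow> (real^'n \<Rightarrow> complex) set" where
  "test_functions \<Omega> = {\<phi>. (\<forall>k. Ck k \<phi>) \<and>
     compact (closure {x. \<phi> x \<noteq> 0}) \<and> closure {x. \<phi> x \<noteq> 0} \<subseteq> \<Omega>}"

definition classical_grad :: "(real^'n \<Rightarrow> complex) \<Rightarrow> real^'n \<Rightarrow> complex^'n" where
  "classical_grad \<phi> x = (\<chi> i. frechet_derivative \<phi> (at x) (axis i 1))"

text \<open>The completion of the test functions in the \<open>H\<^sup>1\<close> norm, realised inside
  \<open>L\<^sup>2 \<times> (L\<^sup>2)\<^sup>n\<close>: \<open>H10_limit \<Omega> u g\<close> says that some sequence of test functions converges to \<open>u\<close>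
  in \<open>L\<^sup>2\<close> while its gradients converge to \<open>g\<close> in \<open>L\<^sup>2\<close>. The gradient is closable on the test
  functions, so \<open>g\<close> is determined by \<open>u\<close> up to equality almost everywhere on \<open>\<Omega>\<close>; it is the
  weak gradient of \<open>u\<close>.\<close>

definition H10_limit ::
    "(real^'n) set \<Rightarrow> (real^'n \<Rightarrow> complex) \<Rightarrow> (real^'n \<Rightarrow> complex^'n) \<Rightarrow> bool" where
  "H10_limit \<Omega> u g \<longleftrightarrow> u \<in> L2 \<Omega> \<and> g \<in> L2 \<Omega> \<and>
     (\<exists>\<phi> :: nat \<Rightarrow> real^'n \<Rightarrow> complex. (\<forall>k. \<phi> k \<in> test_functions \<Omega>) \<and>
        (\<lambda>k. (LINT x|lebesgue_on \<Omega>. (norm (\<phi> k x - u x))\<^sup>2) +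
             (LINT x|lebesgue_on \<Omega>. (norm (classical_grad (\<phi> k) x - g x))\<^sup>2)) \<longlonglongrightarrow> 0)"

definition H10 :: "(real^'n) set \<Rightarrow> (real^'n \<Rightarrow> complex) set" where
  "H10 \<Omega> = {u. \<exists>g. H10_limit \<Omega> u g}"

definition grad :: "(real^'n) set \<Rightarrow> (real^'n \<Rightarrow> complex) \<Rightarrow> real^'n \<Rightarrow> complex^'n" where
  "grad \<Omega> u = (SOME g. H10_limit \<Omega> u g)"

definition dirichlet_eigenvalue :: "(real^'n) set \<Rightarrow> real \<Rightarrow> bool" where
  "dirichlet_eigenvalue \<Omega> \<mu> \<longleftrightarrow>
     (\<exists>u \<in> H10 \<Omega>. \<not> (AE x in lebesgue_on \<Omega>. u x = 0) \<and>
        (\<forall>v \<in> H10 \<Omega>.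
           (LINT x|lebesgue_on \<Omega>. (\<Sum>i\<in>UNIV. grad \<Omega> u x $ i * cnj (grad \<Omega> v x $ i))) =
           of_real \<mu> * (LINT x|lebesgue_on \<Omega>. u x * cnj (v x))))"

definition first_dirichlet_eigenvalue :: "(real^'n) set \<Rightarrow> real" where
  "first_dirichlet_eigenvalue \<Omega> = (LEAST \<mu>. dirichlet_eigenvalue \<Omega> \<mu>)"

text \<open>The pairing in the weak formulation is bilinear: there is no complex conjugation.\<close>

definition weak_solution ::
    "(real^'n) set \<Rightarrow> (complex \<Rightarrow> complex) \<Rightarrow> (complex^'n \<Rightarrow> complex) \<Rightarrow> (real^'n \<Rightarrow> complex) \<Rightarrow>
     (real^'n \<Rightarrow> complex) \<Rightarrow> bool" where
  "weak_solution \<Omega> F1 F2 f u \<longleftrightarrow> u \<in> H10 \<Omega> \<and>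
     (\<forall>v \<in> H10 \<Omega>.
        (LINT x|lebesgue_on \<Omega>. (\<Sum>i\<in>UNIV. grad \<Omega> u x $ i * grad \<Omega> v x $ i)) +
        (LINT x|lebesgue_on \<Omega>. (F1 (u x) + F2 (grad \<Omega> u x)) * v x) =
        (LINT x|lebesgue_on \<Omega>. f x * v x))"

end

theory Submission
  imports Defs
begin

text \<open>With the inner product \<open>\<integral>\<nabla>u \<bullet> \<nabla>v\<close>, which is equivalent to the \<open>H\<^sup>1\<close> one by the Poincare inequality,
  \<open>H\<^sub>0\<^sup>1(\<Omega>)\<close> is a Hilbert space. By the Riesz representation theorem a weak solution is a fixed point of the
  map sending \<open>w\<close> to the solution \<open>u\<close> of \<open>-\<Delta>u = f - F\<^sub>1(w) - F\<^sub>2(\<nabla>w)\<close>, and the Lipschitz bounds together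
  with \<open>\<parallel>u\<parallel> \<le> C \<parallel>\<nabla>u\<parallel>\<close> make it a contraction with constant \<open>C\<^sub>1 C\<^sup>2 + C\<^sub>2 C\<close>. That \<open>\<lambda>\<^sub>1\<close> exists, is positive
  and is the minimum of the Rayleigh quotient follows from Rellich compactness. All estimates on test functions
  come from \<open>\<parallel>\<phi>(\<cdot> + z) - \<phi>\<parallel> \<le> \<bar>z\<bar> \<parallel>\<nabla>\<phi>\<parallel>\<close>: translating by more than the diameter of \<open>\<Omega>\<close> gives a Poincare inequality,
  and averaging over the cells of a fine grid gives compactness.\<close>


section \<open>Minimisation and contraction in Hilbert space\<close>

text \<open>The equation pairs complex functions bilinearly, while minimisation and contraction take
  place in real inner product spaces. The bridge is that \<open>H10\<close> is stable under
  conjugation and under multiplication by \<i>: conjugating the test function turns the bilinear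
  pairing into the Hermitian one, whose real part is the real inner product, and testing with \<i>v
  recovers the imaginary part. A second obstacle is that \<open>grad\<close> is an arbitrary choice
  among a.e. equal functions. The argument therefore runs on pairs (class of u, class of its
  gradient) in the closure of the graph of the classical gradient; there the Poincare inequality
  makes the second component determine the first, and integration by parts makes the first determine
  the second. In the contraction constant \<open>C1 * C\<^sup>2 + C2 * C\<close>, one factor
  \<open>C\<close> comes from the test function; the further one, at \<open>C1\<close> only, from
  estimating a difference of functions by the difference of their gradients. As the first eigenvalue
  is a \<open>LEAST\<close> over the reals, the Rayleigh infimum has to be attained before anything
  is known about \<open>C\<close>.\<close>

lemma nonneg_quadratic_linear_coeff_zero:
  fixes b c :: real
  assumes "\<And>t. 0 \<le> 2 * t * b + t\<^sup>2 * c"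
  shows "b = 0"
proof (rule ccontr)
  assume "b \<noteq> 0"
  \<comment> \<open>Replacing \<open>c\<close> by the larger \<open>d\<close> keeps the inequality,
    and t = -b/d minimises the majorant 2tb + t^2 d; the added 1 keeps \<open>d\<close> positive
    when \<open>c\<close> is 0.\<close>
  define d where "d = \<bar>c\<bar> + 1"
  have d: "d > 0" "c \<le> d" by (auto simp: d_def)
  have "0 \<le> 2 * (- b / d) * b + (- b / d)\<^sup>2 * c" by (rule assms)
  also have "\<dots> \<le> 2 * (- b / d) * b + (- b / d)\<^sup>2 * d"
    using d by (intro add_left_mono mult_left_mono) auto
  also have "\<dots> = - (b\<^sup>2 / d)" using d by (simp add: power2_eq_square field_simps)
  also have "\<dots> < 0" using d \<open>b \<noteq> 0\<close> by simp
  finally show False by simp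
qed

lemma norm_add_scaleR_power2:
  fixes a b :: "'a::real_inner"
  shows "(norm (a + t *\<^sub>R b))\<^sup>2 = (norm a)\<^sup>2 + 2 * t * (a \<bullet> b) + t\<^sup>2 * (norm b)\<^sup>2"
  unfolding power2_norm_eq_inner
  by (simp add: inner_add_left inner_add_right inner_commute[of b a] power2_eq_square algebra_simps)

lemma parallelogram_law:
  fixes u v :: "'a::real_inner"
  shows "(norm (u - v))\<^sup>2 = 2 * (norm u)\<^sup>2 + 2 * (norm v)\<^sup>2 - (norm (u + v))\<^sup>2"
  by (simp add: power2_norm_eq_inner inner_add_left inner_add_right inner_diff_left inner_diff_right inner_commute)

text \<open>The representing vector minimises the energy |x|^2 - 2 l(x), and the parallelogram law
  makes a minimising sequence Cauchy. Linearity and boundedness are asked on \<open>G\<close> only,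
  because the functional to be represented is built from an inverse map that has meaning only
  there.\<close>

lemma riesz_closed_subspace:
  fixes G :: "'a::{real_inner,complete_space} set" and l :: "'a \<Rightarrow> real"
  assumes G: "subspace G" "closed G"
    and add: "\<And>x y. x \<in> G \<Longrightarrow> y \<in> G \<Longrightarrow> l (x + y) = l x + l y"
    and scale: "\<And>c x. x \<in> G \<Longrightarrow> l (c *\<^sub>R x) = c * l x"
    and bound: "\<And>x. x \<in> G \<Longrightarrow> \<bar>l x\<bar> \<le> K * norm x"
  shows "\<exists>w\<in>G. \<forall>v\<in>G. w \<bullet> v = l v"
proof -
  define J where "J x = (norm x)\<^sup>2 - 2 * l x" for x
  \<comment> \<open>Completing the square: J x \<ge> |x|^2 - 2K|x| = (|x| - K)^2 - K^2.\<close>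
  have lower: "- K\<^sup>2 \<le> J x" if "x \<in> G" for x
  proof -
    have "0 \<le> (norm x - K)\<^sup>2" by simp
    then show ?thesis using bound[OF that] by (simp add: J_def power2_diff mult.commute)
  qed
  have bdd: "bdd_below (J ` G)" using lower by (intro bdd_belowI2)
  define d where "d = Inf (J ` G)"
  have dle: "d \<le> J x" if "x \<in> G" for x
    unfolding d_def using bdd that by (simp add: cINF_lower)
  have ne: "J ` G \<noteq> {}" using subspace_0[OF G(1)] by auto
  have "\<exists>x\<in>G. J x < d + inverse (real (Suc k))" for k
  proof -
    have "Inf (J ` G) < d + inverse (real (Suc k))" by (simp add: d_def)
    then show ?thesis using cInf_lessD[OF ne] by blast
  qed
  then obtain x where xG: "\<And>k. x k \<in> G" and xJ: "\<And>k. J (x k) < d + inverse (real (Suc k))" by metis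
  \<comment> \<open>The terms in \<open>l\<close> are the same in 2 J u + 2 J v and in 4 J at the
    midpoint, so the difference of the two is |u - v|^2; the midpoint has energy at least
    \<open>d\<close>.\<close>
  have para: "(norm (u - v))\<^sup>2 \<le> 2 * (J u - d) + 2 * (J v - d)" if u: "u \<in> G" and v: "v \<in> G" for u v
  proof -
    have m: "(1/2) *\<^sub>R (u + v) \<in> G" using G u v by (simp add: subspace_add subspace_scale)
    have "l ((1/2) *\<^sub>R (u + v)) = (l u + l v) / 2"
      using scale[OF subspace_add[OF G(1) u v], of "1/2"] add[OF u v] by simp
    moreover have "(norm ((1/2) *\<^sub>R (u + v)))\<^sup>2 = ((norm u)\<^sup>2 + 2 * (u \<bullet> v) + (norm v)\<^sup>2) / 4"
      by (simp add: power2_norm_eq_inner inner_add_left inner_add_right inner_commute field_simps)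
    ultimately have "4 * J ((1/2) *\<^sub>R (u + v)) = (norm u)\<^sup>2 + 2 * (u \<bullet> v) + (norm v)\<^sup>2 - 4 * l u - 4 * l v"
      by (simp add: J_def field_simps)
    moreover have "(norm (u - v))\<^sup>2 = (norm u)\<^sup>2 - 2 * (u \<bullet> v) + (norm v)\<^sup>2"
      by (simp add: power2_norm_eq_inner inner_diff_left inner_diff_right inner_commute)
    ultimately show ?thesis using dle[OF m] by (simp add: J_def)
  qed
  have "Cauchy x"
  proof (rule metric_CauchyI)
    fix e :: real assume e: "e > 0"
    have arith: "p < q" if "p \<le> 2 * (A - d) + 2 * (B - d)" "A < d + i" "B < d + j" "i \<le> k" "j \<le> k" "k < q / 4"
      for p q A B i j k :: real using that by argo
    obtain M where M: "inverse (real (Suc M)) < e\<^sup>2 / 4"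
      using e reals_Archimedean[of "e\<^sup>2 / 4"] by auto
    show "\<exists>M. \<forall>m\<ge>M. \<forall>n\<ge>M. dist (x m) (x n) < e"
    proof (intro exI allI impI)
      fix m n assume mn: "M \<le> m" "M \<le> n"
      have "inverse (real (Suc m)) \<le> inverse (real (Suc M))" "inverse (real (Suc n)) \<le> inverse (real (Suc M))"
        using mn by (auto intro!: le_imp_inverse_le)
      then have "(norm (x m - x n))\<^sup>2 < e\<^sup>2"
        by (rule arith[OF para[OF xG[of m] xG[of n]] xJ[of m] xJ[of n] _ _ M])
      then show "dist (x m) (x n) < e" using e by (simp add: dist_norm power_less_imp_less_base)
    qed
  qed
  then obtain w where w: "x \<longlonglongrightarrow> w" using Cauchy_convergent convergent_def by blast
  have wG: "w \<in> G" using closed_sequentially[OF G(2)] xG w by blast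
  have "(\<lambda>k. l (x k)) \<longlonglongrightarrow> l w"
  proof -
    have diff: "l (x k - w) = l (x k) - l w" for k
      using add[of "x k - w" w] subspace_diff[OF G(1) xG wG] wG by simp
    have "(\<lambda>k. K * norm (x k - w)) \<longlonglongrightarrow> K * norm (w - w)" by (intro tendsto_intros w)
    then have "(\<lambda>k. K * norm (x k - w)) \<longlonglongrightarrow> 0" by simp
    then have "(\<lambda>k. l (x k) - l w) \<longlonglongrightarrow> 0"
      by (rule Lim_null_comparison[rotated]) (use bound[OF subspace_diff[OF G(1) xG wG]] diff in auto)
    then show ?thesis by (simp add: LIM_zero_iff)
  qed
  then have "(\<lambda>k. J (x k)) \<longlonglongrightarrow> J w" unfolding J_def by (intro tendsto_intros w)
  moreover have "(\<lambda>k. d + inverse (real (Suc k))) \<longlonglongrightarrow> d"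
    using tendsto_add[OF tendsto_const[of d] LIMSEQ_inverse_real_of_nat] by simp
  ultimately have Jw: "J w \<le> d"
    by (rule LIMSEQ_le) (use xJ in \<open>auto intro: less_imp_le\<close>)
  \<comment> \<open>Moving the minimiser in the direction \<open>v\<close> gives a quadratic
    polynomial in t that is nonnegative and vanishes at 0, so its linear coefficient is
    zero.\<close>
  have "w \<bullet> v = l v" if v: "v \<in> G" for v
  proof -
    have "w \<bullet> v - l v = 0"
    proof (rule nonneg_quadratic_linear_coeff_zero)
      fix t :: real
      have tv: "t *\<^sub>R v \<in> G" using G v by (simp add: subspace_scale)
      have "J w \<le> J (w + t *\<^sub>R v)" using Jw dle[OF subspace_add[OF G(1) wG tv]] by linarith
      also have "J (w + t *\<^sub>R v) = J w + (2 * t * (w \<bullet> v - l v) + t\<^sup>2 * (norm v)\<^sup>2)"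
        using add[OF wG tv] scale[OF v, of t]
        by (simp add: J_def norm_add_scaleR_power2 algebra_simps)
      finally show "0 \<le> 2 * t * (w \<bullet> v - l v) + t\<^sup>2 * (norm v)\<^sup>2" by simp
    qed
    then show ?thesis by simp
  qed
  then show ?thesis using wG by blast
qed

text \<open>The bound makes first components Cauchy as soon as the second ones are, so a limit of
  second components lifts to a limit in \<open>H\<close>. For the Sobolev space this says that
  gradients alone form a complete space.\<close>

lemma closed_snd_image:
  fixes H :: "('y::{real_inner,complete_space} \<times> 'z::{real_inner,complete_space}) set"
  assumes H: "subspace H" "closed H" and bound: "\<And>p. p \<in> H \<Longrightarrow> norm (fst p) \<le> C * norm (snd p)"
  shows "closed (snd ` H)"
  unfolding closed_sequential_limits
proof (intro allI impI, elim conjE)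
  fix z l assume z: "\<forall>n::nat. z n \<in> snd ` H" and lim: "z \<longlonglongrightarrow> l"
  from z obtain p where p: "\<And>n. p n \<in> H" "\<And>n. z n = snd (p n)" unfolding image_iff by metis
  have "Cauchy z" using lim by (rule LIMSEQ_imp_Cauchy)
  have "Cauchy (\<lambda>n. fst (p n))"
  proof (rule metric_CauchyI)
    fix e :: real assume e: "e > 0"
    \<comment> \<open>No sign is assumed of \<open>C\<close>; \<bar>C\<bar> + 1 is a positive upper
      bound.\<close>
    then have "e / (\<bar>C\<bar> + 1) > 0" by simp
    with \<open>Cauchy z\<close> obtain M where M: "\<And>m n. m \<ge> M \<Longrightarrow> n \<ge> M \<Longrightarrow> dist (z m) (z n) < e / (\<bar>C\<bar> + 1)"
      by (meson metric_CauchyD)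
    have "dist (fst (p m)) (fst (p n)) < e" if "m \<ge> M" "n \<ge> M" for m n
    proof -
      have "norm (fst (p m - p n)) \<le> C * norm (snd (p m - p n))"
        by (intro bound subspace_diff H p)
      also have "\<dots> \<le> (\<bar>C\<bar> + 1) * norm (snd (p m - p n))" by (intro mult_right_mono) auto
      also have "\<dots> = (\<bar>C\<bar> + 1) * dist (z m) (z n)" by (simp add: p dist_norm)
      also have "\<dots> < e" using M[OF that] by (simp add: field_simps)
      finally show ?thesis by (simp add: dist_norm)
    qed
    then show "\<exists>M. \<forall>m\<ge>M. \<forall>n\<ge>M. dist (fst (p m)) (fst (p n)) < e" by blast
  qed
  then obtain y where "(\<lambda>n. fst (p n)) \<longlonglongrightarrow> y" using Cauchy_convergent convergent_def by blast
  then have "(\<lambda>n. (fst (p n), z n)) \<longlonglongrightarrow> (y, l)" using lim by (rule tendsto_Pair)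
  then have "p \<longlonglongrightarrow> (y, l)" by (simp add: p)
  then have "(y, l) \<in> H" using closed_sequentially[OF H(2)] p by blast
  then show "l \<in> snd ` H" by force
qed

text \<open>By \<open>bound\<close>, \<open>snd\<close> is injective on \<open>H\<close>, so the
  problem moves to the Hilbert space \<open>G\<close> of second components, normed by the gradient
  alone. There the variational identity says that \<open>snd p\<close> is the Riesz representative
  of a functional depending on \<open>p\<close> through \<open>N p\<close>, which is a fixed point
  equation.\<close>

theorem lipschitz_perturbation_unique_solution:
  fixes H :: "('y::{real_inner,complete_space} \<times> 'z::{real_inner,complete_space}) set"
    and N :: "'y \<times> 'z \<Rightarrow> 'y"
  assumes H: "subspace H" "closed H"
    and bound: "\<And>p. p \<in> H \<Longrightarrow> norm (fst p) \<le> C * norm (snd p)"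
    and lip: "\<And>p q. norm (N p - N q) \<le> C1 * norm (fst p - fst q) + C2 * norm (snd p - snd q)"
    and pos: "0 \<le> C" "0 \<le> C1" "0 \<le> C2"
    and small: "C1 * C\<^sup>2 + C2 * C < 1"
  shows "\<exists>!p. p \<in> H \<and> (\<forall>q\<in>H. snd p \<bullet> snd q + N p \<bullet> fst q = 0)"
proof -
  define G where "G = snd ` H"
  have G: "subspace G" "closed G"
    unfolding G_def using closed_snd_image[OF H bound] H(1)
    by (auto intro!: linear_subspace_image linear_snd)
  have inj: "p = q" if "p \<in> H" "q \<in> H" "snd p = snd q" for p q
  proof -
    have "norm (fst (p - q)) \<le> C * norm (snd (p - q))" using that H by (intro bound subspace_diff)
    with that show ?thesis by (simp add: prod_eq_iff)
  qed
  \<comment> \<open>The inverse of \<open>snd\<close> on \<open>H\<close>, meaningful and linear on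
    \<open>G\<close>: it recovers the function from its gradient.\<close>
  define S where "S z = (THE p. p \<in> H \<and> snd p = z)" for z
  have S: "S (snd p) = p" if "p \<in> H" for p
    unfolding S_def using that inj by (intro the_equality) auto
  have SG: "S z \<in> H" "snd (S z) = z" if "z \<in> G" for z
    using that S unfolding G_def by auto
  have Sadd: "S (a + b) = S a + S b" if "a \<in> G" "b \<in> G" for a b
    using that SG S[of "S a + S b"] H by (simp add: subspace_add)
  have Sscale: "S (c *\<^sub>R a) = c *\<^sub>R S a" if "a \<in> G" for a c
    using that SG S[of "c *\<^sub>R S a"] H by (simp add: subspace_scale)
  have Sdiff: "S (a - b) = S a - S b" if "a \<in> G" "b \<in> G" for a b
    using that SG S[of "S a - S b"] H by (simp add: subspace_diff)
  have Sbound: "norm (fst (S z)) \<le> C * norm z" if "z \<in> G" for z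
    using bound[of "S z"] SG[OF that] by simp
  \<comment> \<open>The linear problem with the nonlinearity frozen at the pair over
    \<open>z\<close>; its solution is \<open>T z\<close>.\<close>
  have "\<exists>w\<in>G. \<forall>v\<in>G. w \<bullet> v = - (N (S z) \<bullet> fst (S v))" for z
  proof (rule riesz_closed_subspace[OF G, where K = "norm (N (S z)) * C"])
    fix x assume x: "x \<in> G"
    have "\<bar>N (S z) \<bullet> fst (S x)\<bar> \<le> norm (N (S z)) * norm (fst (S x))" by (rule Cauchy_Schwarz_ineq2)
    also have "\<dots> \<le> norm (N (S z)) * (C * norm x)" using Sbound[OF x] by (intro mult_left_mono) auto
    finally show "\<bar>- (N (S z) \<bullet> fst (S x))\<bar> \<le> norm (N (S z)) * C * norm x" by (simp add: mult.assoc)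
  qed (auto simp: Sadd Sscale inner_add_right)
  then obtain T where TG: "\<And>z. T z \<in> G" and T: "\<And>z v. v \<in> G \<Longrightarrow> T z \<bullet> v = - (N (S z) \<bullet> fst (S v))"
    by metis
  define c where "c = C1 * C\<^sup>2 + C2 * C"
  have "\<exists>!z\<in>G. T z = z"
  proof (rule Banach_fix[where c = c])
    show "complete G" using G(2) by (simp add: complete_eq_closed)
    show "G \<noteq> {}" using subspace_0[OF G(1)] by auto
    show "0 \<le> c" "c < 1" using pos small by (auto simp: c_def)
    show "T ` G \<subseteq> G" using TG by auto
    show "dist (T a) (T b) \<le> c * dist a b" if "a \<in> G" "b \<in> G" for a b
    proof -
      define v where "v = T a - T b"
      have vG: "v \<in> G" unfolding v_def by (intro subspace_diff G TG)
      have "N (S a) - N (S b) = - (N (S b) - N (S a))" by simp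
      have "(norm v)\<^sup>2 = T a \<bullet> v - T b \<bullet> v"
        by (simp add: power2_norm_eq_inner v_def inner_diff_left)
      also have "\<dots> = (N (S b) - N (S a)) \<bullet> fst (S v)" by (simp add: T[OF vG] inner_diff_left)
      also have "\<dots> \<le> norm (N (S b) - N (S a)) * norm (fst (S v))" by (rule norm_cauchy_schwarz)
      \<comment> \<open>The quotient \<open>c / C\<close> is C1 C + C2, the Lipschitz constant of
        \<open>N\<close> in terms of gradients; the other factor C |v| bounds the test function. The
        division forces a separate treatment of \<open>C = 0\<close>.\<close>
      also have "\<dots> \<le> (c / C * dist a b) * (C * norm v)" if "C \<noteq> 0"
      proof (rule mult_mono)
        have "norm (N (S b) - N (S a)) \<le> C1 * norm (fst (S b) - fst (S a)) + C2 * norm (snd (S b) - snd (S a))"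
          by (rule lip)
        also have "\<dots> = C1 * norm (fst (S (b - a))) + C2 * norm (b - a)"
          using \<open>a \<in> G\<close> \<open>b \<in> G\<close> by (simp add: Sdiff SG)
        also have "\<dots> \<le> C1 * (C * norm (b - a)) + C2 * norm (b - a)"
          using \<open>a \<in> G\<close> \<open>b \<in> G\<close> pos by (intro add_right_mono mult_left_mono Sbound subspace_diff G) auto
        also have "\<dots> = c / C * dist a b"
          using that by (simp add: c_def dist_norm norm_minus_commute field_simps power2_eq_square)
        finally show "norm (N (S b) - N (S a)) \<le> c / C * dist a b" .
      qed (use pos Sbound[OF vG] in \<open>auto simp: c_def\<close>)
      finally have *: "(norm v)\<^sup>2 \<le> c * dist a b * norm v" if "C \<noteq> 0"
        using that by (simp add: mult.assoc)
      have "norm v \<le> c * dist a b"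
      proof (cases "C = 0 \<or> v = 0")
        case True
        \<comment> \<open>For \<open>C = 0\<close> the first component over \<open>v\<close>
          vanishes, so \<open>T a\<close> and \<open>T b\<close> are both orthogonal to
          \<open>v\<close>, which is their difference.\<close>
        have "v = 0" if "C = 0"
        proof -
          have "fst (S v) = 0" using Sbound[OF vG] that by simp
          then have "v \<bullet> v = 0" using T[OF vG, of a] T[OF vG, of b] by (simp add: v_def inner_diff_left)
          then show ?thesis by simp
        qed
        with True show ?thesis using \<open>0 \<le> c\<close> by auto
      next
        case False
        with * show ?thesis by (simp add: power2_eq_square)
      qed
      then show ?thesis by (simp add: v_def dist_norm)
    qed
  qed
  \<comment> \<open>The identity makes \<open>snd p - T (snd p)\<close> orthogonal to
    \<open>G\<close>, to which it belongs; so it is zero.\<close>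
  moreover have "(p \<in> H \<and> (\<forall>q\<in>H. snd p \<bullet> snd q + N p \<bullet> fst q = 0)) \<longleftrightarrow>
      p \<in> H \<and> T (snd p) = snd p" for p
  proof (intro conj_cong refl)
    assume p: "p \<in> H"
    have "(\<forall>q\<in>H. snd p \<bullet> snd q + N p \<bullet> fst q = 0) \<longleftrightarrow> (\<forall>v\<in>G. (snd p - T (snd p)) \<bullet> v = 0)"
      unfolding G_def using p by (auto simp: inner_diff_left T G_def S)
    also have "\<dots> \<longleftrightarrow> T (snd p) = snd p"
    proof
      assume *: "\<forall>v\<in>G. (snd p - T (snd p)) \<bullet> v = 0"
      have "snd p - T (snd p) \<in> G" using p by (intro subspace_diff G TG) (auto simp: G_def)
      with * have "(snd p - T (snd p)) \<bullet> (snd p - T (snd p)) = 0" by blast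
      then show "T (snd p) = snd p" by simp
    qed auto
    finally show "(\<forall>q\<in>H. snd p \<bullet> snd q + N p \<bullet> fst q = 0) \<longleftrightarrow> T (snd p) = snd p" .
  qed
  ultimately show ?thesis
    unfolding G_def by (smt (verit, best) inj image_iff)
qed

section \<open>Compactness from finitely many functionals\<close>

text \<open>Rounding each value down to the grid of mesh \<open>e\<close> leaves finitely many
  patterns, the values being bounded by \<open>M\<close>; one point for each pattern that occurs
  forms the net.\<close>

lemma finite_net_of_bounded_functions:
  fixes l :: "'j \<Rightarrow> 's \<Rightarrow> real"
  assumes "finite J" "\<And>j x. j \<in> J \<Longrightarrow> x \<in> S \<Longrightarrow> \<bar>l j x\<bar> \<le> M" "e > 0"
  shows "\<exists>F. finite F \<and> F \<subseteq> S \<and> (\<forall>x\<in>S. \<exists>y\<in>F. \<forall>j\<in>J. \<bar>l j x - l j y\<bar> < e)"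
proof -
  define k where "k x = (\<lambda>j\<in>J. \<lfloor>l j x / e\<rfloor>)" for x
  have "k ` S \<subseteq> PiE J (\<lambda>_. {\<lfloor>- M / e\<rfloor>..\<lfloor>M / e\<rfloor>})"
  proof (intro image_subsetI PiE_I)
    fix x j assume "x \<in> S" "j \<in> J"
    then have "- M \<le> l j x" "l j x \<le> M" using assms(2)[of j x] by auto
    then show "k x j \<in> {\<lfloor>- M / e\<rfloor>..\<lfloor>M / e\<rfloor>}"
      using \<open>j \<in> J\<close> \<open>e > 0\<close> unfolding k_def
      by (auto intro!: floor_mono divide_right_mono simp del: minus_divide_left divide_minus_left)
  qed (auto simp: k_def)
  then have fin: "finite (k ` S)" by (rule finite_subset) (simp add: finite_PiE assms)
  have inv: "inv_into S k (k x) \<in> S" "k (inv_into S k (k x)) = k x" if "x \<in> S" for x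
    using that by (auto simp: inv_into_into f_inv_into_f)
  have "\<bar>l j x - l j y\<bar> < e" if "k y = k x" "j \<in> J" for x y j
  proof -
    have "\<lfloor>l j x / e\<rfloor> = \<lfloor>l j y / e\<rfloor>" using fun_cong[OF that(1), of j] that(2) by (simp add: k_def)
    then have "\<bar>l j x / e - l j y / e\<bar> < 1" by linarith
    then show ?thesis using \<open>e > 0\<close> by (simp add: diff_divide_distrib[symmetric] abs_divide)
  qed
  then have "\<forall>x\<in>S. \<exists>y\<in>inv_into S k ` k ` S. \<forall>j\<in>J. \<bar>l j x - l j y\<bar> < e"
    using inv(2) by (metis imageI)
  moreover have "finite (inv_into S k ` k ` S)" "inv_into S k ` k ` S \<subseteq> S" using fin inv by auto
  ultimately show ?thesis by blast
qed

text \<open>Finitely many linear functionals see the first component up to an arbitrarily small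
  multiple of the second. On a ball the second component is bounded, so a net for these finitely
  many coordinates is a net in norm.\<close>

lemma compact_fst_of_finite_functionals:
  fixes H :: "('y::{real_inner,complete_space} \<times> 'z::{real_inner,complete_space}) set"
  assumes H: "subspace H"
    and fin: "\<And>e. e > 0 \<Longrightarrow> \<exists>(W::'j set) v. finite W \<and>
           (\<forall>p\<in>H. (norm (fst p))\<^sup>2 \<le> (\<Sum>w\<in>W. (fst p \<bullet> v w)\<^sup>2) + e * (norm (snd p))\<^sup>2)"
  shows "compact (closure (fst ` {p\<in>H. norm p \<le> M}))"
  unfolding compact_eq_totally_bounded
proof (intro conjI allI impI)
  let ?S = "{p\<in>H. norm p \<le> M}"
  show "complete (closure (fst ` ?S))" by (simp add: complete_eq_closed)
  fix e :: real assume e: "e > 0"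
  \<comment> \<open>The net is built from closed balls of radius e/2: their finite union is closed,
    hence contains the closure as well, and each lies in the open ball of radius
    \<open>e\<close>.\<close>
  define d where "d = e / 2"
  have d: "d > 0" using e by (simp add: d_def)
  \<comment> \<open>Two points of the ball differ by at most 2\<bar>M\<bar>, so the gradient term of
    their difference contributes at most d^2/2; the added 1 avoids division by zero for
    \<open>M = 0\<close>.\<close>
  define e' where "e' = d\<^sup>2 / (2 * ((2 * \<bar>M\<bar>)\<^sup>2 + 1))"
  have M1: "(2 * \<bar>M\<bar>)\<^sup>2 + 1 > 0" by (smt (verit) zero_le_power2)
  have e': "e' > 0" using d M1 by (simp add: e'_def)
  obtain W :: "'j set" and v where W: "finite W"
    "\<And>p. p \<in> H \<Longrightarrow> (norm (fst p))\<^sup>2 \<le> (\<Sum>w\<in>W. (fst p \<bullet> v w)\<^sup>2) + e' * (norm (snd p))\<^sup>2"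
    using fin[OF e'] by blast
  define B where "B = \<bar>M\<bar> * (\<Sum>w\<in>W. norm (v w))"
  have lB: "\<bar>fst p \<bullet> v w\<bar> \<le> B" if "w \<in> W" "p \<in> ?S" for w p
  proof -
    have "\<bar>fst p \<bullet> v w\<bar> \<le> norm (fst p) * norm (v w)" by (rule Cauchy_Schwarz_ineq2)
    also have "\<dots> \<le> \<bar>M\<bar> * (\<Sum>w\<in>W. norm (v w))"
      using that W(1) norm_fst_le[of "fst p" "snd p"] by (intro mult_mono) (auto intro: member_le_sum)
    finally show ?thesis by (simp add: B_def)
  qed
  \<comment> \<open>Chosen so that \<open>card W\<close> squares of size t^2 sum to at most d^2/2;
    the added 1 covers an empty \<open>W\<close>.\<close>
  define t where "t = d / (2 * (real (card W) + 1))"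
  have t: "t > 0" using d by (simp add: t_def)
  have "\<exists>F. finite F \<and> F \<subseteq> ?S \<and> (\<forall>x\<in>?S. \<exists>y\<in>F. \<forall>w\<in>W. \<bar>fst x \<bullet> v w - fst y \<bullet> v w\<bar> < t)"
    by (rule finite_net_of_bounded_functions[where M = B, OF W(1) lB t])
  then obtain F where F: "finite F" "F \<subseteq> ?S"
    "\<forall>x\<in>?S. \<exists>y\<in>F. \<forall>w\<in>W. \<bar>fst x \<bullet> v w - fst y \<bullet> v w\<bar> < t" by (elim exE conjE)
  have near: "\<exists>y\<in>F. dist (fst x) (fst y) \<le> d" if x: "x \<in> ?S" for x
  proof -
    from bspec[OF F(3) x] obtain y where y: "y \<in> F" "\<And>w. w \<in> W \<Longrightarrow> \<bar>fst x \<bullet> v w - fst y \<bullet> v w\<bar> < t" by blast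
    have yS: "y \<in> ?S" using y F by auto
    have "(norm (fst (x - y)))\<^sup>2 \<le> (\<Sum>w\<in>W. (fst (x - y) \<bullet> v w)\<^sup>2) + e' * (norm (snd (x - y)))\<^sup>2"
      using x yS H by (intro W subspace_diff) auto
    also have "(\<Sum>w\<in>W. (fst (x - y) \<bullet> v w)\<^sup>2) \<le> (\<Sum>w\<in>W. t\<^sup>2)"
    proof (rule sum_mono)
      fix w assume "w \<in> W"
      then have "\<bar>fst (x - y) \<bullet> v w\<bar> \<le> \<bar>t\<bar>" using y(2)[of w] by (simp add: inner_diff_left)
      then show "(fst (x - y) \<bullet> v w)\<^sup>2 \<le> t\<^sup>2" by (simp add: abs_le_square_iff)
    qed
    also have "(\<Sum>w\<in>W. t\<^sup>2) \<le> d\<^sup>2 / 2"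
    proof -
      have "real (card W) * t\<^sup>2 \<le> 2 * (real (card W) + 1)\<^sup>2 * t\<^sup>2"
        by (intro mult_right_mono) (auto simp: power2_eq_square algebra_simps)
      also have "\<dots> = 2 * ((real (card W) + 1) * t)\<^sup>2" by (simp add: power_mult_distrib)
      also have "(real (card W) + 1) * t = d / 2"
        by (simp add: t_def nonzero_divide_eq_eq add_pos_nonneg[THEN less_imp_neq, symmetric] algebra_simps)
      also have "2 * (d / 2)\<^sup>2 = d\<^sup>2 / 2" by (simp add: power_divide)
      finally show ?thesis by simp
    qed
    also have "e' * (norm (snd (x - y)))\<^sup>2 \<le> d\<^sup>2 / 2"
    proof -
      have "norm (snd (x - y)) \<le> norm (x - y)" using norm_snd_le[of "snd (x-y)" "fst (x-y)"] by (simp only: prod.collapse)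
      also have "\<dots> \<le> 2 * \<bar>M\<bar>" using norm_triangle_ineq4[of x y] x yS by auto
      finally have "(norm (snd (x - y)))\<^sup>2 \<le> (2 * \<bar>M\<bar>)\<^sup>2 + 1"
        using power_mono[of "norm (snd (x - y))" "2 * \<bar>M\<bar>" 2] by simp
      then have "e' * (norm (snd (x - y)))\<^sup>2 \<le> e' * ((2 * \<bar>M\<bar>)\<^sup>2 + 1)" using e' by (intro mult_left_mono) auto
      also have "\<dots> = d\<^sup>2 / 2"
      proof -
        have "x / (2 * q) * q = x / 2" if "q > 0" for x q :: real using that by simp
        from this[OF M1] show ?thesis by (simp add: e'_def)
      qed
      finally show ?thesis .
    qed
    finally have "(norm (fst (x - y)))\<^sup>2 \<le> d\<^sup>2" by simp
    then have "norm (fst (x - y)) \<le> d" by (rule power2_le_imp_le) (use d in simp)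
    then show ?thesis using y by (auto simp: dist_norm)
  qed
  have "closure (fst ` ?S) \<subseteq> (\<Union>c\<in>fst ` F. cball c d)"
  proof (rule closure_minimal)
    show "fst ` ?S \<subseteq> (\<Union>c\<in>fst ` F. cball c d)" using near by (force simp: dist_commute)
    show "closed (\<Union>c\<in>fst ` F. cball c d)" using F by auto
  qed
  also have "\<dots> \<subseteq> (\<Union>c\<in>fst ` F. ball c e)" using e by (force simp: d_def)
  finally show "\<exists>k. finite k \<and> closure (fst ` ?S) \<subseteq> (\<Union>x\<in>k. ball x e)" using F by blast
qed

section \<open>Attainment of the Rayleigh quotient\<close>

text \<open>Compactness is used for the first components of a minimising sequence. Once they
  converge, the parallelogram law, with the Rayleigh bound applied to the sum of two members, makes
  the second components Cauchy, so strong convergence is obtained without weak limits. The last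
  conclusion is the Euler-Lagrange equation of the minimiser.\<close>

theorem rayleigh_minimizer:
  fixes H :: "('y::{real_inner,complete_space} \<times> 'z::{real_inner,complete_space}) set"
  assumes H: "subspace H" "closed H"
    and bound: "\<And>p. p \<in> H \<Longrightarrow> norm (fst p) \<le> K * norm (snd p)"
    and comp: "\<And>M. compact (closure (fst ` {p\<in>H. norm p \<le> M}))"
    and nontriv: "\<exists>p\<in>H. fst p \<noteq> 0"
  obtains m p where "m > 0" "p \<in> H" "fst p \<noteq> 0"
    "\<And>q. q \<in> H \<Longrightarrow> m * (norm (fst q))\<^sup>2 \<le> (norm (snd q))\<^sup>2"
    "\<And>q. q \<in> H \<Longrightarrow> snd p \<bullet> snd q = m * (fst p \<bullet> fst q)"
proof -
  define U where "U = {p\<in>H. norm (fst p) = 1}"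
  define m where "m = Inf ((\<lambda>p. (norm (snd p))\<^sup>2) ` U)"
  have bdd: "bdd_below ((\<lambda>p. (norm (snd p))\<^sup>2) ` U)" by (rule bdd_belowI2[of _ 0]) simp
  have le: "m * (norm (fst q))\<^sup>2 \<le> (norm (snd q))\<^sup>2" if q: "q \<in> H" for q
  proof (cases "fst q = 0")
    case False
    define s where "s = inverse (norm (fst q))"
    have "s *\<^sub>R q \<in> U" using q False H by (simp add: U_def subspace_scale s_def)
    then have "m \<le> (norm (snd (s *\<^sub>R q)))\<^sup>2" unfolding m_def using bdd by (rule cINF_lower[rotated])
    also have "\<dots> = (norm (snd q))\<^sup>2 / (norm (fst q))\<^sup>2"
      using False by (simp add: s_def power_divide field_simps)
    finally show ?thesis using False by (simp add: field_simps)
  qed simp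
  obtain q0 where q0: "q0 \<in> H" "fst q0 \<noteq> 0" using nontriv by blast
  have "inverse (norm (fst q0)) *\<^sub>R q0 \<in> U" using q0 H by (simp add: U_def subspace_scale)
  then have ne: "(\<lambda>p. (norm (snd p))\<^sup>2) ` U \<noteq> {}" by blast
  have "\<exists>x\<in>U. (norm (snd x))\<^sup>2 < m + inverse (real (Suc k))" for k
  proof -
    have "Inf ((\<lambda>p. (norm (snd p))\<^sup>2) ` U) < m + inverse (real (Suc k))" by (simp add: m_def)
    then show ?thesis using cInf_lessD[OF ne] by blast
  qed
  then obtain x where xU: "\<And>k. x k \<in> U" and xm: "\<And>k. (norm (snd (x k)))\<^sup>2 < m + inverse (real (Suc k))"
    by metis
  have xH: "x k \<in> H" and x1: "norm (fst (x k)) = 1" for k using xU by (auto simp: U_def)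
  have lim: "(\<lambda>k. (norm (snd (x k)))\<^sup>2) \<longlonglongrightarrow> m"
  proof (rule tendsto_sandwich)
    show "\<forall>\<^sub>F k in sequentially. m \<le> (norm (snd (x k)))\<^sup>2" using le[OF xH] x1 by simp
    show "\<forall>\<^sub>F k in sequentially. (norm (snd (x k)))\<^sup>2 \<le> m + inverse (real (Suc k))"
      using xm by (simp add: less_imp_le)
    show "(\<lambda>k. m + inverse (real (Suc k))) \<longlonglongrightarrow> m"
      using tendsto_add[OF tendsto_const[of m] LIMSEQ_inverse_real_of_nat] by simp
  qed simp
  have "norm (x k) \<le> sqrt (1 + (m + 1))" for k
  proof -
    have "inverse (real (Suc k)) \<le> 1" by (simp add: inverse_le_1_iff)
    then have "(norm (snd (x k)))\<^sup>2 \<le> m + 1" using xm[of k] by linarith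
    then show ?thesis using x1[of k] by (simp add: norm_prod_def)
  qed
  then have "\<forall>k. fst (x k) \<in> closure (fst ` {p\<in>H. norm p \<le> sqrt (1 + (m + 1))})"
    using xH closure_subset by fastforce
  then obtain y r where r: "strict_mono (r::nat\<Rightarrow>nat)" and y: "((\<lambda>k. fst (x k)) \<circ> r) \<longlonglongrightarrow> y"
    by (rule seq_compactE[OF comp[of "sqrt (1 + (m + 1))", unfolded compact_eq_seq_compact_metric]])
  define z where "z = x \<circ> r"
  have zH: "z k \<in> H" and z1: "norm (fst (z k)) = 1" for k using xH x1 by (auto simp: z_def)
  have zy: "(\<lambda>k. fst (z k)) \<longlonglongrightarrow> y" using y by (simp add: z_def o_def)
  have zm: "(\<lambda>k. (norm (snd (z k)))\<^sup>2) \<longlonglongrightarrow> m"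
    using LIMSEQ_subseq_LIMSEQ[OF lim r] by (simp add: z_def o_def)
  have "Cauchy (\<lambda>k. snd (z k))"
  proof (rule metric_CauchyI)
    fix e :: real assume e: "e > 0"
    \<comment> \<open>The parallelogram estimate below leaves 4(m + a) - m(4 - a) = (4 + m)a, which
      this choice makes equal to e^2.\<close>
    define a where "a = e\<^sup>2 / (4 + \<bar>m\<bar>)"
    have a: "a > 0" using e by (auto simp: a_def intro!: divide_pos_pos)
    have "\<forall>\<^sub>F k in sequentially. (norm (snd (z k)))\<^sup>2 < m + a" using zm a by (simp add: order_tendstoD)
    then obtain M1 where M1: "\<And>k. k \<ge> M1 \<Longrightarrow> (norm (snd (z k)))\<^sup>2 < m + a"
      unfolding eventually_sequentially by blast
    have "Cauchy (\<lambda>k. fst (z k))" using zy by (rule LIMSEQ_imp_Cauchy)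
    then obtain M2 where M2: "\<And>k l. k \<ge> M2 \<Longrightarrow> l \<ge> M2 \<Longrightarrow> dist (fst (z k)) (fst (z l)) < sqrt a"
      using a by (meson metric_CauchyD real_sqrt_gt_0_iff)
    have "dist (snd (z k)) (snd (z l)) < e" if k: "k \<ge> max M1 M2" and l: "l \<ge> max M1 M2" for k l
    proof -
      have "norm (fst (z k) - fst (z l)) < sqrt a" using M2[of k l] k l by (simp add: dist_norm)
      then have "(norm (fst (z k) - fst (z l)))\<^sup>2 < a" using a
        by (metis norm_ge_zero real_less_rsqrt real_sqrt_abs abs_of_nonneg real_sqrt_less_iff)
      \<comment> \<open>Two unit vectors that nearly coincide have a sum of norm nearly 2.\<close>
      then have A: "(norm (fst (z k + z l)))\<^sup>2 > 4 - a"
        using parallelogram_law[of "fst (z k)" "fst (z l)"] z1 by simp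
      have m0: "m \<ge> 0" using zm by (rule LIMSEQ_le_const) auto
      have "(norm (snd (z k + z l)))\<^sup>2 \<ge> m * (norm (fst (z k + z l)))\<^sup>2"
        by (intro le subspace_add H zH)
      moreover have "m * (norm (fst (z k + z l)))\<^sup>2 \<ge> m * (4 - a)"
        using A m0 by (intro mult_left_mono) auto
      ultimately have "(norm (snd (z k) - snd (z l)))\<^sup>2 < 2 * (m + a) + 2 * (m + a) - m * (4 - a)"
        using M1[of k] M1[of l] k l parallelogram_law[of "snd (z k)" "snd (z l)"] by simp
      also have "\<dots> = (4 + \<bar>m\<bar>) * a" using m0 by (simp add: algebra_simps)
      also have "\<dots> = e\<^sup>2" by (simp add: a_def add_pos_nonneg[THEN less_imp_neq, symmetric])
      finally show ?thesis using e by (simp add: dist_norm power_less_imp_less_base)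
    qed
    then show "\<exists>M. \<forall>k\<ge>M. \<forall>l\<ge>M. dist (snd (z k)) (snd (z l)) < e" by blast
  qed
  then obtain w where zw: "(\<lambda>k. snd (z k)) \<longlonglongrightarrow> w" using Cauchy_convergent convergent_def by blast
  define p where "p = (y, w)"
  have "z \<longlonglongrightarrow> p" using tendsto_Pair[OF zy zw] by (simp add: p_def)
  then have pH: "p \<in> H" using closed_sequentially[OF H(2)] zH by blast
  have "(\<lambda>k. norm (fst (z k))) \<longlonglongrightarrow> norm y" by (intro tendsto_intros zy)
  then have y1: "norm y = 1" using z1 by (simp add: LIMSEQ_const_iff)
  have "(\<lambda>k. (norm (snd (z k)))\<^sup>2) \<longlonglongrightarrow> (norm w)\<^sup>2" by (intro tendsto_intros zw)
  then have wm: "(norm w)\<^sup>2 = m" using zm LIMSEQ_unique by blast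
  \<comment> \<open>A zero second component would force \<open>y = 0\<close> through
    \<open>bound\<close>, against \<open>y1\<close>. This is where positivity of the minimum comes
    from.\<close>
  have "w \<noteq> 0" using bound[OF pH] y1 by (auto simp: p_def)
  then have "m > 0" using wm by auto
  \<comment> \<open>The quadratic form |snd|^2 - m |fst|^2 is nonnegative on \<open>H\<close> and
    zero at \<open>p\<close>, so its first variation at \<open>p\<close> vanishes in every
    direction.\<close>
  have "snd p \<bullet> snd q = m * (fst p \<bullet> fst q)" if q: "q \<in> H" for q
  proof -
    have "snd p \<bullet> snd q - m * (fst p \<bullet> fst q) = 0"
    proof (rule nonneg_quadratic_linear_coeff_zero)
      fix t :: real
      have "m * (norm (fst (p + t *\<^sub>R q)))\<^sup>2 \<le> (norm (snd (p + t *\<^sub>R q)))\<^sup>2"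
        by (intro le subspace_add subspace_scale H pH q)
      then show "0 \<le> 2 * t * (snd p \<bullet> snd q - m * (fst p \<bullet> fst q)) + t\<^sup>2 * ((norm (snd q))\<^sup>2 - m * (norm (fst q))\<^sup>2)"
        using wm y1 by (simp add: p_def norm_add_scaleR_power2 algebra_simps)
    qed
    then show ?thesis by simp
  qed
  moreover have "fst p \<noteq> 0" using y1 by (auto simp: p_def)
  ultimately show ?thesis using that[of m p] \<open>m > 0\<close> pH le by blast
qed

section \<open>The Hilbert space of square-integrable functions\<close>

text \<open>Stated on the whole space, because a type of classes cannot depend on the set \<Omega>;
  functions on \<Omega> enter later through extension by zero.\<close>

definition square_integrable :: "('a::euclidean_space \<Rightarrow> 'b::euclidean_space) \<Rightarrow> bool" where
  "square_integrable f \<longleftrightarrow> f \<in> borel_measurable lebesgue \<and> integrable lebesgue (\<lambda>x. (norm (f x))\<^sup>2)"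

lemma square_integrable_0: "square_integrable (\<lambda>x. 0)"
  by (simp add: square_integrable_def)

lemma square_integrable_bound:
  fixes g :: "'a::euclidean_space \<Rightarrow> real"
  assumes "integrable lebesgue g" "f \<in> borel_measurable lebesgue" "\<And>x. (norm (f x))\<^sup>2 \<le> g x"
  shows "square_integrable f"
  unfolding square_integrable_def
proof
  show "integrable lebesgue (\<lambda>x. (norm (f x))\<^sup>2)"
    by (rule Bochner_Integration.integrable_bound[OF assms(1)])
      (use assms in \<open>auto intro!: AE_I2 intro: order_trans[OF _ abs_ge_self]\<close>)
qed (rule assms)

lemma square_integrable_add:
  assumes "square_integrable f" "square_integrable g"
  shows "square_integrable (\<lambda>x. f x + g x)"
proof (rule square_integrable_bound)
  show "integrable lebesgue (\<lambda>x. 2 * (norm (f x))\<^sup>2 + 2 * (norm (g x))\<^sup>2)"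
    using assms by (auto simp: square_integrable_def)
  show "(\<lambda>x. f x + g x) \<in> borel_measurable lebesgue"
    using assms by (auto simp: square_integrable_def)
  fix x
  have "(norm (f x + g x))\<^sup>2 \<le> (norm (f x) + norm (g x))\<^sup>2"
    by (intro power_mono norm_triangle_ineq) auto
  also have "\<dots> \<le> 2 * (norm (f x))\<^sup>2 + 2 * (norm (g x))\<^sup>2"
    using sum_squares_bound[of "norm (f x)" "norm (g x)"] by (simp add: power2_sum)
  finally show "(norm (f x + g x))\<^sup>2 \<le> 2 * (norm (f x))\<^sup>2 + 2 * (norm (g x))\<^sup>2" .
qed

lemma square_integrable_scaleR:
  "square_integrable f \<Longrightarrow> square_integrable (\<lambda>x. c *\<^sub>R f x)"
  by (auto simp: square_integrable_def power_mult_distrib)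

lemma square_integrable_minus:
  "square_integrable f \<Longrightarrow> square_integrable (\<lambda>x. - f x)"
  by (auto simp: square_integrable_def)

lemma square_integrable_diff:
  assumes "square_integrable f" "square_integrable g"
  shows "square_integrable (\<lambda>x. f x - g x)"
  using square_integrable_add[OF assms(1) square_integrable_minus[OF assms(2)]] by simp

lemma square_integrable_inner:
  assumes "square_integrable f" "square_integrable g"
  shows "integrable lebesgue (\<lambda>x. f x \<bullet> g x)"
proof (rule Bochner_Integration.integrable_bound)
  show "integrable lebesgue (\<lambda>x. (norm (f x))\<^sup>2 + (norm (g x))\<^sup>2)"
    using assms by (auto simp: square_integrable_def)
  show "(\<lambda>x. f x \<bullet> g x) \<in> borel_measurable lebesgue"
    using assms by (auto simp: square_integrable_def)
  have "\<bar>f x \<bullet> g x\<bar> \<le> (norm (f x))\<^sup>2 + (norm (g x))\<^sup>2" for x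
    using Cauchy_Schwarz_ineq2[of "f x" "g x"] sum_squares_bound[of "norm (f x)" "norm (g x)"]
      mult_nonneg_nonneg[OF norm_ge_zero norm_ge_zero, of "f x" "g x"] by linarith
  then show "AE x in lebesgue. norm (f x \<bullet> g x) \<le> norm ((norm (f x))\<^sup>2 + (norm (g x))\<^sup>2)" by simp
qed

text \<open>Only a partial equivalence: being reflexive exactly at the square-integrable functions,
  it selects the carrier of the quotient and identifies a.e. equal functions in one step.\<close>

definition l2_eq :: "('a::euclidean_space \<Rightarrow> 'b::euclidean_space) \<Rightarrow> ('a \<Rightarrow> 'b) \<Rightarrow> bool" where
  "l2_eq f g \<longleftrightarrow> square_integrable f \<and> square_integrable g \<and> (AE x in lebesgue. f x = g x)"

lemma part_equivp_l2_eq: "part_equivp l2_eq"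
proof (rule part_equivpI)
  show "\<exists>f. l2_eq f f" using square_integrable_0 unfolding l2_eq_def by auto
  show "symp l2_eq" by (auto simp: symp_def l2_eq_def elim: eventually_mono)
  show "transp l2_eq" by (auto simp: transp_def l2_eq_def elim: eventually_elim2)
qed

quotient_type (overloaded) ('a, 'b) l2 = "'a::euclidean_space \<Rightarrow> 'b::euclidean_space" / partial: l2_eq
  by (rule part_equivp_l2_eq)

instantiation l2 :: (euclidean_space, euclidean_space) real_vector
begin

lift_definition zero_l2 :: "('a, 'b) l2" is "\<lambda>_. 0"
  using square_integrable_0 by (auto simp: l2_eq_def)

lift_definition plus_l2 :: "('a, 'b) l2 \<Rightarrow> ('a, 'b) l2 \<Rightarrow> ('a, 'b) l2" is "\<lambda>f g x. f x + g x"
  by (auto simp: l2_eq_def square_integrable_add elim: eventually_elim2)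

lift_definition uminus_l2 :: "('a, 'b) l2 \<Rightarrow> ('a, 'b) l2" is "\<lambda>f x. - f x"
  by (auto simp: l2_eq_def square_integrable_minus elim: eventually_mono)

lift_definition minus_l2 :: "('a, 'b) l2 \<Rightarrow> ('a, 'b) l2 \<Rightarrow> ('a, 'b) l2" is "\<lambda>f g x. f x - g x"
  by (auto simp: l2_eq_def square_integrable_diff elim: eventually_elim2)

lift_definition scaleR_l2 :: "real \<Rightarrow> ('a, 'b) l2 \<Rightarrow> ('a, 'b) l2" is "\<lambda>c f x. c *\<^sub>R f x"
  by (auto simp: l2_eq_def square_integrable_scaleR elim: eventually_mono)

instance
proof
  fix a b c :: "('a, 'b) l2" and r s :: real
  show "a + b + c = a + (b + c)"
    by transfer (auto simp: l2_eq_def square_integrable_add algebra_simps)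
  show "a + b = b + a"
    by transfer (auto simp: l2_eq_def square_integrable_add algebra_simps)
  show "0 + a = a"
    by transfer (auto simp: l2_eq_def)
  show "- a + a = 0"
    by transfer (auto simp: l2_eq_def square_integrable_0)
  show "a - b = a + - b"
    by transfer (auto simp: l2_eq_def square_integrable_diff)
  show "r *\<^sub>R (a + b) = r *\<^sub>R a + r *\<^sub>R b"
    by transfer (auto simp: l2_eq_def square_integrable_scaleR square_integrable_add scaleR_right_distrib)
  show "(r + s) *\<^sub>R a = r *\<^sub>R a + s *\<^sub>R a"
    by transfer (auto simp: l2_eq_def square_integrable_scaleR square_integrable_add scaleR_left_distrib)
  show "r *\<^sub>R s *\<^sub>R a = (r * s) *\<^sub>R a"
    by transfer (auto simp: l2_eq_def square_integrable_scaleR)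
  show "1 *\<^sub>R a = a"
    by transfer (auto simp: l2_eq_def)
qed

end

instantiation l2 :: (euclidean_space, euclidean_space) real_inner
begin

lift_definition inner_l2 :: "('a, 'b) l2 \<Rightarrow> ('a, 'b) l2 \<Rightarrow> real" is
  "\<lambda>f g. LINT x|lebesgue. f x \<bullet> g x"
proof -
  fix f f' g g' :: "'a \<Rightarrow> 'b"
  assume *: "l2_eq f f'" "l2_eq g g'"
  then have "AE x in lebesgue. f x \<bullet> g x = f' x \<bullet> g' x"
    by (auto simp: l2_eq_def elim: eventually_elim2)
  then show "(LINT x|lebesgue. f x \<bullet> g x) = (LINT x|lebesgue. f' x \<bullet> g' x)"
    using * by (intro integral_cong_AE) (auto simp: l2_eq_def square_integrable_def)
qed

definition "norm (a :: ('a, 'b) l2) = sqrt (a \<bullet> a)"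
definition "dist (a :: ('a, 'b) l2) b = norm (a - b)"
definition "sgn (a :: ('a, 'b) l2) = inverse (norm a) *\<^sub>R a"
definition "(uniformity :: (('a, 'b) l2 \<times> ('a, 'b) l2) filter) = (INF e\<in>{0<..}. principal {(x, y). dist x y < e})"
definition "open (U :: ('a, 'b) l2 set) \<longleftrightarrow> (\<forall>x\<in>U. \<forall>\<^sub>F (x', y) in uniformity. x' = x \<longrightarrow> y \<in> U)"

instance
proof
  fix a b c :: "('a, 'b) l2" and r :: real and U :: "('a, 'b) l2 set"
  show "dist a b = norm (a - b)" by (rule dist_l2_def)
  show "sgn a = a /\<^sub>R norm a" by (simp add: sgn_l2_def)
  show "(uniformity :: (('a, 'b) l2 \<times> ('a, 'b) l2) filter) = (INF e\<in>{0<..}. principal {(x, y). dist x y < e})"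
    by (rule uniformity_l2_def)
  show "open U \<longleftrightarrow> (\<forall>x\<in>U. \<forall>\<^sub>F (x', y) in uniformity. x' = x \<longrightarrow> y \<in> U)" by (rule open_l2_def)
  show "a \<bullet> b = b \<bullet> a" by transfer (simp add: inner_commute)
  show "(a + b) \<bullet> c = a \<bullet> c + b \<bullet> c"
    by transfer (auto simp: l2_eq_def inner_add_left intro!: Bochner_Integration.integral_add square_integrable_inner)
  show "(r *\<^sub>R a) \<bullet> b = r * (a \<bullet> b)"
    by transfer simp
  show "0 \<le> a \<bullet> a"
    by transfer (auto intro!: integral_nonneg_AE)
  show "a \<bullet> a = 0 \<longleftrightarrow> a = 0"
  proof transfer
    fix f :: "'a \<Rightarrow> 'b" assume f: "l2_eq f f"
    then have "integrable lebesgue (\<lambda>x. f x \<bullet> f x)" by (simp add: square_integrable_inner l2_eq_def)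
    then have "(LINT x|lebesgue. f x \<bullet> f x) = 0 \<longleftrightarrow> (AE x in lebesgue. f x \<bullet> f x = 0)"
      by (intro integral_nonneg_eq_0_iff_AE) auto
    then show "(LINT x|lebesgue. f x \<bullet> f x) = 0 \<longleftrightarrow> l2_eq f (\<lambda>_. 0)"
      using f by (simp add: l2_eq_def square_integrable_0)
  qed
  show "norm a = sqrt (a \<bullet> a)" by (rule norm_l2_def)
qed

end

definition to_l2 :: "('a::euclidean_space \<Rightarrow> 'b::euclidean_space) \<Rightarrow> ('a, 'b) l2" where
  "to_l2 = abs_l2"

lemma l2_cases:
  obtains f where "square_integrable f" "y = to_l2 f"
  unfolding to_l2_def by (metis Quotient_l2 Quotient_abs_rep Quotient_rep_reflp l2_eq_def)

lemma to_l2_eq_iff: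
  "square_integrable f \<Longrightarrow> square_integrable g \<Longrightarrow> to_l2 f = to_l2 g \<longleftrightarrow> (AE x in lebesgue. f x = g x)"
  using Quotient_rel[OF Quotient_l2, of f g] by (auto simp: l2_eq_def to_l2_def)

lemma to_l2_0: "to_l2 (\<lambda>_. 0) = 0"
  by (simp add: to_l2_def zero_l2.abs_eq)

lemma
  assumes "square_integrable f" "square_integrable g"
  shows to_l2_add: "to_l2 (\<lambda>x. f x + g x) = to_l2 f + to_l2 g"
    and to_l2_diff: "to_l2 (\<lambda>x. f x - g x) = to_l2 f - to_l2 g"
    and inner_to_l2: "to_l2 f \<bullet> to_l2 g = (LINT x|lebesgue. f x \<bullet> g x)"
  using assms by (simp_all add: to_l2_def plus_l2.abs_eq minus_l2.abs_eq inner_l2.abs_eq l2_eq_def)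

lemma to_l2_scaleR: "square_integrable f \<Longrightarrow> to_l2 (\<lambda>x. c *\<^sub>R f x) = c *\<^sub>R to_l2 f"
  by (simp add: to_l2_def scaleR_l2.abs_eq l2_eq_def)

lemma norm_to_l2:
  "square_integrable f \<Longrightarrow> (norm (to_l2 f))\<^sup>2 = (LINT x|lebesgue. (norm (f x))\<^sup>2)"
  by (simp add: power2_norm_eq_inner inner_to_l2)

lemma norm_to_l2_mono:
  assumes "square_integrable f" "square_integrable g" "\<And>x. norm (f x) \<le> norm (g x)"
  shows "norm (to_l2 f) \<le> norm (to_l2 g)"
proof (rule power2_le_imp_le)
  show "(norm (to_l2 f))\<^sup>2 \<le> (norm (to_l2 g))\<^sup>2"
    using assms by (simp add: norm_to_l2) (auto simp: square_integrable_def intro!: integral_mono power_mono)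
qed simp

text \<open>Riesz--Fischer: along a subsequence whose increments \<open>d\<^sub>k\<close> have norm at most \<open>2\<^sup>-\<^sup>k\<close>, the weighted sum
  \<open>\<Sum>2\<^sup>k \<bar>d\<^sub>k\<bar>\<^sup>2\<close> is integrable, hence finite almost everywhere, which forces pointwise convergence.\<close>

instance l2 :: (euclidean_space, euclidean_space) complete_space
proof
  fix X :: "nat \<Rightarrow> ('a, 'b) l2"
  assume "Cauchy X"
  have "\<exists>M. \<forall>m\<ge>M. \<forall>n\<ge>M. norm (X m - X n) < (1/2) ^ k" for k :: nat
    using \<open>Cauchy X\<close> by (intro CauchyD) auto
  then obtain M where M: "\<And>k m n. m \<ge> M k \<Longrightarrow> n \<ge> M k \<Longrightarrow> norm (X m - X n) < (1/2) ^ k" by metis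
  \<comment> \<open>The sum dominates each \<open>M k\<close>, and the summand \<open>k\<close>
    makes the indices strictly increasing.\<close>
  define r where "r k = (\<Sum>i\<le>k. M i) + k" for k
  have r: "strict_mono r" by (auto simp: strict_mono_Suc_iff r_def)
  have "M k \<le> r k" for k unfolding r_def by (intro trans_le_add1 member_le_sum) auto
  then have rX: "norm (X m - X (r k)) \<le> (1/2) ^ k" if "m \<ge> r k" for m k
    using M that by (meson less_imp_le order_trans)
  have "\<forall>k. \<exists>f. square_integrable f \<and> X (r k) = to_l2 f" by (metis l2_cases)
  then obtain f where f: "\<And>k. square_integrable (f k)" and Xf: "\<And>k. X (r k) = to_l2 (f k)" by metis
  have meas: "f k \<in> borel_measurable lebesgue" for k using f by (simp add: square_integrable_def)
  have nn: "(\<integral>\<^sup>+x. ennreal ((norm (g x))\<^sup>2) \<partial>lebesgue) = ennreal ((norm (to_l2 g))\<^sup>2)"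
    if "square_integrable g" for g :: "'a \<Rightarrow> 'b"
    using that by (simp add: norm_to_l2) (simp add: square_integrable_def nn_integral_eq_integral)
  define d where "d k x = f (Suc k) x - f k x" for k x
  have d: "square_integrable (d k)" for k unfolding d_def by (intro square_integrable_diff f)
  have dnorm: "norm (to_l2 (d k)) \<le> (1/2) ^ k" for k
    using rX[of k "r (Suc k)"] strict_mono_leD[OF r, of k "Suc k"]
    by (simp add: d_def[abs_def] to_l2_diff f Xf[symmetric])
  have "(\<integral>\<^sup>+x. (\<Sum>k. ennreal (2 ^ k * (norm (d k x))\<^sup>2)) \<partial>lebesgue)
      = (\<Sum>k. \<integral>\<^sup>+x. ennreal (2 ^ k * (norm (d k x))\<^sup>2) \<partial>lebesgue)"
    using meas by (intro nn_integral_suminf) (simp add: d_def)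
  also have "\<dots> \<le> (\<Sum>k. ennreal ((1/2) ^ k))"
  proof (intro suminf_le summableI)
    fix k
    have "(\<integral>\<^sup>+x. ennreal (2 ^ k * (norm (d k x))\<^sup>2) \<partial>lebesgue)
        = ennreal (2 ^ k) * (\<integral>\<^sup>+x. ennreal ((norm (d k x))\<^sup>2) \<partial>lebesgue)"
      using meas by (subst nn_integral_cmult[symmetric]) (auto simp: d_def ennreal_mult)
    also have "\<dots> = ennreal (2 ^ k * (norm (to_l2 (d k)))\<^sup>2)"
      by (simp add: nn d ennreal_mult)
    also have "\<dots> \<le> ennreal ((1/2) ^ k)"
    proof (rule ennreal_leI)
      have "(norm (to_l2 (d k)))\<^sup>2 \<le> ((1/2) ^ k)\<^sup>2" by (intro power_mono dnorm) auto
      then have "2 ^ k * (norm (to_l2 (d k)))\<^sup>2 \<le> 2 ^ k * ((1/2) ^ k)\<^sup>2" by (intro mult_left_mono) auto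
      also have "\<dots> = (1/2) ^ k" by (simp add: power2_eq_square power_divide)
      finally show "2 ^ k * (norm (to_l2 (d k)))\<^sup>2 \<le> (1/2) ^ k" .
    qed
    finally show "(\<integral>\<^sup>+x. ennreal (2 ^ k * (norm (d k x))\<^sup>2) \<partial>lebesgue) \<le> ennreal ((1/2) ^ k)" .
  qed
  also have "\<dots> < \<infinity>" by (subst suminf_ennreal2) (auto simp: summable_geometric)
  finally have "AE x in lebesgue. (\<Sum>k. ennreal (2 ^ k * (norm (d k x))\<^sup>2)) \<noteq> \<infinity>"
    using meas by (intro nn_integral_noteq_infinite) (auto simp: d_def)
  then have conv: "AE x in lebesgue. (\<lambda>k. f k x) \<longlonglongrightarrow> lim (\<lambda>k. f k x)"
  proof eventually_elim
    case (elim x)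
    have sm: "summable (\<lambda>k. 2 ^ k * (norm (d k x))\<^sup>2)"
      using elim by (intro summable_suminf_not_top) auto
    have "summable (\<lambda>k. norm (d k x))"
    proof (rule summable_comparison_test')
      show "summable (\<lambda>k. 2 ^ k * (norm (d k x))\<^sup>2 + (1/2) ^ k)"
        by (intro summable_add sm summable_geometric) auto
      fix k :: nat
      \<comment> \<open>Expanding the square gives 2|d| \<le> 2^k |d|^2 + 2^(-k), which dominates
        the increments by the sum of two summable series.\<close>
      have "0 \<le> (2 ^ k * norm (d k x) - 1)\<^sup>2" by simp
      then have "2 * (2 ^ k * norm (d k x)) \<le> (2 ^ k * norm (d k x))\<^sup>2 + 1" by (simp add: power2_diff)
      then have "2 ^ k * (2 * norm (d k x)) \<le> 2 ^ k * (2 ^ k * (norm (d k x))\<^sup>2 + (1/2) ^ k)"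
        by (simp add: power2_eq_square algebra_simps power_divide)
      then have "2 * norm (d k x) \<le> 2 ^ k * (norm (d k x))\<^sup>2 + (1/2) ^ k" by simp
      then show "norm (norm (d k x)) \<le> 2 ^ k * (norm (d k x))\<^sup>2 + (1/2) ^ k"
        using norm_ge_zero[of "d k x"] unfolding real_norm_def abs_norm_cancel by linarith
    qed
    then have "summable (\<lambda>k. d k x)" by (rule summable_norm_cancel)
    then have "convergent (\<lambda>n. \<Sum>k<n. d k x)" by (simp add: summable_iff_convergent)
    then have "convergent (\<lambda>n. f n x - f 0 x)"
      by (simp add: d_def sum_lessThan_telescope[of "\<lambda>n. f n x"])
    then have "convergent (\<lambda>n. f n x)" by (simp add: convergent_diff_const_right_iff)
    then show ?case by (simp add: convergent_LIMSEQ_iff)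
  qed
  define g where "g x = lim (\<lambda>k. f k x)" for x
  have gm: "g \<in> borel_measurable lebesgue" unfolding g_def by (intro borel_measurable_lim_metric meas)
  \<comment> \<open>Letting m tend to infinity in |f m - f k| \<le> 2^(-k) by Fatou's lemma yields
    both the square integrability of the limit and the rate of convergence.\<close>
  have fatou: "(\<integral>\<^sup>+x. ennreal ((norm (g x - f k x))\<^sup>2) \<partial>lebesgue) \<le> ennreal (((1/2) ^ k)\<^sup>2)" for k
  proof -
    have "(\<integral>\<^sup>+x. ennreal ((norm (g x - f k x))\<^sup>2) \<partial>lebesgue)
        = (\<integral>\<^sup>+x. liminf (\<lambda>m. ennreal ((norm (f m x - f k x))\<^sup>2)) \<partial>lebesgue)"
    proof (rule nn_integral_cong_AE)
      show "AE x in lebesgue. ennreal ((norm (g x - f k x))\<^sup>2) = liminf (\<lambda>m. ennreal ((norm (f m x - f k x))\<^sup>2))"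
        using conv
      proof eventually_elim
        case (elim x)
        then have "(\<lambda>m. ennreal ((norm (f m x - f k x))\<^sup>2)) \<longlonglongrightarrow> ennreal ((norm (g x - f k x))\<^sup>2)"
          unfolding g_def by (intro tendsto_intros)
        then show ?case by (rule lim_imp_Liminf[OF trivial_limit_sequentially, symmetric])
      qed
    qed
    also have "\<dots> \<le> liminf (\<lambda>m. \<integral>\<^sup>+x. ennreal ((norm (f m x - f k x))\<^sup>2) \<partial>lebesgue)"
      using meas by (intro nn_integral_liminf) auto
    also have "\<dots> \<le> ennreal (((1/2) ^ k)\<^sup>2)"
    proof (rule Liminf_le)
      show "\<forall>\<^sub>F m in sequentially. (\<integral>\<^sup>+x. ennreal ((norm (f m x - f k x))\<^sup>2) \<partial>lebesgue) \<le> ennreal (((1/2) ^ k)\<^sup>2)"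
        using eventually_ge_at_top[of k]
      proof eventually_elim
        case (elim m)
        have "norm (to_l2 (\<lambda>x. f m x - f k x)) \<le> (1/2) ^ k"
          using rX[of k "r m"] strict_mono_leD[OF r elim] by (simp add: to_l2_diff f Xf[symmetric])
        then show ?case by (subst nn) (auto intro!: ennreal_leI power_mono square_integrable_diff f)
      qed
    qed simp
    finally show ?thesis .
  qed
  have gf: "square_integrable (\<lambda>x. g x - f k x)" for k
    unfolding square_integrable_def
  proof
    show "(\<lambda>x. g x - f k x) \<in> borel_measurable lebesgue" using gm meas by simp
    then show "integrable lebesgue (\<lambda>x. (norm (g x - f k x))\<^sup>2)"
      using fatou[of k] by (intro integrableI_bounded) (auto simp: le_less_trans)
  qed
  then have g: "square_integrable g" using square_integrable_add[OF gf[of 0] f[of 0]] by simp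
  have dist_le: "norm (to_l2 g - X (r k)) \<le> (1/2) ^ k" for k
  proof -
    have "ennreal ((norm (to_l2 (\<lambda>x. g x - f k x)))\<^sup>2) \<le> ennreal (((1/2) ^ k)\<^sup>2)"
      using fatou[of k] nn[OF gf] by simp
    then have "(norm (to_l2 g - X (r k)))\<^sup>2 \<le> ((1/2) ^ k)\<^sup>2" by (simp add: to_l2_diff g f Xf)
    then show ?thesis by (rule power2_le_imp_le) simp
  qed
  have "(\<lambda>k. X (r k) - to_l2 g) \<longlonglongrightarrow> 0"
  proof (rule Lim_null_comparison)
    show "\<forall>\<^sub>F k in sequentially. norm (X (r k) - to_l2 g) \<le> (1/2) ^ k"
      using dist_le by (simp add: norm_minus_commute)
    show "(\<lambda>k. (1/2) ^ k :: real) \<longlonglongrightarrow> 0" by (intro LIMSEQ_power_zero) simp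
  qed
  then have "(X \<circ> r) \<longlonglongrightarrow> to_l2 g" by (simp add: LIM_zero_iff o_def)
  then show "convergent X"
    using \<open>Cauchy X\<close> r by (meson Cauchy_converges_subseq convergentI)
qed

section \<open>Difference quotients in the mean-square sense\<close>

lemma Ck_SucD: "Ck (Suc k) \<phi> \<Longrightarrow> Ck k (\<lambda>x. frechet_derivative \<phi> (at x) v)"
  by simp

lemma Ck_bounded_linear:
  fixes \<phi> :: "'a::euclidean_space \<Rightarrow> 'b::real_normed_vector" and L :: "'b \<Rightarrow> 'c::real_normed_vector"
  assumes L: "bounded_linear L"
  shows "Ck k \<phi> \<Longrightarrow> Ck k (\<lambda>x. L (\<phi> x))"
proof (induction k arbitrary: \<phi>)
  case 0
  then show ?case using L by (simp add: bounded_linear.continuous_on)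
next
  case (Suc k)
  have d: "((\<lambda>x. L (\<phi> x)) has_derivative (\<lambda>v. L (frechet_derivative \<phi> (at x) v))) (at x)" for x
    using Suc.prems by (intro bounded_linear.has_derivative[OF L]) (simp add: frechet_derivative_works)
  show ?case
    using Suc by (auto simp: frechet_derivative_at[OF d, symmetric] intro: differentiableI[OF d])
qed

lemma Ck_add:
  fixes \<phi> \<psi> :: "'a::euclidean_space \<Rightarrow> 'b::real_normed_vector"
  shows "Ck k \<phi> \<Longrightarrow> Ck k \<psi> \<Longrightarrow> Ck k (\<lambda>x. \<phi> x + \<psi> x)"
proof (induction k arbitrary: \<phi> \<psi>)
  case 0
  then show ?case by (simp add: continuous_on_add)
next
  case (Suc k)
  have d: "((\<lambda>x. \<phi> x + \<psi> x) has_derivative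
      (\<lambda>v. frechet_derivative \<phi> (at x) v + frechet_derivative \<psi> (at x) v)) (at x)" for x
    using Suc.prems by (intro has_derivative_add) (simp_all add: frechet_derivative_works)
  show ?case
    using Suc by (auto simp: frechet_derivative_at[OF d, symmetric] intro: differentiableI[OF d])
qed

section \<open>Translates of continuous functions with compact support\<close>

text \<open>A class wider than the test functions of \<Omega>: translation may leave \<Omega>, and
  the directional derivatives of a compactly supported C^1 function are merely continuous. It still
  guarantees square integrability.\<close>

definition cont_cpt :: "('a::euclidean_space \<Rightarrow> 'b::euclidean_space) \<Rightarrow> bool" where
  "cont_cpt f \<longleftrightarrow> continuous_on UNIV f \<and> (\<exists>K. compact K \<and> (\<forall>x. x \<notin> K \<longrightarrow> f x = 0))"

lemma cont_cpt_add: "cont_cpt f \<Longrightarrow> cont_cpt g \<Longrightarrow> cont_cpt (\<lambda>x. f x + g x)"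
  unfolding cont_cpt_def
  by (elim conjE exE) (rule conjI, (auto intro: continuous_on_add)[1], rule_tac x = "K \<union> Ka" in exI, auto)

lemma cont_cpt_scaleR: "cont_cpt f \<Longrightarrow> cont_cpt (\<lambda>x. c *\<^sub>R f x)"
  unfolding cont_cpt_def by (auto intro!: continuous_intros)

lemma cont_cpt_diff: "cont_cpt f \<Longrightarrow> cont_cpt g \<Longrightarrow> cont_cpt (\<lambda>x. f x - g x)"
  using cont_cpt_add[of f "\<lambda>x. (-1) *\<^sub>R g x"] cont_cpt_scaleR[of g "-1"] by simp

lemma cont_cpt_translate:
  assumes "cont_cpt f"
  shows "cont_cpt (\<lambda>x. f (x + z))"
proof -
  obtain K where K: "compact K" "\<And>x. x \<notin> K \<Longrightarrow> f x = 0" using assms by (auto simp: cont_cpt_def)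
  have "compact ((\<lambda>x. x - z) ` K)" using K by (intro compact_continuous_image) (auto intro!: continuous_intros)
  moreover have "f (x + z) = 0" if "x \<notin> (\<lambda>x. x - z) ` K" for x
    using that by (intro K) (metis add_diff_cancel_right' image_eqI)
  moreover have "continuous_on UNIV (\<lambda>x. f (x + z))"
    using assms by (auto simp: cont_cpt_def intro!: continuous_intros elim: continuous_on_compose2)
  ultimately show ?thesis by (auto simp: cont_cpt_def)
qed

lemma cont_cpt_borel: "cont_cpt f \<Longrightarrow> f \<in> borel_measurable borel"
  by (simp add: cont_cpt_def borel_measurable_continuous_onI)

lemma cont_cpt_lebesgue: "cont_cpt f \<Longrightarrow> f \<in> borel_measurable lebesgue"
  by (intro measurable_completion) (simp add: cont_cpt_borel)

lemma cont_cpt_bound: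
  assumes "cont_cpt f"
  shows "\<exists>B>0. \<exists>r>0. (\<forall>x. norm (f x) \<le> B) \<and> (\<forall>x. norm x > r \<longrightarrow> f x = 0)"
proof -
  obtain K where K: "compact K" "\<And>x. x \<notin> K \<Longrightarrow> f x = 0" using assms by (auto simp: cont_cpt_def)
  have "continuous_on K f" using assms by (auto simp: cont_cpt_def intro: continuous_on_subset)
  then have "bounded (f ` K)" using K by (intro compact_imp_bounded compact_continuous_image)
  then obtain B where B: "B > 0" "\<And>x. x \<in> K \<Longrightarrow> norm (f x) \<le> B" by (auto simp: bounded_pos)
  obtain r where r: "r > 0" "\<And>x. x \<in> K \<Longrightarrow> norm x \<le> r"
    using compact_imp_bounded[OF K(1)] by (auto simp: bounded_pos)
  have "norm (f x) \<le> B" for x using B K by (cases "x \<in> K") auto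
  moreover have "f x = 0" if "norm x > r" for x using r K that by (metis not_le)
  ultimately show ?thesis using B r by blast
qed

lemma integrable_indicator_cball: "integrable lebesgue (\<lambda>x::'a::euclidean_space. c * indicator (cball 0 r) x :: real)"
  by (intro integrable_mult_right integrable_real_indicator)
     (simp_all add: emeasure_lborel_cball_finite[unfolded infinity_ennreal_def])

lemma square_integrable_cont_cpt:
  assumes "cont_cpt f"
  shows "square_integrable f"
proof -
  obtain B r where B: "B > 0" "\<And>x. norm (f x) \<le> B" "r > 0" "\<And>x. norm x > r \<Longrightarrow> f x = 0"
    using cont_cpt_bound[OF assms] by blast
  show ?thesis
  proof (rule square_integrable_bound)
    show "integrable lebesgue (\<lambda>x. B\<^sup>2 * indicator (cball 0 r) x :: real)" by (rule integrable_indicator_cball)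
    show "f \<in> borel_measurable lebesgue" by (rule cont_cpt_lebesgue[OF assms])
    show "(norm (f x))\<^sup>2 \<le> B\<^sup>2 * indicator (cball 0 r) x" for x
      using B(2)[of x] B(4)[of x] by (auto simp: indicator_def intro: power_mono)
  qed
qed

text \<open>Invariance is taken from \<open>lborel\<close>; Borel measurability of \<open>g\<close>
  lets it pass to the completion.\<close>

lemma lebesgue_integral_translate:
  fixes g :: "'a::euclidean_space \<Rightarrow> real"
  assumes "g \<in> borel_measurable borel"
  shows "(LINT x|lebesgue. g (x + z)) = (LINT x|lebesgue. g x)"
proof -
  have "(LINT x|lborel. g x) = (LINT x|distr lborel borel ((+) z). g x)" by (simp add: lborel_distr_plus)
  also have "\<dots> = (LINT x|lborel. g (z + x))" using assms by (intro integral_distr) auto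
  finally show ?thesis using assms by (simp add: integral_completion add.commute)
qed

lemma norm_to_l2_translate:
  assumes "cont_cpt f"
  shows "norm (to_l2 (\<lambda>x. f (x + z))) = norm (to_l2 f)"
proof -
  have "(LINT x|lebesgue. (norm (f (x + z)))\<^sup>2) = (LINT x|lebesgue. (norm (f x))\<^sup>2)"
    using cont_cpt_borel[OF assms] by (intro lebesgue_integral_translate) simp
  then have "(norm (to_l2 (\<lambda>x. f (x + z))))\<^sup>2 = (norm (to_l2 f))\<^sup>2"
    by (simp add: norm_to_l2 square_integrable_cont_cpt cont_cpt_translate assms)
  then show ?thesis by simp
qed

lemma inner_to_l2_translate:
  assumes "cont_cpt f" "cont_cpt g"
  shows "to_l2 (\<lambda>x. f (x + z)) \<bullet> to_l2 g = to_l2 f \<bullet> to_l2 (\<lambda>x. g (x - z))"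
proof -
  have "(LINT x|lebesgue. f (x + z) \<bullet> g ((x + z) - z)) = (LINT x|lebesgue. f x \<bullet> g (x - z))"
    using cont_cpt_borel[OF assms(1)] cont_cpt_borel[OF cont_cpt_translate[OF assms(2), of "- z"]]
    by (intro lebesgue_integral_translate) simp
  then show ?thesis
    using cont_cpt_translate[OF assms(2), of "- z"]
    by (simp add: inner_to_l2 square_integrable_cont_cpt cont_cpt_translate assms)
qed

text \<open>The increment over m steps is a sum of m translates of the increment over one step, all
  of the same norm.\<close>

lemma norm_to_l2_telescope:
  assumes "cont_cpt f"
  shows "norm (to_l2 (\<lambda>x. f (x + real m *\<^sub>R h) - f x)) \<le> real m * norm (to_l2 (\<lambda>x. f (x + h) - f x))"
proof (induction m)
  case 0
  then show ?case by (simp add: to_l2_0)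
next
  case (Suc m)
  define g where "g x = f (x + h) - f x" for x
  have g: "cont_cpt g" unfolding g_def by (intro cont_cpt_diff cont_cpt_translate assms)
  have "(\<lambda>x. f (x + real (Suc m) *\<^sub>R h) - f x)
      = (\<lambda>x. g (x + real m *\<^sub>R h) + (f (x + real m *\<^sub>R h) - f x))"
    by (simp add: g_def algebra_simps)
  then have "norm (to_l2 (\<lambda>x. f (x + real (Suc m) *\<^sub>R h) - f x))
      = norm (to_l2 (\<lambda>x. g (x + real m *\<^sub>R h)) + to_l2 (\<lambda>x. f (x + real m *\<^sub>R h) - f x))"
    by (simp add: to_l2_add square_integrable_cont_cpt cont_cpt_translate cont_cpt_diff g assms)
  also have "\<dots> \<le> norm (to_l2 g) + norm (to_l2 (\<lambda>x. f (x + real m *\<^sub>R h) - f x))"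
    using norm_triangle_ineq[of "to_l2 (\<lambda>x. g (x + real m *\<^sub>R h))"] norm_to_l2_translate[OF g] by simp
  also have "\<dots> \<le> norm (to_l2 g) + real m * norm (to_l2 g)"
    using Suc by (simp add: g_def[abs_def])
  also have "\<dots> = real (Suc m) * norm (to_l2 (\<lambda>x. f (x + h) - f x))"
    by (simp add: g_def[abs_def] algebra_simps)
  finally show ?case .
qed

section \<open>Difference quotients of compactly supported C^1 functions\<close>

definition c1_cpt :: "('a::euclidean_space \<Rightarrow> 'b::euclidean_space) \<Rightarrow> bool" where
  "c1_cpt f \<longleftrightarrow> Ck 1 f \<and> (\<exists>K. compact K \<and> (\<forall>x. x \<notin> K \<longrightarrow> f x = 0))"

lemma c1_cpt_differentiable: "c1_cpt f \<Longrightarrow> f differentiable (at x)"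
  by (simp add: c1_cpt_def)

lemma c1_cpt_has_derivative: "c1_cpt f \<Longrightarrow> (f has_derivative frechet_derivative f (at x)) (at x)"
  by (simp add: c1_cpt_differentiable frechet_derivative_works[symmetric])

lemma c1_cpt_cont_cpt: "c1_cpt f \<Longrightarrow> cont_cpt f"
  unfolding cont_cpt_def using c1_cpt_differentiable
  by (auto simp: c1_cpt_def intro!: differentiable_imp_continuous_on differentiable_at_imp_differentiable_on)

lemma frechet_derivative_zero_outside:
  fixes f :: "'a::real_normed_vector \<Rightarrow> 'b::real_normed_vector"
  assumes "closed K" "\<And>x. x \<notin> K \<Longrightarrow> f x = 0" "x \<notin> K"
  shows "frechet_derivative f (at x) v = 0"
proof -
  have "frechet_derivative (\<lambda>_. 0) (at x) = frechet_derivative f (at x)"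
    using assms by (intro frechet_derivative_transform_within_open[where X = "- K"]) auto
  then show ?thesis by (metis frechet_derivative_const)
qed

lemma cont_cpt_frechet_derivative:
  assumes "c1_cpt f"
  shows "cont_cpt (\<lambda>x. frechet_derivative f (at x) v)"
proof -
  obtain K where K: "compact K" "\<And>x. x \<notin> K \<Longrightarrow> f x = 0" using assms by (auto simp: c1_cpt_def)
  show ?thesis
    using K frechet_derivative_zero_outside[of K f _ v] assms
    by (auto simp: cont_cpt_def c1_cpt_def compact_imp_closed intro!: exI[of _ K])
qed

lemma frechet_derivative_scaleR:
  "f differentiable (at x) \<Longrightarrow> frechet_derivative f (at x) (c *\<^sub>R v) = c *\<^sub>R frechet_derivative f (at x) v"
  using linear_frechet_derivative linear_scale by blast

text \<open>The mean value inequality along the segment, where only the derivative in direction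
  \<open>z\<close> enters. It supplies the uniform bound for dominated convergence.\<close>

lemma norm_difference_quotient_le:
  fixes f :: "'a::euclidean_space \<Rightarrow> 'b::euclidean_space"
  assumes f: "c1_cpt f" and B: "\<And>x. norm (frechet_derivative f (at x) z) \<le> B" and t: "t > 0"
  shows "norm (f (x + t *\<^sub>R z) - f x) \<le> B * t"
proof -
  have d: "((\<lambda>s. f (x + s *\<^sub>R z)) has_vector_derivative frechet_derivative f (at (x + s *\<^sub>R z)) z) (at s)" for s
  proof -
    have "((\<lambda>s. x + s *\<^sub>R z) has_derivative (\<lambda>h. h *\<^sub>R z)) (at s)" by (auto intro!: derivative_eq_intros)
    from has_derivative_compose[OF this c1_cpt_has_derivative[OF f]]
    show ?thesis
      by (simp add: has_vector_derivative_def frechet_derivative_scaleR c1_cpt_differentiable[OF f])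
  qed
  have "norm (f (x + t *\<^sub>R z) - f (x + 0 *\<^sub>R z)) \<le> B * t - B * 0"
  proof (rule differentiable_bound_general[OF t])
    show "continuous_on {0..t} (\<lambda>s. f (x + s *\<^sub>R z))"
      using d by (meson continuous_at_imp_continuous_on has_vector_derivative_continuous)
    show "((\<lambda>s. B * s) has_vector_derivative B) (at s)" for s
      by (auto intro!: derivative_eq_intros)
  qed (use d B in \<open>auto intro!: continuous_intros\<close>)
  then show ?thesis by simp
qed

lemma difference_quotient_tendsto:
  assumes f: "f differentiable (at x)"
  shows "(\<lambda>N. real (Suc N) *\<^sub>R (f (x + (1 / real (Suc N)) *\<^sub>R z) - f x)) \<longlonglongrightarrow> frechet_derivative f (at x) z"
proof -
  let ?D = "frechet_derivative f (at x)"
  have D: "(f has_derivative ?D) (at x)" using f by (simp add: frechet_derivative_works)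
  have "((\<lambda>s. x + s *\<^sub>R z) has_derivative (\<lambda>h. h *\<^sub>R z)) (at 0)" by (auto intro!: derivative_eq_intros)
  then have "((\<lambda>s. f (x + s *\<^sub>R z)) has_derivative (\<lambda>h. ?D (h *\<^sub>R z))) (at 0)"
    by (rule has_derivative_compose) (simp add: D)
  then have *: "((\<lambda>h. norm (f (x + h *\<^sub>R z) - f x - ?D (h *\<^sub>R z)) / norm h) \<longlongrightarrow> 0) (at 0)"
    by (simp add: has_derivative_at)
  have "filterlim (\<lambda>N. 1 / real (Suc N)) (at 0) sequentially"
    using LIMSEQ_inverse_real_of_nat by (simp add: filterlim_at divide_inverse)
  from filterlim_compose[OF * this]
  have "(\<lambda>N. norm (f (x + (1 / real (Suc N)) *\<^sub>R z) - f x - ?D ((1 / real (Suc N)) *\<^sub>R z)) * real (Suc N)) \<longlonglongrightarrow> 0"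
    by simp
  moreover have "norm (f (x + (1 / real (Suc N)) *\<^sub>R z) - f x - ?D ((1 / real (Suc N)) *\<^sub>R z)) * real (Suc N)
      = norm (real (Suc N) *\<^sub>R (f (x + (1 / real (Suc N)) *\<^sub>R z) - f x) - ?D z)" for N
  proof -
    have "real (Suc N) *\<^sub>R (f (x + (1 / real (Suc N)) *\<^sub>R z) - f x) - ?D z
      = real (Suc N) *\<^sub>R (f (x + (1 / real (Suc N)) *\<^sub>R z) - f x - ?D ((1 / real (Suc N)) *\<^sub>R z))"
      by (simp add: frechet_derivative_scaleR[OF f] scaleR_diff_right del: of_nat_Suc)
    then show ?thesis by (simp del: of_nat_Suc)
  qed
  ultimately show ?thesis by (simp add: LIM_zero_iff tendsto_norm_zero_iff)
qed

text \<open>Dominated convergence: the quotients converge pointwise, share the bound of the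
  directional derivative, and vanish off one fixed ball.\<close>

lemma difference_quotient_l2:
  fixes f :: "'a::euclidean_space \<Rightarrow> 'b::euclidean_space"
  assumes f: "c1_cpt f"
  shows "(\<lambda>N. to_l2 (\<lambda>x. real (Suc N) *\<^sub>R (f (x + (1 / real (Suc N)) *\<^sub>R z) - f x)))
      \<longlonglongrightarrow> to_l2 (\<lambda>x. frechet_derivative f (at x) z)"
proof -
  let ?D = "\<lambda>x. frechet_derivative f (at x) z"
  define q where "q N x = real (Suc N) *\<^sub>R (f (x + (1 / real (Suc N)) *\<^sub>R z) - f x)" for N x
  have fc: "cont_cpt f" by (rule c1_cpt_cont_cpt[OF f])
  have qc: "cont_cpt (q N)" for N
    unfolding q_def by (intro cont_cpt_scaleR cont_cpt_diff cont_cpt_translate fc)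
  have Dc: "cont_cpt ?D" by (rule cont_cpt_frechet_derivative[OF f])
  obtain B r where B: "B > 0" "\<And>x. norm (?D x) \<le> B" "r > 0" "\<And>x. norm x > r \<Longrightarrow> ?D x = 0"
    using cont_cpt_bound[OF Dc] by blast
  obtain r' where r': "r' > 0" "\<And>x. norm x > r' \<Longrightarrow> f x = 0"
    using cont_cpt_bound[OF fc] by blast
  have qB: "norm (q N x) \<le> B" for N x
  proof -
    have "real (Suc N) * norm (f (x + (1 / real (Suc N)) *\<^sub>R z) - f x) \<le> real (Suc N) * (B * (1 / real (Suc N)))"
      by (intro mult_left_mono norm_difference_quotient_le f B) auto
    then show ?thesis by (simp add: q_def)
  qed
  \<comment> \<open>Steps are never longer than |z|, so outside this radius both evaluation points
    miss the support of \<open>f\<close> (radius \<open>r'\<close>), and the derivative (radius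
    \<open>r\<close>) vanishes too.\<close>
  define R where "R = r + r' + norm z"
  have q0: "q N x = 0" if "norm x > R" for N x
  proof -
    have "norm ((1 / real (Suc N)) *\<^sub>R z) \<le> 1 * norm z" unfolding norm_scaleR by (intro mult_right_mono) auto
    moreover have "norm x \<le> norm (x + (1 / real (Suc N)) *\<^sub>R z) + norm ((1 / real (Suc N)) *\<^sub>R z)"
      by (metis add_diff_cancel_right' norm_triangle_ineq4)
    ultimately have "norm (x + (1 / real (Suc N)) *\<^sub>R z) > r'" "norm x > r'"
      using that B(3) r' norm_ge_zero[of z] unfolding R_def by linarith+
    then show ?thesis using r' by (simp add: q_def)
  qed
  have D0: "?D x = 0" if "norm x > R" for x
  proof (rule B(4))
    show "norm x > r" using that r' norm_ge_zero[of z] unfolding R_def by linarith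
  qed
  have "(\<lambda>N. LINT x|lebesgue. (norm (q N x - ?D x))\<^sup>2) \<longlonglongrightarrow> (LINT x|(lebesgue::'a measure). 0)"
  proof (rule integral_dominated_convergence)
    show "integrable lebesgue (\<lambda>x::'a. (2 * B)\<^sup>2 * indicator (cball 0 R) x :: real)"
      by (rule integrable_indicator_cball)
    show "AE x in lebesgue. (\<lambda>N. (norm (q N x - ?D x))\<^sup>2) \<longlonglongrightarrow> 0"
    proof (rule AE_I2)
      fix x
      have "(\<lambda>N. q N x) \<longlonglongrightarrow> ?D x"
        unfolding q_def by (rule difference_quotient_tendsto[OF c1_cpt_differentiable[OF f]])
      then have "(\<lambda>N. (norm (q N x - ?D x))\<^sup>2) \<longlonglongrightarrow> (norm (?D x - ?D x))\<^sup>2" by (intro tendsto_intros)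
      then show "(\<lambda>N. (norm (q N x - ?D x))\<^sup>2) \<longlonglongrightarrow> 0" by simp
    qed
    show "AE x in lebesgue. norm ((norm (q N x - ?D x))\<^sup>2) \<le> (2 * B)\<^sup>2 * indicator (cball 0 R) x" for N
    proof (rule AE_I2)
      fix x
      show "norm ((norm (q N x - ?D x))\<^sup>2) \<le> (2 * B)\<^sup>2 * indicator (cball 0 R) x"
      proof (cases "norm x > R")
        case True
        then show ?thesis by (simp add: q0 D0)
      next
        case False
        have "norm (q N x - ?D x) \<le> 2 * B"
          using norm_triangle_ineq4[of "q N x" "?D x"] qB[of N x] B(2)[of x] by linarith
        then have "(norm (q N x - ?D x))\<^sup>2 \<le> (2 * B)\<^sup>2" by (intro power_mono) auto
        with False show ?thesis by simp
      qed
    qed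
    show "(\<lambda>x. (norm (q N x - ?D x))\<^sup>2) \<in> borel_measurable lebesgue" for N
      using cont_cpt_lebesgue[OF cont_cpt_diff[OF qc Dc]] by simp
  qed simp
  then have "(\<lambda>N. (norm (to_l2 (q N) - to_l2 ?D))\<^sup>2) \<longlonglongrightarrow> 0"
    by (simp add: to_l2_diff[symmetric] norm_to_l2 square_integrable_cont_cpt qc Dc cont_cpt_diff)
  then have "(\<lambda>N. sqrt ((norm (to_l2 (q N) - to_l2 ?D))\<^sup>2)) \<longlonglongrightarrow> sqrt 0" by (intro tendsto_intros)
  then have "(\<lambda>N. to_l2 (q N) - to_l2 ?D) \<longlonglongrightarrow> 0" by (simp add: tendsto_norm_zero_iff)
  then show ?thesis by (simp add: LIM_zero_iff q_def[abs_def])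
qed

text \<open>Cutting the translation into \<open>N\<close> equal steps and letting \<open>N\<close> tend to infinity replaces the usual
  integral formula and Fubini argument.\<close>

lemma norm_translate_diff_le:
  fixes f :: "'a::euclidean_space \<Rightarrow> 'b::euclidean_space"
  assumes f: "c1_cpt f"
  shows "norm (to_l2 (\<lambda>x. f (x + z) - f x)) \<le> norm (to_l2 (\<lambda>x. frechet_derivative f (at x) z))"
proof (rule LIMSEQ_le_const)
  show "(\<lambda>N. norm (to_l2 (\<lambda>x. real (Suc N) *\<^sub>R (f (x + (1 / real (Suc N)) *\<^sub>R z) - f x))))
      \<longlonglongrightarrow> norm (to_l2 (\<lambda>x. frechet_derivative f (at x) z))"
    by (intro tendsto_norm difference_quotient_l2 f)
  have fc: "cont_cpt f" by (rule c1_cpt_cont_cpt[OF f])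
  have "norm (to_l2 (\<lambda>x. f (x + z) - f x))
      \<le> norm (to_l2 (\<lambda>x. real (Suc N) *\<^sub>R (f (x + (1 / real (Suc N)) *\<^sub>R z) - f x)))" for N
    using norm_to_l2_telescope[OF fc, of "Suc N" "(1 / real (Suc N)) *\<^sub>R z"]
    by (simp add: to_l2_scaleR square_integrable_cont_cpt cont_cpt_diff cont_cpt_translate fc del: of_nat_Suc)
  then show "\<exists>N. \<forall>n\<ge>N. norm (to_l2 (\<lambda>x. f (x + z) - f x))
      \<le> norm (to_l2 (\<lambda>x. real (Suc n) *\<^sub>R (f (x + (1 / real (Suc n)) *\<^sub>R z) - f x)))" by blast
qed

text \<open>Translation invariance moves a difference quotient of \<open>f\<close> in direction
  \<open>z\<close> onto \<open>g\<close> as a difference quotient in direction \<open>-z\<close>;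
  the minus sign survives in the limit.\<close>

lemma l2_integration_by_parts:
  fixes f g :: "'a::euclidean_space \<Rightarrow> 'b::euclidean_space"
  assumes f: "c1_cpt f" and g: "c1_cpt g"
  shows "to_l2 (\<lambda>x. frechet_derivative f (at x) z) \<bullet> to_l2 g
      = - (to_l2 f \<bullet> to_l2 (\<lambda>x. frechet_derivative g (at x) z))"
proof -
  have fc: "cont_cpt f" and gc: "cont_cpt g" using f g by (auto intro: c1_cpt_cont_cpt)
  have sq: "square_integrable f" "square_integrable g" "square_integrable (\<lambda>x. f (x + y))"
    "square_integrable (\<lambda>x. g (x + y))" for y
    using fc gc by (auto intro: square_integrable_cont_cpt cont_cpt_translate)
  have "to_l2 (\<lambda>x. real (Suc N) *\<^sub>R (f (x + (1 / real (Suc N)) *\<^sub>R z) - f x)) \<bullet> to_l2 g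
      = to_l2 f \<bullet> to_l2 (\<lambda>x. real (Suc N) *\<^sub>R (g (x + (1 / real (Suc N)) *\<^sub>R (- z)) - g x))" for N
    using inner_to_l2_translate[OF fc gc, of "(1 / real (Suc N)) *\<^sub>R z"] sq(4)[of "- ((1 / real (Suc N)) *\<^sub>R z)"]
    by (simp add: to_l2_scaleR to_l2_diff square_integrable_diff sq inner_diff_left inner_diff_right del: of_nat_Suc)
  moreover have "(\<lambda>N. to_l2 (\<lambda>x. real (Suc N) *\<^sub>R (f (x + (1 / real (Suc N)) *\<^sub>R z) - f x)) \<bullet> to_l2 g)
      \<longlonglongrightarrow> to_l2 (\<lambda>x. frechet_derivative f (at x) z) \<bullet> to_l2 g"
    by (intro tendsto_intros difference_quotient_l2 f)
  moreover have "(\<lambda>N. to_l2 f \<bullet> to_l2 (\<lambda>x. real (Suc N) *\<^sub>R (g (x + (1 / real (Suc N)) *\<^sub>R (- z)) - g x)))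
      \<longlonglongrightarrow> to_l2 f \<bullet> to_l2 (\<lambda>x. frechet_derivative g (at x) (- z))"
    by (intro tendsto_intros difference_quotient_l2 g)
  ultimately have "to_l2 (\<lambda>x. frechet_derivative f (at x) z) \<bullet> to_l2 g
      = to_l2 f \<bullet> to_l2 (\<lambda>x. frechet_derivative g (at x) (- z))"
    using LIMSEQ_unique by simp
  also have "(\<lambda>x. frechet_derivative g (at x) (- z)) = (\<lambda>x. (-1) *\<^sub>R frechet_derivative g (at x) z)"
    using frechet_derivative_scaleR[OF c1_cpt_differentiable[OF g], of _ "-1" z] by simp
  also have "to_l2 f \<bullet> to_l2 \<dots> = - (to_l2 f \<bullet> to_l2 (\<lambda>x. frechet_derivative g (at x) z))"
    using square_integrable_cont_cpt[OF cont_cpt_frechet_derivative[OF g]]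
    by (subst to_l2_scaleR) auto
  finally show ?thesis .
qed

section \<open>Test functions\<close>

lemma test_functionsI:
  assumes "\<And>k. Ck k \<phi>" "compact K" "K \<subseteq> \<Omega>" "\<And>x. x \<notin> K \<Longrightarrow> \<phi> x = 0"
  shows "\<phi> \<in> test_functions \<Omega>"
proof -
  have "closure {x. \<phi> x \<noteq> 0} \<subseteq> K"
    using assms by (intro closure_minimal) (auto intro: compact_imp_closed)
  moreover from this have "bounded (closure {x. \<phi> x \<noteq> 0})"
    using assms(2) by (meson bounded_subset compact_imp_bounded)
  ultimately show ?thesis
    using assms by (auto simp: test_functions_def compact_eq_bounded_closed)
qed

lemma test_functions_support:
  assumes "\<phi> \<in> test_functions \<Omega>"
  shows "\<exists>K. compact K \<and> K \<subseteq> \<Omega> \<and> (\<forall>x. x \<notin> K \<longrightarrow> \<phi> x = 0)"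
proof (intro exI conjI allI impI)
  let ?K = "closure {x. \<phi> x \<noteq> 0}"
  show "compact ?K" "?K \<subseteq> \<Omega>" using assms by (auto simp: test_functions_def)
  show "\<phi> x = 0" if "x \<notin> ?K" for x using that closure_subset[of "{x. \<phi> x \<noteq> 0}"] by blast
qed

lemma test_functions_Ck: "\<phi> \<in> test_functions \<Omega> \<Longrightarrow> Ck k \<phi>"
  by (simp add: test_functions_def)

lemma test_functions_c1_cpt: "\<phi> \<in> test_functions \<Omega> \<Longrightarrow> c1_cpt \<phi>"
  unfolding c1_cpt_def using test_functions_Ck[of \<phi> \<Omega> 1] test_functions_support[of \<phi> \<Omega>] by blast

lemma test_functions_zero: "(\<lambda>_. 0) \<in> test_functions \<Omega>"
proof (rule test_functionsI[where K = "{}"])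
  show "Ck k (\<lambda>_::real^'n. 0::complex)" for k by (induction k) auto
qed auto

lemma test_functions_add:
  assumes "\<phi> \<in> test_functions \<Omega>" "\<psi> \<in> test_functions \<Omega>"
  shows "(\<lambda>x. \<phi> x + \<psi> x) \<in> test_functions \<Omega>"
proof -
  obtain K where K: "compact K" "K \<subseteq> \<Omega>" "\<And>x. x \<notin> K \<Longrightarrow> \<phi> x = 0" using test_functions_support[OF assms(1)] by blast
  obtain L where L: "compact L" "L \<subseteq> \<Omega>" "\<And>x. x \<notin> L \<Longrightarrow> \<psi> x = 0" using test_functions_support[OF assms(2)] by blast
  show ?thesis
    using K L by (intro test_functionsI[where K = "K \<union> L"] Ck_add[OF test_functions_Ck[OF assms(1)] test_functions_Ck[OF assms(2)]]) auto
qed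

lemma test_functions_bounded_linear:
  assumes L: "bounded_linear L" and \<phi>: "\<phi> \<in> test_functions \<Omega>"
  shows "(\<lambda>x. L (\<phi> x)) \<in> test_functions \<Omega>"
proof -
  obtain K where K: "compact K" "K \<subseteq> \<Omega>" "\<And>x. x \<notin> K \<Longrightarrow> \<phi> x = 0" using test_functions_support[OF \<phi>] by blast
  show ?thesis
    using K by (intro test_functionsI[where K = K] Ck_bounded_linear[OF L test_functions_Ck[OF \<phi>]])
      (auto simp: bounded_linear.linear[OF L] linear_0)
qed

lemma test_functions_frechet_derivative:
  assumes \<phi>: "\<phi> \<in> test_functions \<Omega>"
  shows "(\<lambda>x. frechet_derivative \<phi> (at x) v) \<in> test_functions \<Omega>"
proof -
  obtain K where K: "compact K" "K \<subseteq> \<Omega>" "\<And>x. x \<notin> K \<Longrightarrow> \<phi> x = 0" using test_functions_support[OF \<phi>] by blast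
  show ?thesis
    using K by (intro test_functionsI[where K = K] Ck_SucD[OF test_functions_Ck[OF \<phi>]])
      (auto intro: frechet_derivative_zero_outside compact_imp_closed)
qed

lemma classical_grad_zero_outside:
  assumes "compact K" "\<And>x. x \<notin> K \<Longrightarrow> \<phi> x = 0" "x \<notin> K"
  shows "classical_grad \<phi> x = 0"
  using assms by (simp add: classical_grad_def vec_eq_iff frechet_derivative_zero_outside[of K] compact_imp_closed)

lemma cont_cpt_classical_grad:
  assumes "c1_cpt \<phi>"
  shows "cont_cpt (classical_grad \<phi>)"
proof -
  obtain K where K: "compact K" "\<And>x. x \<notin> K \<Longrightarrow> \<phi> x = 0" using assms by (auto simp: c1_cpt_def)
  have "continuous_on UNIV (classical_grad \<phi>)"
    using assms unfolding classical_grad_def c1_cpt_def by (intro continuous_on_vec_lambda) auto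
  then show ?thesis using K classical_grad_zero_outside[OF K] by (auto simp: cont_cpt_def)
qed

lemma classical_grad_add:
  assumes "\<phi> differentiable (at x)" "\<psi> differentiable (at x)"
  shows "classical_grad (\<lambda>x. \<phi> x + \<psi> x) x = classical_grad \<phi> x + classical_grad \<psi> x"
proof -
  have "((\<lambda>x. \<phi> x + \<psi> x) has_derivative (\<lambda>v. frechet_derivative \<phi> (at x) v + frechet_derivative \<psi> (at x) v)) (at x)"
    using assms by (intro has_derivative_add) (simp_all add: frechet_derivative_works)
  from frechet_derivative_at[OF this, symmetric] show ?thesis by (simp add: classical_grad_def vec_eq_iff)
qed

lemma classical_grad_bounded_linear:
  assumes L: "bounded_linear L" and "\<phi> differentiable (at x)"
  shows "classical_grad (\<lambda>x. L (\<phi> x)) x = (\<chi> i. L (classical_grad \<phi> x $ i))"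
proof -
  have "((\<lambda>x. L (\<phi> x)) has_derivative (\<lambda>v. L (frechet_derivative \<phi> (at x) v))) (at x)"
    using assms by (intro bounded_linear.has_derivative[OF L]) (simp add: frechet_derivative_works)
  from frechet_derivative_at[OF this, symmetric] show ?thesis by (simp add: classical_grad_def vec_eq_iff)
qed

text \<open>Expanding \<open>z\<close> in the coordinate basis, then Cauchy-Schwarz over the
  coordinates.\<close>

lemma norm_frechet_derivative_le_classical_grad:
  assumes "\<phi> differentiable (at x)"
  shows "norm (frechet_derivative \<phi> (at x) z) \<le> norm z * norm (classical_grad \<phi> x)"
proof -
  let ?D = "frechet_derivative \<phi> (at x)"
  have lin: "linear ?D" by (rule linear_frechet_derivative[OF assms])
  have "z = (\<Sum>i\<in>UNIV. z $ i *\<^sub>R axis i 1)"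
    using basis_expansion[of z] by (simp add: scalar_mult_eq_scaleR)
  then have "?D z = ?D (\<Sum>i\<in>UNIV. z $ i *\<^sub>R axis i 1)" by simp
  also have "\<dots> = (\<Sum>i\<in>UNIV. z $ i *\<^sub>R ?D (axis i 1))"
    by (simp add: linear_sum[OF lin] linear_scale[OF lin])
  finally have "norm (?D z) \<le> (\<Sum>i\<in>UNIV. norm (z $ i) * norm (classical_grad \<phi> x $ i))"
    by (simp add: classical_grad_def sum_norm_le)
  also have "\<dots> = (\<Sum>i\<in>UNIV. \<bar>norm (z $ i)\<bar> * \<bar>norm (classical_grad \<phi> x $ i)\<bar>)" by simp
  also have "\<dots> \<le> L2_set (\<lambda>i. norm (z $ i)) UNIV * L2_set (\<lambda>i. norm (classical_grad \<phi> x $ i)) UNIV"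
    by (rule L2_set_mult_ineq)
  finally show ?thesis by (simp add: norm_vec_def)
qed

lemma norm_translate_diff_le_classical_grad:
  assumes f: "c1_cpt \<phi>"
  shows "norm (to_l2 (\<lambda>x. \<phi> (x + z) - \<phi> x)) \<le> norm z * norm (to_l2 (classical_grad \<phi>))"
proof -
  have "norm (to_l2 (\<lambda>x. \<phi> (x + z) - \<phi> x)) \<le> norm (to_l2 (\<lambda>x. frechet_derivative \<phi> (at x) z))"
    by (rule norm_translate_diff_le[OF f])
  also have "\<dots> \<le> norm (to_l2 (\<lambda>x. norm z *\<^sub>R classical_grad \<phi> x))"
    using norm_frechet_derivative_le_classical_grad[OF c1_cpt_differentiable[OF f]]
    by (intro norm_to_l2_mono square_integrable_cont_cpt cont_cpt_frechet_derivative cont_cpt_scaleR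
        cont_cpt_classical_grad f) simp
  also have "\<dots> = norm z * norm (to_l2 (classical_grad \<phi>))"
    by (simp add: to_l2_scaleR square_integrable_cont_cpt cont_cpt_classical_grad f)
  finally show ?thesis .
qed

text \<open>A translate of \<open>\<phi>\<close> by more than the diameter of \<open>\<Omega>\<close> is orthogonal to \<open>\<phi>\<close>.\<close>

lemma poincare_test_functions:
  fixes \<Omega> :: "(real^'n) set"
  assumes "bounded \<Omega>"
  obtains K where "K > 0"
    "\<And>\<phi>. \<phi> \<in> test_functions \<Omega> \<Longrightarrow> norm (to_l2 \<phi>) \<le> K * norm (to_l2 (classical_grad \<phi>))"
proof -
  obtain r where r: "r > 0" "\<And>x. x \<in> \<Omega> \<Longrightarrow> norm x \<le> r" using assms by (auto simp: bounded_pos)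
  \<comment> \<open>Two points of \<Omega> are at most 2r apart, so a shift of length 3r separates
    \<Omega> from its translate.\<close>
  obtain z :: "real^'n" where z: "norm z = 3 * r" using vector_choose_size[of "3 * r"] r by auto
  have "norm (to_l2 \<phi>) \<le> (3 * r) * norm (to_l2 (classical_grad \<phi>))" if \<phi>: "\<phi> \<in> test_functions \<Omega>" for \<phi>
  proof -
    have c: "cont_cpt \<phi>" "cont_cpt (\<lambda>x. \<phi> (x + z))"
      using \<phi> by (auto intro: c1_cpt_cont_cpt test_functions_c1_cpt cont_cpt_translate)
    obtain K where K: "compact K" "K \<subseteq> \<Omega>" "\<And>x. x \<notin> K \<Longrightarrow> \<phi> x = 0" using test_functions_support[OF \<phi>] by blast
    have "\<phi> (x + z) \<bullet> \<phi> x = 0" for x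
    proof (rule ccontr)
      assume "\<phi> (x + z) \<bullet> \<phi> x \<noteq> 0"
      then have "x + z \<in> \<Omega>" "x \<in> \<Omega>" using K by force+
      then have "norm z \<le> r + r" using r(2) norm_triangle_ineq4[of "x + z" x] by (smt (verit) add_diff_cancel_left')
      with z r show False by simp
    qed
    then have "to_l2 (\<lambda>x. \<phi> (x + z)) \<bullet> to_l2 \<phi> = 0"
      by (simp add: inner_to_l2 square_integrable_cont_cpt c)
    \<comment> \<open>Pythagoras for the orthogonal pair; dropping the square of the translate
      leaves the inequality wanted.\<close>
    then have "(norm (to_l2 (\<lambda>x. \<phi> (x + z)) - to_l2 \<phi>))\<^sup>2 = (norm (to_l2 (\<lambda>x. \<phi> (x + z))))\<^sup>2 + (norm (to_l2 \<phi>))\<^sup>2"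
      by (simp add: power2_norm_eq_inner inner_diff_left inner_diff_right inner_commute)
    then have "norm (to_l2 \<phi>) \<le> norm (to_l2 (\<lambda>x. \<phi> (x + z)) - to_l2 \<phi>)"
      by (intro power2_le_imp_le[OF _ norm_ge_zero]) simp
    also have "\<dots> = norm (to_l2 (\<lambda>x. \<phi> (x + z) - \<phi> x))" by (simp add: to_l2_diff square_integrable_cont_cpt c)
    also have "\<dots> \<le> norm z * norm (to_l2 (classical_grad \<phi>))"
      by (rule norm_translate_diff_le_classical_grad[OF test_functions_c1_cpt[OF \<phi>]])
    finally show ?thesis by (simp add: z)
  qed
  with r show ?thesis by (intro that[of "3 * r"]) auto
qed

text \<open>The variance written as a double integral of squared differences. The second conclusion
  records that the right-hand side is not truncated by \<open>ennreal\<close>, so the first can be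
  read as an identity of reals.\<close>

lemma nn_integral_pairwise_distance:
  fixes f :: "'a \<Rightarrow> 'b::euclidean_space"
  assumes M: "finite_measure M" and f: "f \<in> borel_measurable M" and B: "\<And>x. norm (f x) \<le> B"
  shows "(\<integral>\<^sup>+x. \<integral>\<^sup>+y. ennreal ((norm (f x - f y))\<^sup>2) \<partial>M \<partial>M)
    = ennreal (2 * measure M (space M) * (LINT x|M. (norm (f x))\<^sup>2) - 2 * (norm (LINT x|M. f x))\<^sup>2)"
    and "0 \<le> 2 * measure M (space M) * (LINT x|M. (norm (f x))\<^sup>2) - 2 * (norm (LINT x|M. f x))\<^sup>2"
proof -
  interpret finite_measure M by (rule M)
  have sq: "(norm (f x))\<^sup>2 \<le> B\<^sup>2" for x using B[of x] by (intro power_mono) auto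
  have int: "integrable M f" "integrable M (\<lambda>x. (norm (f x))\<^sup>2)"
    using f B sq by (intro integrable_const_bound[where B = B] AE_I2; simp)
      (intro integrable_const_bound[where B = "B\<^sup>2"] AE_I2; use f sq in simp)
  define a where "a = (LINT x|M. f x)"
  define S where "S = (LINT x|M. (norm (f x))\<^sup>2)"
  define m where "m = measure M (space M)"
  have expand: "(norm (f x - f y))\<^sup>2 = (norm (f x))\<^sup>2 - 2 * (f x \<bullet> f y) + (norm (f y))\<^sup>2" for x y
    by (simp add: power2_norm_eq_inner inner_diff_left inner_diff_right inner_commute)
  have inner: "integrable M (\<lambda>y. (norm (f x - f y))\<^sup>2)"
    "(LINT y|M. (norm (f x - f y))\<^sup>2) = m * (norm (f x))\<^sup>2 - 2 * (f x \<bullet> a) + S" for x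
    unfolding expand using int by (auto simp: a_def S_def m_def)
  have nonneg: "0 \<le> m * (norm (f x))\<^sup>2 - 2 * (f x \<bullet> a) + S" for x
    unfolding inner(2)[symmetric] by (intro integral_nonneg_AE) simp
  have "(\<integral>\<^sup>+x. \<integral>\<^sup>+y. ennreal ((norm (f x - f y))\<^sup>2) \<partial>M \<partial>M)
      = (\<integral>\<^sup>+x. ennreal (LINT y|M. (norm (f x - f y))\<^sup>2) \<partial>M)"
    by (intro nn_integral_cong nn_integral_eq_integral inner) auto
  also have "\<dots> = ennreal (LINT x|M. LINT y|M. (norm (f x - f y))\<^sup>2)"
    unfolding inner(2) using int nonneg by (intro nn_integral_eq_integral) auto
  also have eq: "(LINT x|M. LINT y|M. (norm (f x - f y))\<^sup>2) = m * S - 2 * (a \<bullet> a) + m * S"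
    unfolding inner(2) using int by (simp add: a_def S_def m_def)
  finally show "(\<integral>\<^sup>+x. \<integral>\<^sup>+y. ennreal ((norm (f x - f y))\<^sup>2) \<partial>M \<partial>M)
    = ennreal (2 * measure M (space M) * (LINT x|M. (norm (f x))\<^sup>2) - 2 * (norm (LINT x|M. f x))\<^sup>2)"
    by (simp add: a_def S_def m_def power2_norm_eq_inner mult.assoc)
  have "0 \<le> (LINT x|M. LINT y|M. (norm (f x - f y))\<^sup>2)"
    by (intro integral_nonneg_AE AE_I2) simp
  with eq show "0 \<le> 2 * measure M (space M) * (LINT x|M. (norm (f x))\<^sup>2) - 2 * (norm (LINT x|M. f x))\<^sup>2"
    by (simp add: a_def S_def m_def power2_norm_eq_inner mult.assoc)
qed

section \<open>Rellich compactness\<close>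

lemma nn_integral_lborel_translate:
  fixes x :: "'a::euclidean_space"
  assumes "g \<in> borel_measurable borel"
  shows "(\<integral>\<^sup>+y. g y \<partial>lborel) = (\<integral>\<^sup>+z. g (x + z) \<partial>lborel)"
proof -
  have "(\<integral>\<^sup>+y. g y \<partial>lborel) = (\<integral>\<^sup>+y. g y \<partial>distr lborel borel ((+) x))" by (simp add: lborel_distr_plus)
  also have "\<dots> = (\<integral>\<^sup>+z. g (x + z) \<partial>lborel)" using assms by (intro nn_integral_distr) auto
  finally show ?thesis .
qed

text \<open>Substituting y = x + z and exchanging the integrals leaves, for each \<open>z\<close> in
  \<open>B\<close>, the squared norm of a translation difference, which is at most the square of |z|
  times the norm of the gradient.\<close>

lemma nn_integral_near_pairs_le:
  fixes f :: "real^'n \<Rightarrow> complex"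
  assumes f: "c1_cpt f" and B: "B \<in> sets borel" and b: "\<And>z. z \<in> B \<Longrightarrow> norm z \<le> d"
  shows "(\<integral>\<^sup>+x. \<integral>\<^sup>+y. indicator B (y - x) * ennreal ((norm (f x - f y))\<^sup>2) \<partial>lborel \<partial>lborel)
    \<le> ennreal ((d * norm (to_l2 (classical_grad f)))\<^sup>2) * emeasure lborel B"
proof -
  define G where "G = norm (to_l2 (classical_grad f))"
  have fc: "cont_cpt f" by (rule c1_cpt_cont_cpt[OF f])
  note [measurable] = cont_cpt_borel[OF fc] B
  have "(\<integral>\<^sup>+x. \<integral>\<^sup>+y. indicator B (y - x) * ennreal ((norm (f x - f y))\<^sup>2) \<partial>lborel \<partial>lborel)
      = (\<integral>\<^sup>+x. \<integral>\<^sup>+z. indicator B z * ennreal ((norm (f x - f (x + z)))\<^sup>2) \<partial>lborel \<partial>lborel)"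
  proof (rule nn_integral_cong)
    fix x
    show "(\<integral>\<^sup>+y. indicator B (y - x) * ennreal ((norm (f x - f y))\<^sup>2) \<partial>lborel)
        = (\<integral>\<^sup>+z. indicator B z * ennreal ((norm (f x - f (x + z)))\<^sup>2) \<partial>lborel)"
      by (subst nn_integral_lborel_translate[where x = x]) auto
  qed
  also have "\<dots> = (\<integral>\<^sup>+z. \<integral>\<^sup>+x. indicator B z * ennreal ((norm (f x - f (x + z)))\<^sup>2) \<partial>lborel \<partial>lborel)"
    by (intro lborel_pair.Fubini'[symmetric]) measurable
  also have "\<dots> \<le> (\<integral>\<^sup>+z. ennreal ((d * G)\<^sup>2) * indicator B z \<partial>lborel)"
  proof (rule nn_integral_mono)
    fix z :: "real^'n"
    have c: "cont_cpt (\<lambda>x. f (x + z) - f x)" by (intro cont_cpt_diff cont_cpt_translate fc)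
    have sq: "square_integrable (\<lambda>x. f (x + z) - f x)" by (rule square_integrable_cont_cpt[OF c])
    have "(\<integral>\<^sup>+x. ennreal ((norm (f x - f (x + z)))\<^sup>2) \<partial>lborel)
        = (\<integral>\<^sup>+x. ennreal ((norm (f (x + z) - f x))\<^sup>2) \<partial>lebesgue)"
      by (simp add: nn_integral_completion norm_minus_commute)
    also have "\<dots> = ennreal ((norm (to_l2 (\<lambda>x. f (x + z) - f x)))\<^sup>2)"
      using sq by (simp add: norm_to_l2) (simp add: square_integrable_def nn_integral_eq_integral)
    also have "\<dots> \<le> ennreal ((norm z * G)\<^sup>2)"
      unfolding G_def by (intro ennreal_leI power_mono norm_translate_diff_le_classical_grad f) auto
    finally have *: "(\<integral>\<^sup>+x. ennreal ((norm (f x - f (x + z)))\<^sup>2) \<partial>lborel) \<le> ennreal ((norm z * G)\<^sup>2)" .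
    show "(\<integral>\<^sup>+x. indicator B z * ennreal ((norm (f x - f (x + z)))\<^sup>2) \<partial>lborel) \<le> ennreal ((d * G)\<^sup>2) * indicator B z"
    proof (cases "z \<in> B")
      case True
      have "ennreal ((norm z * G)\<^sup>2) \<le> ennreal ((d * G)\<^sup>2)"
        using b[OF True] by (intro ennreal_leI power_mono mult_right_mono) (auto simp: G_def)
      from order_trans[OF * this] True show ?thesis by simp
    qed simp
  qed
  also have "\<dots> = ennreal ((d * G)\<^sup>2) * emeasure lborel B" by (simp add: nn_integral_cmult)
  finally show ?thesis by (simp add: G_def)
qed

text \<open>On each cell of a grid of mesh \<open>h\<close>, the mean square of \<open>\<phi>\<close> is the square of its mean plus half the
  mean of \<open>\<bar>\<phi> x - \<phi> y\<bar>\<^sup>2\<close> over pairs in the cell; pairs in a common cell differ by less than \<open>h\<close> in each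
  coordinate, so the sum of the latter terms is controlled by short translations.\<close>

theorem rellich_test_functions:
  fixes \<Omega> :: "(real^'n) set"
  assumes "bounded \<Omega>" "e > 0"
  shows "\<exists>(W :: ((int^'n) \<times> complex) set) v. finite W \<and> (\<forall>\<phi>\<in>test_functions \<Omega>.
    (norm (to_l2 \<phi>))\<^sup>2 \<le> (\<Sum>w\<in>W. (to_l2 \<phi> \<bullet> v w)\<^sup>2) + e * (norm (to_l2 (classical_grad \<phi>)))\<^sup>2)"
proof -
  obtain r where r: "r > 0" "\<And>x. x \<in> \<Omega> \<Longrightarrow> norm x \<le> r" using assms(1) by (auto simp: bounded_pos)
  define n where "n = CARD('n)"
  have n: "real n > 0" by (simp add: n_def)
  \<comment> \<open>The mesh solves (n h)^2 2^n = e: n h bounds the norm on the cube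
    \<open>B\<close> of differences, and 2^n is the ratio of the volume of \<open>B\<close> to that
    of a cell.\<close>
  define h where "h = sqrt (e / (real n ^ 2 * 2 ^ n))"
  have h: "h > 0" "h\<^sup>2 = e / (real n ^ 2 * 2 ^ n)" using assms(2) n by (simp_all add: h_def)
  define cell :: "real^'n \<Rightarrow> int^'n" where "cell x = (\<chi> i. \<lfloor>x $ i / h\<rfloor>)" for x
  \<comment> \<open>These half-open cubes partition the space, so sums over cells reproduce
    integrals exactly; the boxes spanned by \<open>lo\<close> and \<open>hi\<close> enclose and fill
    them for the volume estimates.\<close>
  define Q where "Q k = {x. cell x = k}" for k
  define lo hi :: "int^'n \<Rightarrow> real^'n"
    where "lo k = (\<chi> i. h * of_int (k $ i))" and "hi k = (\<chi> i. h * (of_int (k $ i) + 1))" for k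
  have Q_iff: "x \<in> Q k \<longleftrightarrow> (\<forall>i. h * of_int (k $ i) \<le> x $ i \<and> x $ i < h * (of_int (k $ i) + 1))" for x k
    using h(1) by (simp add: Q_def cell_def vec_eq_iff floor_eq_iff field_simps)
  have Qm[measurable]: "Q k \<in> sets borel" for k
  proof -
    have "Q k = (\<Inter>i. {x. h * of_int (k $ i) \<le> x $ i \<and> x $ i < h * (of_int (k $ i) + 1)})"
      using Q_iff by auto
    also have "\<dots> \<in> sets borel" by (intro sets.finite_INT) auto
    finally show ?thesis .
  qed
  have Qsub: "Q k \<subseteq> cbox (lo k) (hi k)" for k
    by (auto simp: mem_box_cart Q_iff lo_def hi_def less_imp_le)
  have Qsup: "box (lo k) (hi k) \<subseteq> Q k" for k
    by (auto simp: mem_box_cart Q_iff lo_def hi_def less_imp_le)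
  have Qfin: "emeasure lborel (Q k) < \<infinity>" for k
    by (rule emeasure_bounded_finite) (meson Qsub bounded_cbox bounded_subset)
  define c where "c = h ^ n"
  have c: "c > 0" using h by (simp add: c_def)
  have "measure lborel (box (lo k) (hi k)) = (\<Prod>b\<in>(Basis::(real^'n) set). h)" for k
  proof -
    have *: "(hi k - lo k) \<bullet> b = h" if "b \<in> Basis" for b
      using that by (auto simp: Basis_vec_def inner_axis lo_def hi_def algebra_simps)
    then have "lo k \<bullet> b \<le> hi k \<bullet> b" if "b \<in> Basis" for b
      using that h(1) by (metis inner_diff_left diff_ge_0_iff_ge less_imp_le)
    then show ?thesis by (simp add: measure_lborel_box_eq *)
  qed
  then have cbox: "measure lborel (box (lo k) (hi k)) = c" for k by (simp add: c_def n_def)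
  have Qc: "c \<le> measure lborel (Q k)" for k
    unfolding cbox[of k, symmetric] using Qfin[of k]
    by (intro measure_mono_fmeasurable Qsup) (auto simp: fmeasurable_def)
  define I where "I = cell ` \<Omega>"
  have "finite I"
  proof -
    have "cell x $ i \<in> {\<lfloor>- r / h\<rfloor>..\<lfloor>r / h\<rfloor>}" if "x \<in> \<Omega>" for x i
    proof -
      have "\<bar>x $ i\<bar> \<le> r" using component_le_norm_cart[of x i] r(2)[OF that] by linarith
      then have "- r / h \<le> x $ i / h" "x $ i / h \<le> r / h"
        using h(1) by (auto intro!: divide_right_mono simp del: minus_divide_left divide_minus_left)
      then show ?thesis by (auto simp: cell_def intro: floor_mono)
    qed
    then have "I \<subseteq> {k. \<forall>i. k $ i \<in> {\<lfloor>- r / h\<rfloor>..\<lfloor>r / h\<rfloor>}}" by (auto simp: I_def)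
    moreover have "finite {k::int^'n. \<forall>i. k $ i \<in> {\<lfloor>- r / h\<rfloor>..\<lfloor>r / h\<rfloor>}}"
    proof (rule finite_subset)
      let ?F = "{\<lfloor>- r / h\<rfloor>..\<lfloor>r / h\<rfloor>}"
      show "{k::int^'n. \<forall>i. k $ i \<in> ?F} \<subseteq> (\<lambda>f. \<chi> i. f i) ` (UNIV \<rightarrow>\<^sub>E ?F)"
      proof
        fix k :: "int^'n" assume "k \<in> {k. \<forall>i. k $ i \<in> ?F}"
        then have "(\<lambda>i. k $ i) \<in> UNIV \<rightarrow>\<^sub>E ?F" "k = (\<chi> i. k $ i)" by auto
        then show "k \<in> (\<lambda>f. \<chi> i. f i) ` (UNIV \<rightarrow>\<^sub>E ?F)" by blast
      qed
      show "finite ((\<lambda>f. \<chi> i. f i :: int^'n) ` (UNIV \<rightarrow>\<^sub>E ?F))" by (intro finite_imageI finite_PiE) auto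
    qed
    ultimately show ?thesis by (rule finite_subset)
  qed
  \<comment> \<open>Contains every difference of two points of a common cell, hence side length
    2h.\<close>
  define B where "B = cbox (\<chi> i. - h) (\<chi> i. h :: real^'n)"
  have near: "y - x \<in> B" if "cell x = cell y" for x y
  proof -
    have "\<bar>y $ i - x $ i\<bar> \<le> h" for i
      using Q_iff[of x "cell x"] Q_iff[of y "cell x"] that h(1)
      by (auto simp: Q_def abs_le_iff algebra_simps dest!: spec[of _ i])
    then show ?thesis by (auto simp: B_def mem_box_cart abs_le_iff) (smt (verit))+
  qed
  have Bnorm: "norm z \<le> real n * h" if "z \<in> B" for z
  proof -
    have "norm z \<le> (\<Sum>i\<in>UNIV. \<bar>z $ i\<bar>)" by (rule norm_le_l1_cart)
    also have "\<dots> \<le> (\<Sum>i\<in>(UNIV::'n set). h)"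
      using that by (intro sum_mono) (auto simp: B_def mem_box_cart abs_le_iff minus_le_iff)
    finally show ?thesis by (simp add: n_def)
  qed
  have Bmeas: "emeasure lborel B = ennreal (2 ^ n * c)"
  proof -
    have *: "((\<chi> i. h) - (\<chi> i. - h)) \<bullet> b = 2 * h" if "b \<in> Basis" for b :: "real^'n"
      using that by (auto simp: Basis_vec_def inner_axis)
    then have "(\<chi> i. - h) \<bullet> b \<le> (\<chi> i. h) \<bullet> b" if "b \<in> Basis" for b :: "real^'n"
      using that h(1) by (smt (verit) inner_diff_left)
    then have "emeasure lborel B = ennreal (\<Prod>b\<in>(Basis::(real^'n) set). 2 * h)"
      unfolding B_def by (subst emeasure_lborel_cbox) (auto simp: *)
    then show ?thesis by (simp add: n_def c_def power_mult_distrib)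
  qed
  \<comment> \<open>Up to normalisation these are the real and imaginary parts of the integral over
    a cell; the factor 1 / sqrt c turns the squares into |integral|^2 / c.\<close>
  define v where "v w = (1 / sqrt c) *\<^sub>R to_l2 (\<lambda>x. indicator (Q (fst w)) x *\<^sub>R snd w)"
    for w :: "(int^'n) \<times> complex"
  define W where "W = I \<times> (Basis :: complex set)"
  have "(norm (to_l2 \<phi>))\<^sup>2 \<le> (\<Sum>w\<in>W. (to_l2 \<phi> \<bullet> v w)\<^sup>2) + e * (norm (to_l2 (classical_grad \<phi>)))\<^sup>2"
    if \<phi>: "\<phi> \<in> test_functions \<Omega>" for \<phi>
  proof -
    define G where "G = norm (to_l2 (classical_grad \<phi>))"
    have f: "c1_cpt \<phi>" by (rule test_functions_c1_cpt[OF \<phi>])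
    have fc: "cont_cpt \<phi>" by (rule c1_cpt_cont_cpt[OF f])
    note [measurable] = cont_cpt_borel[OF fc]
    obtain Bd where Bd: "\<And>x. norm (\<phi> x) \<le> Bd" using cont_cpt_bound[OF fc] by blast
    define M where "M k = restrict_space lborel (Q k)" for k
    have spaceM: "space (M k) = Q k" for k by (simp add: M_def space_restrict_space)
    have measM: "measure (M k) (space (M k)) = measure lborel (Q k)" for k
      by (simp add: M_def space_restrict_space measure_restrict_space)
    have finM: "finite_measure (M k)" for k
      using Qfin[of k] by (intro finite_measureI) (simp add: M_def space_restrict_space emeasure_restrict_space)
    have \<phi>M: "\<phi> \<in> borel_measurable (M k)" for k
      unfolding M_def by (intro measurable_restrict_space1) simp
    define A where "A k = (LINT x|M k. \<phi> x)" for k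
    define S where "S k = (LINT x|M k. (norm (\<phi> x))\<^sup>2)" for k
    \<comment> \<open>The double integral of |\<phi> x - \<phi> y|^2 over pairs in cell
      \<open>k\<close>, in its variance form.\<close>
    define t where "t k = 2 * measure lborel (Q k) * S k - 2 * (norm (A k))\<^sup>2" for k
    have t_eq: "(\<integral>\<^sup>+x. \<integral>\<^sup>+y. ennreal ((norm (\<phi> x - \<phi> y))\<^sup>2) \<partial>M k \<partial>M k) = ennreal (t k)"
      and t0: "0 \<le> t k" for k
      using nn_integral_pairwise_distance[OF finM \<phi>M Bd, of k]
      by (simp_all add: t_def S_def A_def measM)
    have "ennreal (\<Sum>k\<in>I. t k) = (\<Sum>k\<in>I. \<integral>\<^sup>+x. \<integral>\<^sup>+y. ennreal ((norm (\<phi> x - \<phi> y))\<^sup>2) \<partial>M k \<partial>M k)"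
      by (simp add: t_eq t0)
    also have "\<dots> = (\<Sum>k\<in>I. \<integral>\<^sup>+x. \<integral>\<^sup>+y. ennreal ((norm (\<phi> x - \<phi> y))\<^sup>2) * indicator (Q k) y * indicator (Q k) x \<partial>lborel \<partial>lborel)"
      unfolding M_def
      by (intro sum.cong refl) (simp add: nn_integral_restrict_space nn_integral_multc)
    also have "\<dots> = (\<integral>\<^sup>+x. \<integral>\<^sup>+y. (\<Sum>k\<in>I. ennreal ((norm (\<phi> x - \<phi> y))\<^sup>2) * indicator (Q k) y * indicator (Q k) x) \<partial>lborel \<partial>lborel)"
      by (simp add: nn_integral_sum)
    \<comment> \<open>At most one cell contains both \<open>x\<close> and \<open>y\<close>, and then
      \<open>y - x\<close> lies in \<open>B\<close>; so the sum over cells collapses to a single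
      indicator.\<close>
    also have "\<dots> \<le> (\<integral>\<^sup>+x. \<integral>\<^sup>+y. indicator B (y - x) * ennreal ((norm (\<phi> x - \<phi> y))\<^sup>2) \<partial>lborel \<partial>lborel)"
    proof (intro nn_integral_mono)
      fix x y
      have "(\<Sum>k\<in>I. ennreal ((norm (\<phi> x - \<phi> y))\<^sup>2) * indicator (Q k) y * indicator (Q k) x)
          = (\<Sum>k\<in>I. if k = cell x then ennreal ((norm (\<phi> x - \<phi> y))\<^sup>2) * indicator (Q k) y else 0)"
        by (intro sum.cong) (auto simp: Q_def indicator_def)
      also have "\<dots> \<le> ennreal ((norm (\<phi> x - \<phi> y))\<^sup>2) * indicator (Q (cell x)) y"
        using \<open>finite I\<close> by (simp add: sum.delta)
      also have "\<dots> \<le> indicator B (y - x) * ennreal ((norm (\<phi> x - \<phi> y))\<^sup>2)"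
        using near[of x y] by (auto simp: Q_def indicator_def)
      finally show "(\<Sum>k\<in>I. ennreal ((norm (\<phi> x - \<phi> y))\<^sup>2) * indicator (Q k) y * indicator (Q k) x)
          \<le> indicator B (y - x) * ennreal ((norm (\<phi> x - \<phi> y))\<^sup>2)" .
    qed
    also have "\<dots> \<le> ennreal ((real n * h * G)\<^sup>2) * emeasure lborel B"
      unfolding G_def by (intro nn_integral_near_pairs_le f Bnorm) (simp_all add: B_def)
    also have "\<dots> = ennreal ((real n * h * G)\<^sup>2 * (2 ^ n * c))"
      using c by (simp add: Bmeas ennreal_mult)
    finally have "(\<Sum>k\<in>I. t k) \<le> (real n * h * G)\<^sup>2 * (2 ^ n * c)"
      using c by (subst (asm) ennreal_le_iff) auto
    also have "\<dots> = c * (e * G\<^sup>2)"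
      using n by (simp add: power_mult_distrib h(2))
    finally have t_le: "(\<Sum>k\<in>I. t k) \<le> c * (e * G\<^sup>2)" .
    have S0: "0 \<le> S k" for k unfolding S_def by (intro integral_nonneg_AE) auto
    have S_eq: "S k = (LINT x|lebesgue. indicator (Q k) x *\<^sub>R (norm (\<phi> x))\<^sup>2)" for k
      by (simp add: S_def M_def integral_restrict_space integral_completion)
    have sq: "square_integrable \<phi>" by (rule square_integrable_cont_cpt[OF fc])
    have Qleb: "Q k \<in> sets lebesgue" for k by simp
    have intQ: "integrable lebesgue (\<lambda>x. indicator (Q k) x *\<^sub>R (norm (\<phi> x))\<^sup>2)" for k
      using sq Qleb by (intro integrable_mult_indicator) (auto simp: square_integrable_def)
    \<comment> \<open>The cells indexed by \<open>I\<close> cover \<Omega>, and \<phi> vanishes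
      elsewhere.\<close>
    have "(\<Sum>k\<in>I. S k) = (LINT x|lebesgue. (\<Sum>k\<in>I. indicator (Q k) x *\<^sub>R (norm (\<phi> x))\<^sup>2))"
      unfolding S_eq by (rule Bochner_Integration.integral_sum[symmetric]) (rule intQ)
    also have "\<dots> = (LINT x|lebesgue. (norm (\<phi> x))\<^sup>2)"
    proof (rule Bochner_Integration.integral_cong[OF refl])
      fix x
      show "(\<Sum>k\<in>I. indicator (Q k) x *\<^sub>R (norm (\<phi> x))\<^sup>2) = (norm (\<phi> x))\<^sup>2"
      proof (cases "x \<in> \<Omega>")
        case True
        have "(\<Sum>k\<in>I. indicator (Q k) x *\<^sub>R (norm (\<phi> x))\<^sup>2) = (\<Sum>k\<in>I. if k = cell x then (norm (\<phi> x))\<^sup>2 else 0)"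
          by (intro sum.cong) (auto simp: Q_def indicator_def)
        then show ?thesis using True \<open>finite I\<close> by (simp add: I_def)
      next
        case False
        then have "\<phi> x = 0" using test_functions_support[OF \<phi>] by blast
        then show ?thesis by simp
      qed
    qed
    finally have S_sum: "(\<Sum>k\<in>I. S k) = (norm (to_l2 \<phi>))\<^sup>2" by (simp add: norm_to_l2 sq)
    have A_inner: "A k \<bullet> b = to_l2 \<phi> \<bullet> to_l2 (\<lambda>x. indicator (Q k) x *\<^sub>R b)" for k b
    proof -
      interpret finite_measure "M k" by (rule finM)
      have "integrable (M k) \<phi>" using \<phi>M Bd by (intro integrable_const_bound[where B = Bd]) auto
      then have "A k \<bullet> b = (LINT x|M k. \<phi> x \<bullet> b)" by (simp add: A_def)
      also have "\<dots> = (LINT x|lebesgue. \<phi> x \<bullet> (indicator (Q k) x *\<^sub>R b))"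
        by (simp add: M_def integral_restrict_space integral_completion mult.commute)
      also have "\<dots> = to_l2 \<phi> \<bullet> to_l2 (\<lambda>x. indicator (Q k) x *\<^sub>R b)"
      proof (rule inner_to_l2[symmetric, OF sq])
        show "square_integrable (\<lambda>x. indicator (Q k) x *\<^sub>R b)"
        proof (rule square_integrable_bound)
          show "integrable lebesgue (\<lambda>x. (norm b)\<^sup>2 * indicator (Q k) x :: real)"
            using Qfin[of k] by (intro integrable_mult_right integrable_real_indicator Qleb) simp
          show "(\<lambda>x. indicator (Q k) x *\<^sub>R b) \<in> borel_measurable lebesgue"
            using Qleb by (intro borel_measurable_scaleR borel_measurable_indicator) auto
        qed (auto simp: indicator_def)
      qed
      finally show ?thesis .
    qed
    have "(\<Sum>w\<in>W. (to_l2 \<phi> \<bullet> v w)\<^sup>2) = (\<Sum>k\<in>I. \<Sum>b\<in>Basis. (to_l2 \<phi> \<bullet> v (k, b))\<^sup>2)"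
      by (simp add: W_def sum.cartesian_product)
    also have "\<dots> = (\<Sum>k\<in>I. \<Sum>b\<in>Basis. (A k \<bullet> b)\<^sup>2 / c)"
      using c by (simp add: v_def A_inner power_divide)
    also have "\<dots> = (\<Sum>k\<in>I. (norm (A k))\<^sup>2 / c)"
    proof -
      have "(norm z)\<^sup>2 = (\<Sum>b\<in>Basis. (z \<bullet> b)\<^sup>2)" for z :: complex
        unfolding power2_norm_eq_inner by (subst euclidean_inner) (simp add: power2_eq_square)
      then show ?thesis by (simp only: sum_divide_distrib)
    qed
    finally have A_sum: "c * (\<Sum>w\<in>W. (to_l2 \<phi> \<bullet> v w)\<^sup>2) = (\<Sum>k\<in>I. (norm (A k))\<^sup>2)"
      using c by (simp add: sum_divide_distrib[symmetric])
    \<comment> \<open>As \<open>S k\<close> is nonnegative, the volume of a cell may be replaced by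
      its lower bound \<open>c\<close> in the variance identity, which is then summed over the
      cells.\<close>
    have "2 * c * (norm (to_l2 \<phi>))\<^sup>2 = (\<Sum>k\<in>I. 2 * c * S k)" by (simp add: S_sum[symmetric] sum_distrib_left)
    also have "\<dots> \<le> (\<Sum>k\<in>I. t k + 2 * (norm (A k))\<^sup>2)"
      using S0 Qc by (intro sum_mono) (simp add: t_def mult_right_mono)
    also have "\<dots> \<le> c * (e * G\<^sup>2) + 2 * (c * (\<Sum>w\<in>W. (to_l2 \<phi> \<bullet> v w)\<^sup>2))"
      unfolding A_sum using t_le by (simp add: sum.distrib sum_distrib_left)
    also have "\<dots> \<le> 2 * c * ((\<Sum>w\<in>W. (to_l2 \<phi> \<bullet> v w)\<^sup>2) + e * G\<^sup>2)"
      using c assms(2) by (simp add: algebra_simps)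
    finally show ?thesis using c by (simp add: G_def)
  qed
  moreover have "finite W" using \<open>finite I\<close> by (simp add: W_def)
  ultimately show ?thesis by blast
qed

section \<open>Bump functions\<close>

lemma Ck_Suc_imp_Ck:
  fixes f :: "'a::euclidean_space \<Rightarrow> 'b::real_normed_vector"
  shows "Ck (Suc k) f \<Longrightarrow> Ck k f"
proof (induction k arbitrary: f)
  case 0
  then show ?case by (auto intro!: differentiable_imp_continuous_on differentiable_at_imp_differentiable_on)
qed simp

lemma Ck_mult:
  fixes f g :: "'a::euclidean_space \<Rightarrow> real"
  shows "Ck k f \<Longrightarrow> Ck k g \<Longrightarrow> Ck k (\<lambda>x. f x * g x)"
proof (induction k arbitrary: f g)
  case 0
  then show ?case by (simp add: continuous_on_mult)
next
  case (Suc k)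
  have d: "((\<lambda>x. f x * g x) has_derivative
      (\<lambda>v. f x * frechet_derivative g (at x) v + frechet_derivative f (at x) v * g x)) (at x)" for x
    using Suc.prems by (intro has_derivative_mult) (simp_all add: frechet_derivative_works)
  have "Ck k f" "Ck k g" using Suc.prems Ck_Suc_imp_Ck by blast+
  then show ?case
    using Suc by (auto simp: frechet_derivative_at[OF d, symmetric] intro!: differentiableI[OF d] Ck_add)
qed

lemma Ck_const: "Ck k (\<lambda>_::'a::euclidean_space. c::'b::real_normed_vector)"
  by (induction k arbitrary: c) auto

lemma Ck_affine: "Ck k (\<lambda>x::'a::euclidean_space. a \<bullet> x + c :: real)"
proof (cases k)
  case 0
  then show ?thesis by (auto intro!: continuous_intros)
next
  case (Suc j)
  have d: "((\<lambda>x. a \<bullet> x + c) has_derivative (\<lambda>v. a \<bullet> v)) (at x)" for x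
    by (auto intro!: derivative_eq_intros)
  show ?thesis
    by (auto simp: Suc frechet_derivative_at[OF d, symmetric] Ck_const intro!: differentiableI[OF d])
qed

text \<open>The family \<open>exp (- 1 / s) / s\<^sup>m\<close>, extended by zero, is closed under differentiation up to linear
  combinations, so smoothness of the bump is an induction.\<close>

definition eflat :: "nat \<Rightarrow> real \<Rightarrow> real" where
  "eflat m s = (if s > 0 then exp (- inverse s) * inverse s ^ m else 0)"

text \<open>A single term of the exponential series at t = 1/s beats the power t^(m+2). Quadratic
  decay is what gives derivative zero at the origin.\<close>

lemma eflat_le_square: "\<bar>eflat m s\<bar> \<le> fact (m + 2) * s\<^sup>2"
proof (cases "s > 0")
  case True
  define t where "t = inverse s"
  have t: "t > 0" using True by (simp add: t_def)
  have "t ^ (m + 2) / fact (m + 2) \<le> exp t"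
  proof -
    have "inverse (fact (m + 2)) * t ^ (m + 2) = (\<Sum>n\<in>{m+2}. inverse (fact n) * t ^ n)" by simp
    also have "\<dots> \<le> (\<Sum>n. inverse (fact n) * t ^ n)"
      using t summable_exp[of t] by (intro sum_le_suminf) auto
    also have "\<dots> = exp t" by (simp add: exp_def)
    finally show ?thesis by (simp add: divide_inverse mult.commute)
  qed
  then have "t ^ m * t\<^sup>2 \<le> fact (m + 2) * exp t"
    by (simp add: field_simps power_add del: fact_Suc add_2_eq_Suc')
  then have "exp (- t) * t ^ m * t\<^sup>2 \<le> fact (m + 2)"
    using t by (simp add: exp_minus field_simps del: fact_Suc add_2_eq_Suc')
  then have "exp (- t) * t ^ m \<le> fact (m + 2) * s\<^sup>2"
    using True by (simp add: t_def field_simps del: fact_Suc add_2_eq_Suc')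
  then show ?thesis using True by (simp add: eflat_def t_def abs_mult del: fact_Suc add_2_eq_Suc')
qed (simp add: eflat_def)

text \<open>Differentiating the exponential raises the power of 1/s by two, differentiating the
  power raises it by one; at the origin the difference quotient is of order |h|.\<close>

lemma eflat_derivative:
  "(eflat m has_real_derivative (eflat (m + 2) s - real m * eflat (m + 1) s)) (at s)"
proof -
  consider "s > 0" | "s < 0" | "s = 0" by linarith
  then show ?thesis
  proof cases
    case 1
    have "((\<lambda>s. exp (- inverse s) * inverse s ^ m) has_real_derivative
        exp (- inverse s) * (inverse s)\<^sup>2 * inverse s ^ m
          - exp (- inverse s) * (real m * inverse s ^ (m - 1) * (inverse s)\<^sup>2)) (at s)"
      using 1 by (auto intro!: derivative_eq_intros simp: power2_eq_square algebra_simps)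
    also have "exp (- inverse s) * (inverse s)\<^sup>2 * inverse s ^ m
          - exp (- inverse s) * (real m * inverse s ^ (m - 1) * (inverse s)\<^sup>2)
        = eflat (m + 2) s - real m * eflat (m + 1) s"
      \<comment> \<open>For \<open>m = 0\<close> the exponent \<open>m - 1\<close> is truncated, but
        its coefficient vanishes.\<close>
      using 1 by (cases m) (simp_all add: eflat_def power2_eq_square algebra_simps)
    finally show ?thesis
      by (rule has_field_derivative_transform_within_open[where S = "{0<..}"]) (use 1 in \<open>auto simp: eflat_def\<close>)
  next
    case 2
    have "((\<lambda>_. 0) has_real_derivative (eflat (m + 2) s - real m * eflat (m + 1) s)) (at s)"
      using 2 by (simp add: eflat_def)
    then show ?thesis
      by (rule has_field_derivative_transform_within_open[where S = "{..<0}"]) (use 2 in \<open>auto simp: eflat_def\<close>)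
  next
    case 3
    have "((\<lambda>h. eflat m h / h) \<longlongrightarrow> 0) (at 0)"
    proof (rule Lim_null_comparison)
      show "\<forall>\<^sub>F h in at 0. norm (eflat m h / h) \<le> fact (m + 2) * \<bar>h\<bar>"
        unfolding eventually_at_filter
      proof (intro always_eventually allI impI)
        fix h :: real assume "h \<noteq> 0"
        then show "norm (eflat m h / h) \<le> fact (m + 2) * \<bar>h\<bar>"
          using eflat_le_square[of m h]
          by (simp add: abs_divide divide_le_eq power2_eq_square mult.assoc abs_mult_self_eq del: fact_Suc add_2_eq_Suc')
      qed
      have "((\<lambda>h::real. fact (m + 2) * \<bar>h\<bar>) \<longlongrightarrow> fact (m + 2) * \<bar>0\<bar>) (at 0)" by (intro tendsto_intros)
      then show "((\<lambda>h::real. fact (m + 2) * \<bar>h\<bar>) \<longlongrightarrow> 0) (at 0)" by simp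
    qed
    then show ?thesis by (simp add: 3 DERIV_def eflat_def)
  qed
qed

text \<open>The index \<open>m\<close> must vary in the induction, since the derivative involves
  \<open>m + 1\<close> and \<open>m + 2\<close>. The inner function is quadratic, so its derivative
  in a fixed direction is affine in the point.\<close>

lemma Ck_eflat_ball:
  fixes a :: "'a::euclidean_space"
  shows "Ck k (\<lambda>x. eflat m (R - (norm (x - a))\<^sup>2))"
proof (induction k arbitrary: m)
  case 0
  have "continuous_on UNIV (eflat m)"
    using eflat_derivative by (meson DERIV_isCont continuous_at_imp_continuous_on)
  then show ?case by (auto intro!: continuous_intros elim!: continuous_on_compose2)
next
  case (Suc k)
  have d: "((\<lambda>x. eflat m (R - (norm (x - a))\<^sup>2)) has_derivative
     (\<lambda>v. (eflat (m + 2) (R - (norm (x - a))\<^sup>2) + (- real m) * eflat (m + 1) (R - (norm (x - a))\<^sup>2)) *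
        (((-2) *\<^sub>R v) \<bullet> x + 2 * (v \<bullet> a)))) (at x)" for x
  proof -
    have "((\<lambda>x. R - (norm (x - a))\<^sup>2) has_derivative (\<lambda>v. ((-2) *\<^sub>R v) \<bullet> x + 2 * (v \<bullet> a))) (at x)"
      unfolding power2_norm_eq_inner
      by (auto intro!: derivative_eq_intros simp: inner_diff_left inner_diff_right inner_commute fun_eq_iff algebra_simps)
    moreover have "(eflat m has_derivative (\<lambda>t. (eflat (m + 2) s - real m * eflat (m + 1) s) * t)) (at s)" for s
      using eflat_derivative[of m s] by (simp add: has_field_derivative_def)
    ultimately show ?thesis using has_derivative_compose by fastforce
  qed
  show ?case
    unfolding Ck.simps frechet_derivative_at[OF d, symmetric]
  proof (intro conjI allI)
    fix v
    show "Ck k (\<lambda>x. (eflat (m + 2) (R - (norm (x - a))\<^sup>2) + (- real m) * eflat (m + 1) (R - (norm (x - a))\<^sup>2)) *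
        (((-2) *\<^sub>R v) \<bullet> x + 2 * (v \<bullet> a)))"
      by (rule Ck_mult[OF Ck_add[OF Suc Ck_mult[OF Ck_const Suc]] Ck_affine])
  qed (rule differentiableI[OF d])
qed

text \<open>Provides a pair with nonzero first component, so that the Rayleigh quotient is taken
  over a nonempty set. The bump is nonzero on a ball, which is not a null set.\<close>

lemma nontrivial_test_function:
  fixes \<Omega> :: "(real^'n) set"
  assumes "open \<Omega>" "\<Omega> \<noteq> {}"
  shows "\<exists>\<phi>\<in>test_functions \<Omega>. to_l2 \<phi> \<noteq> 0"
proof -
  obtain a r where r: "r > 0" "cball a r \<subseteq> \<Omega>" using assms by (metis ex_in_conv open_contains_cball)
  define \<phi> where "\<phi> x = complex_of_real (eflat 0 (r\<^sup>2 - (norm (x - a))\<^sup>2))" for x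
  have out: "\<phi> x = 0" if "x \<notin> cball a r" for x
  proof -
    have "r\<^sup>2 \<le> (norm (x - a))\<^sup>2" using that r by (intro power_mono) (auto simp: dist_norm norm_minus_commute)
    then show ?thesis by (simp add: \<phi>_def eflat_def)
  qed
  have \<phi>: "\<phi> \<in> test_functions \<Omega>"
  proof (rule test_functionsI)
    show "Ck k \<phi>" for k
      unfolding \<phi>_def[abs_def] by (rule Ck_bounded_linear[OF bounded_linear_of_real Ck_eflat_ball])
  qed (use r out in auto)
  have pos: "\<phi> x \<noteq> 0" if "x \<in> ball a r" for x
  proof -
    have "(norm (x - a))\<^sup>2 < r\<^sup>2" using that r by (intro power_strict_mono) (auto simp: dist_norm norm_minus_commute)
    then show ?thesis by (simp add: \<phi>_def eflat_def)
  qed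
  have "to_l2 \<phi> \<noteq> 0"
  proof
    assume "to_l2 \<phi> = 0"
    moreover have "square_integrable \<phi>"
      using \<phi> by (intro square_integrable_cont_cpt c1_cpt_cont_cpt test_functions_c1_cpt)
    ultimately have "AE x in lebesgue. \<phi> x = 0"
      using to_l2_eq_iff[of \<phi> "\<lambda>_. 0"] by (simp add: to_l2_0 square_integrable_0)
    then have "AE x in lebesgue. x \<notin> ball a r" by eventually_elim (use pos in blast)
    then have "ball a r \<in> null_sets lebesgue" by (simp add: AE_iff_null_sets)
    then show False using open_not_negligible[of "ball a r"] r by (simp add: negligible_iff_null_sets)
  qed
  with \<phi> show ?thesis by blast
qed

section \<open>The space of pairs of a function and its weak gradient\<close>

lemma subspace_closure:
  fixes S :: "'a::real_normed_vector set"
  assumes "subspace S"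
  shows "subspace (closure S)"
proof (rule subspaceI)
  show "0 \<in> closure S" using subspace_0[OF assms] closure_subset by blast
next
  fix x y assume "x \<in> closure S" "y \<in> closure S"
  then obtain f g where "\<And>n. f n \<in> S" "f \<longlonglongrightarrow> x" "\<And>n. g n \<in> S" "g \<longlonglongrightarrow> y"
    by (metis closure_sequential)
  then show "x + y \<in> closure S"
    using assms by (auto simp: closure_sequential intro!: exI[of _ "\<lambda>n. f n + g n"] tendsto_add subspace_add)
next
  fix c x assume "x \<in> closure S"
  then obtain f where "\<And>n. f n \<in> S" "f \<longlonglongrightarrow> x" by (metis closure_sequential)
  then show "c *\<^sub>R x \<in> closure S"
    using assms by (auto simp: closure_sequential intro!: exI[of _ "\<lambda>n. c *\<^sub>R f n"] tendsto_scaleR subspace_scale)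
qed

type_synonym 'n h1 = "(real^'n, complex) l2 \<times> (real^'n, complex^'n) l2"

definition h1_test :: "(real^'n \<Rightarrow> complex) \<Rightarrow> 'n h1" where
  "h1_test \<phi> = (to_l2 \<phi>, to_l2 (classical_grad \<phi>))"

text \<open>The closure of the graph of the classical gradient. That this closure is again a graph
  is the closability of the gradient, proved below.\<close>

definition h10 :: "(real^'n) set \<Rightarrow> 'n h1 set" where
  "h10 \<Omega> = closure (h1_test ` test_functions \<Omega>)"

lemma closed_h10: "closed (h10 \<Omega>)" by (simp add: h10_def)

lemma h1_test_in_h10: "\<phi> \<in> test_functions \<Omega> \<Longrightarrow> h1_test \<phi> \<in> h10 \<Omega>"
  unfolding h10_def by (rule subsetD[OF closure_subset]) simp

text \<open>Density: closed conditions, such as identities and inequalities between continuous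
  expressions, need checking on test functions only.\<close>

lemma h10_induct:
  assumes "p \<in> h10 \<Omega>" "closed {p. P p}" "\<And>\<phi>. \<phi> \<in> test_functions \<Omega> \<Longrightarrow> P (h1_test \<phi>)"
  shows "P p"
proof -
  have "h10 \<Omega> \<subseteq> {p. P p}" unfolding h10_def using assms(2,3) by (intro closure_minimal) auto
  with assms(1) show ?thesis by blast
qed

lemma square_integrable_test_function:
  assumes "\<phi> \<in> test_functions \<Omega>"
  shows "square_integrable \<phi>" "square_integrable (classical_grad \<phi>)"
  using assms by (auto intro: square_integrable_cont_cpt c1_cpt_cont_cpt cont_cpt_classical_grad test_functions_c1_cpt)

lemma subspace_h10:
  fixes \<Omega> :: "(real^'n) set"
  shows "subspace (h10 \<Omega>)"
  unfolding h10_def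
proof (rule subspace_closure, rule subspaceI)
  have "classical_grad (\<lambda>_. 0) = (\<lambda>_. 0 :: complex^'n)" by (simp add: classical_grad_def fun_eq_iff vec_eq_iff)
  then have "h1_test (\<lambda>_::real^'n. 0) = 0" by (simp add: h1_test_def to_l2_0 zero_prod_def)
  then show "0 \<in> h1_test ` test_functions \<Omega>" using test_functions_zero by (metis imageI)
next
  fix p q assume "p \<in> h1_test ` test_functions \<Omega>" "q \<in> h1_test ` test_functions \<Omega>"
  then obtain \<phi> \<psi> where \<phi>: "\<phi> \<in> test_functions \<Omega>" "p = h1_test \<phi>" and \<psi>: "\<psi> \<in> test_functions \<Omega>" "q = h1_test \<psi>"
    by blast
  have "classical_grad (\<lambda>x. \<phi> x + \<psi> x) = (\<lambda>x. classical_grad \<phi> x + classical_grad \<psi> x)"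
    using \<phi>(1) \<psi>(1) by (intro ext classical_grad_add c1_cpt_differentiable test_functions_c1_cpt)
  then have "p + q = h1_test (\<lambda>x. \<phi> x + \<psi> x)"
    by (simp add: \<phi> \<psi> h1_test_def to_l2_add square_integrable_test_function[OF \<phi>(1)] square_integrable_test_function[OF \<psi>(1)])
  then show "p + q \<in> h1_test ` test_functions \<Omega>" using test_functions_add[OF \<phi>(1) \<psi>(1)] by blast
next
  fix c p assume "p \<in> h1_test ` test_functions \<Omega>"
  then obtain \<phi> where \<phi>: "\<phi> \<in> test_functions \<Omega>" "p = h1_test \<phi>" by blast
  have bl: "bounded_linear (\<lambda>z::complex. c *\<^sub>R z)" by (rule bounded_linear_scaleR_right)
  have "classical_grad (\<lambda>x. c *\<^sub>R \<phi> x) = (\<lambda>x. c *\<^sub>R classical_grad \<phi> x)"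
    using \<phi>(1) by (intro ext, subst classical_grad_bounded_linear[OF bl])
      (auto simp: vec_eq_iff intro: c1_cpt_differentiable test_functions_c1_cpt)
  then have "c *\<^sub>R p = h1_test (\<lambda>x. c *\<^sub>R \<phi> x)"
    by (simp add: \<phi> h1_test_def to_l2_scaleR square_integrable_test_function[OF \<phi>(1)])
  then show "c *\<^sub>R p \<in> h1_test ` test_functions \<Omega>" using test_functions_bounded_linear[OF bl \<phi>(1)] by blast
qed

lemma poincare_h10:
  fixes \<Omega> :: "(real^'n) set"
  assumes "bounded \<Omega>"
  obtains K where "K > 0" "\<And>p. p \<in> h10 \<Omega> \<Longrightarrow> norm (fst p) \<le> K * norm (snd p)"
proof -
  obtain K where K: "K > 0"
    "\<And>\<phi>. \<phi> \<in> test_functions \<Omega> \<Longrightarrow> norm (to_l2 \<phi>) \<le> K * norm (to_l2 (classical_grad \<phi>))"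
    using poincare_test_functions[OF assms] by metis
  have "norm (fst p) \<le> K * norm (snd p)" if "p \<in> h10 \<Omega>" for p
    using that by (rule h10_induct) (auto simp: h1_test_def K intro!: closed_Collect_le continuous_intros)
  with K that show ?thesis by blast
qed

lemma rellich_h10:
  fixes \<Omega> :: "(real^'n) set"
  assumes "bounded \<Omega>"
  shows "compact (closure (fst ` {p \<in> h10 \<Omega>. norm p \<le> M}))"
proof (rule compact_fst_of_finite_functionals[OF subspace_h10])
  fix e :: real assume "e > 0"
  then obtain W :: "((int^'n) \<times> complex) set" and v where W: "finite W"
    "\<And>\<phi>. \<phi> \<in> test_functions \<Omega> \<Longrightarrow>
      (norm (to_l2 \<phi>))\<^sup>2 \<le> (\<Sum>w\<in>W. (to_l2 \<phi> \<bullet> v w)\<^sup>2) + e * (norm (to_l2 (classical_grad \<phi>)))\<^sup>2"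
    using rellich_test_functions[OF assms] by metis
  have "(norm (fst p))\<^sup>2 \<le> (\<Sum>w\<in>W. (fst p \<bullet> v w)\<^sup>2) + e * (norm (snd p))\<^sup>2" if "p \<in> h10 \<Omega>" for p
    using that by (rule h10_induct) (auto simp: h1_test_def W intro!: closed_Collect_le continuous_intros)
  with W(1) show "\<exists>(W :: ((int^'n) \<times> complex) set) v. finite W \<and> (\<forall>p\<in>h10 \<Omega>.
      (norm (fst p))\<^sup>2 \<le> (\<Sum>w\<in>W. (fst p \<bullet> v w)\<^sup>2) + e * (norm (snd p))\<^sup>2)"
    by blast
qed

lemma inner_to_l2_vec:
  fixes F G :: "'a::euclidean_space \<Rightarrow> complex^'n"
  assumes F: "square_integrable F" and G: "square_integrable G"
    and Fi: "\<And>i. square_integrable (\<lambda>x. F x $ i)" and Gi: "\<And>i. square_integrable (\<lambda>x. G x $ i)"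
  shows "to_l2 F \<bullet> to_l2 G = (\<Sum>i\<in>UNIV. to_l2 (\<lambda>x. F x $ i) \<bullet> to_l2 (\<lambda>x. G x $ i))"
  using Fi Gi by (simp add: inner_to_l2 F G inner_vec_def square_integrable_inner)

text \<open>Integrating by parts against gradients of test functions only, whose components are again
  test functions, avoids any density theorem.\<close>

lemma h10_gradient_unique:
  fixes \<Omega> :: "(real^'n) set"
  assumes p: "p \<in> h10 \<Omega>" and 0: "fst p = 0"
  shows "snd p = 0"
proof -
  have "snd p \<bullet> to_l2 (classical_grad \<psi>) = 0" if \<psi>: "\<psi> \<in> test_functions \<Omega>" for \<psi>
  proof -
    define \<psi>i where "\<psi>i i x = frechet_derivative \<psi> (at x) (axis i 1)" for i x
    have \<psi>i: "\<psi>i i \<in> test_functions \<Omega>" for i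
      unfolding \<psi>i_def by (rule test_functions_frechet_derivative[OF \<psi>])
    \<comment> \<open>The class of the Laplacian of \<psi>.\<close>
    define Y where "Y = (\<Sum>i\<in>UNIV. to_l2 (\<lambda>x. frechet_derivative (\<psi>i i) (at x) (axis i 1)))"
    have "snd p \<bullet> to_l2 (classical_grad \<psi>) = - (fst p \<bullet> Y)"
      using p
    proof (rule h10_induct)
      show "closed {p. snd p \<bullet> to_l2 (classical_grad \<psi>) = - (fst p \<bullet> Y)}"
        by (intro closed_Collect_eq continuous_intros)
      fix \<phi> assume \<phi>: "\<phi> \<in> test_functions \<Omega>"
      have comp: "square_integrable (\<lambda>x. classical_grad \<phi> x $ i)" "square_integrable (\<lambda>x. classical_grad \<psi> x $ i)" for i
        by (simp_all add: classical_grad_def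
            square_integrable_test_function(1)[OF test_functions_frechet_derivative[OF \<phi>]]
            square_integrable_test_function(1)[OF test_functions_frechet_derivative[OF \<psi>]])
      have "to_l2 (classical_grad \<phi>) \<bullet> to_l2 (classical_grad \<psi>)
          = (\<Sum>i\<in>UNIV. to_l2 (\<lambda>x. classical_grad \<phi> x $ i) \<bullet> to_l2 (\<lambda>x. classical_grad \<psi> x $ i))"
        using comp by (intro inner_to_l2_vec square_integrable_test_function[OF \<phi>] square_integrable_test_function[OF \<psi>])
      also have "\<dots> = (\<Sum>i\<in>UNIV. to_l2 (\<lambda>x. frechet_derivative \<phi> (at x) (axis i 1)) \<bullet> to_l2 (\<psi>i i))"
        by (simp add: classical_grad_def \<psi>i_def[abs_def])
      also have "\<dots> = (\<Sum>i\<in>UNIV. - (to_l2 \<phi> \<bullet> to_l2 (\<lambda>x. frechet_derivative (\<psi>i i) (at x) (axis i 1))))"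
        by (intro sum.cong refl l2_integration_by_parts test_functions_c1_cpt[OF \<phi>] test_functions_c1_cpt[OF \<psi>i])
      finally show "snd (h1_test \<phi>) \<bullet> to_l2 (classical_grad \<psi>) = - (fst (h1_test \<phi>) \<bullet> Y)"
        by (simp add: h1_test_def Y_def inner_sum_right sum_negf)
    qed
    then show ?thesis by (simp add: 0)
  qed
  \<comment> \<open>Gradients of test functions are dense among the second components, so
    \<open>snd p\<close> is in particular orthogonal to itself.\<close>
  then have "snd p \<bullet> snd q = 0" if "q \<in> h10 \<Omega>" for q
    using that by (rule_tac h10_induct) (auto simp: h1_test_def intro!: closed_Collect_eq continuous_intros)
  from this[OF p] show ?thesis by simp
qed

section \<open>From functions on \<Omega> to classes on the whole space\<close>

text \<open>Erases the irrelevant values off \<Omega>, so that a.e. equality, integrals and square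
  integrability on \<Omega> become statements on the whole space.\<close>

definition ext0 :: "'a set \<Rightarrow> ('a \<Rightarrow> 'b::zero) \<Rightarrow> 'a \<Rightarrow> 'b" where
  "ext0 \<Omega> u x = (if x \<in> \<Omega> then u x else 0)"

lemma ext0_in [simp]: "x \<in> \<Omega> \<Longrightarrow> ext0 \<Omega> u x = u x" and ext0_out [simp]: "x \<notin> \<Omega> \<Longrightarrow> ext0 \<Omega> u x = 0"
  by (simp_all add: ext0_def)

context
  fixes \<Omega> :: "'a::euclidean_space set"
  assumes open_\<Omega>: "open \<Omega>"
begin

lemma sets_lebesgue_\<Omega>: "\<Omega> \<in> sets lebesgue"
  using open_\<Omega> by (simp add: borel_open)

lemma integral_lebesgue_on_ext0:
  fixes f :: "'a \<Rightarrow> 'b::{banach, second_countable_topology}"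
  shows "(LINT x|lebesgue_on \<Omega>. f x) = (LINT x|lebesgue. ext0 \<Omega> f x)"
  using sets_lebesgue_\<Omega> by (subst integral_restrict_space) (auto intro!: Bochner_Integration.integral_cong simp: ext0_def)

lemma integrable_lebesgue_on_ext0:
  fixes f :: "'a \<Rightarrow> 'b::{banach, second_countable_topology}"
  shows "integrable (lebesgue_on \<Omega>) f \<longleftrightarrow> integrable lebesgue (ext0 \<Omega> f)"
proof -
  have "ext0 \<Omega> f = (\<lambda>x. indicator \<Omega> x *\<^sub>R f x)" by (auto simp: ext0_def)
  then show ?thesis using sets_lebesgue_\<Omega> by (simp add: integrable_restrict_space)
qed

lemma L2_iff_square_integrable:
  fixes u :: "'a \<Rightarrow> 'b::euclidean_space"
  shows "u \<in> L2 \<Omega> \<longleftrightarrow> square_integrable (ext0 \<Omega> u)"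
proof -
  have "ext0 \<Omega> u = (\<lambda>x. indicator \<Omega> x *\<^sub>R u x)" by (auto simp: ext0_def)
  then have "u \<in> borel_measurable (lebesgue_on \<Omega>) \<longleftrightarrow> ext0 \<Omega> u \<in> borel_measurable lebesgue"
    using sets_lebesgue_\<Omega> by (simp add: borel_measurable_restrict_space_iff)
  moreover have "ext0 \<Omega> (\<lambda>x. (norm (u x))\<^sup>2) = (\<lambda>x. (norm (ext0 \<Omega> u x))\<^sup>2)" by (auto simp: ext0_def)
  ultimately show ?thesis by (simp add: L2_def square_integrable_def integrable_lebesgue_on_ext0)
qed

lemma square_integrable_ext0:
  fixes f :: "'a \<Rightarrow> 'b::euclidean_space"
  assumes "square_integrable f"
  shows "square_integrable (ext0 \<Omega> f)"
proof (rule square_integrable_bound)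
  show "integrable lebesgue (\<lambda>x. (norm (f x))\<^sup>2)" using assms by (simp add: square_integrable_def)
  have "ext0 \<Omega> f = (\<lambda>x. indicator \<Omega> x *\<^sub>R f x)" by (auto simp: ext0_def)
  then show "ext0 \<Omega> f \<in> borel_measurable lebesgue"
    using assms sets_lebesgue_\<Omega>
    by (auto simp: square_integrable_def intro!: borel_measurable_scaleR borel_measurable_indicator)
qed (simp add: ext0_def)

lemma AE_lebesgue_on_iff:
  "(AE x in lebesgue_on \<Omega>. P x) \<longleftrightarrow> (AE x in lebesgue. x \<in> \<Omega> \<longrightarrow> P x)"
  using sets_lebesgue_\<Omega> by (simp add: AE_restrict_space_iff)

lemma to_l2_ext0_eq_iff:
  fixes u v :: "'a \<Rightarrow> 'b::euclidean_space"
  assumes "u \<in> L2 \<Omega>" "v \<in> L2 \<Omega>"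
  shows "to_l2 (ext0 \<Omega> u) = to_l2 (ext0 \<Omega> v) \<longleftrightarrow> (AE x in lebesgue_on \<Omega>. u x = v x)"
proof -
  have "to_l2 (ext0 \<Omega> u) = to_l2 (ext0 \<Omega> v) \<longleftrightarrow> (AE x in lebesgue. ext0 \<Omega> u x = ext0 \<Omega> v x)"
    using assms by (simp add: to_l2_eq_iff L2_iff_square_integrable)
  also have "(\<lambda>x. ext0 \<Omega> u x = ext0 \<Omega> v x) = (\<lambda>x. x \<in> \<Omega> \<longrightarrow> u x = v x)" by (auto simp: ext0_def)
  finally show ?thesis by (simp add: AE_lebesgue_on_iff)
qed

lemma inner_to_l2_ext0:
  fixes u v :: "'a \<Rightarrow> 'b::euclidean_space"
  assumes "u \<in> L2 \<Omega>" "v \<in> L2 \<Omega>"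
  shows "to_l2 (ext0 \<Omega> u) \<bullet> to_l2 (ext0 \<Omega> v) = (LINT x|lebesgue_on \<Omega>. u x \<bullet> v x)"
    and "integrable (lebesgue_on \<Omega>) (\<lambda>x. u x \<bullet> v x)"
proof -
  have "ext0 \<Omega> (\<lambda>x. u x \<bullet> v x) = (\<lambda>x. ext0 \<Omega> u x \<bullet> ext0 \<Omega> v x)" by (auto simp: ext0_def)
  then show "to_l2 (ext0 \<Omega> u) \<bullet> to_l2 (ext0 \<Omega> v) = (LINT x|lebesgue_on \<Omega>. u x \<bullet> v x)"
    "integrable (lebesgue_on \<Omega>) (\<lambda>x. u x \<bullet> v x)"
    using assms by (simp_all add: inner_to_l2 L2_iff_square_integrable integral_lebesgue_on_ext0
        integrable_lebesgue_on_ext0 square_integrable_inner)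
qed

end

lemma ext0_test_function:
  fixes \<Omega> :: "(real^'n) set"
  assumes "\<phi> \<in> test_functions \<Omega>"
  shows "ext0 \<Omega> \<phi> = \<phi>" "ext0 \<Omega> (classical_grad \<phi>) = classical_grad \<phi>"
proof -
  obtain K where K: "compact K" "K \<subseteq> \<Omega>" "\<And>x. x \<notin> K \<Longrightarrow> \<phi> x = 0"
    using test_functions_support[OF assms] by blast
  then show "ext0 \<Omega> \<phi> = \<phi>" by (auto simp: ext0_def fun_eq_iff)
  show "ext0 \<Omega> (classical_grad \<phi>) = classical_grad \<phi>"
  proof
    fix x
    show "ext0 \<Omega> (classical_grad \<phi>) x = classical_grad \<phi> x"
      using classical_grad_zero_outside[of K \<phi> x] K by (cases "x \<in> \<Omega>") auto
  qed
qed

lemma test_function_L2: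
  fixes \<Omega> :: "(real^'n) set"
  assumes "open \<Omega>" "\<phi> \<in> test_functions \<Omega>"
  shows "\<phi> \<in> L2 \<Omega>" "classical_grad \<phi> \<in> L2 \<Omega>"
  using assms by (simp_all add: L2_iff_square_integrable ext0_test_function square_integrable_test_function)

lemma L2_diff: "open \<Omega> \<Longrightarrow> u \<in> L2 \<Omega> \<Longrightarrow> v \<in> L2 \<Omega> \<Longrightarrow> (\<lambda>x. u x - v x) \<in> L2 \<Omega>"
proof -
  assume "open \<Omega>" "u \<in> L2 \<Omega>" "v \<in> L2 \<Omega>"
  moreover have "ext0 \<Omega> (\<lambda>x. u x - v x) = (\<lambda>x. ext0 \<Omega> u x - ext0 \<Omega> v x)" by (auto simp: ext0_def)
  ultimately show ?thesis by (simp add: L2_iff_square_integrable square_integrable_diff)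
qed

text \<open>The sum of the two squared distances in \<open>H10_limit\<close> is the squared product
  norm of the difference of pairs, so the approximating sequence expresses membership in the
  sequential closure.\<close>

lemma H10_limit_iff:
  fixes \<Omega> :: "(real^'n) set"
  assumes "open \<Omega>"
  shows "H10_limit \<Omega> u g \<longleftrightarrow> u \<in> L2 \<Omega> \<and> g \<in> L2 \<Omega> \<and> (to_l2 (ext0 \<Omega> u), to_l2 (ext0 \<Omega> g)) \<in> h10 \<Omega>"
proof -
  have "(\<exists>\<phi> :: nat \<Rightarrow> real^'n \<Rightarrow> complex. (\<forall>k. \<phi> k \<in> test_functions \<Omega>) \<and>
        (\<lambda>k. (LINT x|lebesgue_on \<Omega>. (norm (\<phi> k x - u x))\<^sup>2) +
             (LINT x|lebesgue_on \<Omega>. (norm (classical_grad (\<phi> k) x - g x))\<^sup>2)) \<longlonglongrightarrow> 0)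
      \<longleftrightarrow> (to_l2 (ext0 \<Omega> u), to_l2 (ext0 \<Omega> g)) \<in> h10 \<Omega>" (is "?lhs \<longleftrightarrow> ?p \<in> _")
    if u: "u \<in> L2 \<Omega>" and g: "g \<in> L2 \<Omega>"
  proof -
    have dist: "(LINT x|lebesgue_on \<Omega>. (norm (w x - w' x))\<^sup>2) = (norm (to_l2 (ext0 \<Omega> w) - to_l2 (ext0 \<Omega> w')))\<^sup>2"
      if "w \<in> L2 \<Omega>" "w' \<in> L2 \<Omega>" for w w' :: "real^'n \<Rightarrow> 'z::euclidean_space"
    proof -
      have "to_l2 (ext0 \<Omega> w) - to_l2 (ext0 \<Omega> w') = to_l2 (\<lambda>x. ext0 \<Omega> w x - ext0 \<Omega> w' x)"
        using that assms by (simp add: to_l2_diff L2_iff_square_integrable)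
      also have "(\<lambda>x. ext0 \<Omega> w x - ext0 \<Omega> w' x) = ext0 \<Omega> (\<lambda>x. w x - w' x)" by (auto simp: ext0_def)
      finally show ?thesis
        using inner_to_l2_ext0(1)[OF assms L2_diff[OF assms that] L2_diff[OF assms that]]
        by (simp add: power2_norm_eq_inner)
    qed
    have norm_eq: "(LINT x|lebesgue_on \<Omega>. (norm (\<phi> x - u x))\<^sup>2) +
             (LINT x|lebesgue_on \<Omega>. (norm (classical_grad \<phi> x - g x))\<^sup>2) = (norm (h1_test \<phi> - ?p))\<^sup>2"
      if "\<phi> \<in> test_functions \<Omega>" for \<phi>
      using dist[OF test_function_L2(1)[OF assms that] u] dist[OF test_function_L2(2)[OF assms that] g] that
      by (simp add: ext0_test_function h1_test_def norm_Pair)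
    have conv: "(\<lambda>k. (norm (X k - ?p))\<^sup>2) \<longlonglongrightarrow> 0 \<longleftrightarrow> X \<longlonglongrightarrow> ?p" for X
    proof
      assume "(\<lambda>k. (norm (X k - ?p))\<^sup>2) \<longlonglongrightarrow> 0"
      then have "(\<lambda>k. sqrt ((norm (X k - ?p))\<^sup>2)) \<longlonglongrightarrow> sqrt 0" by (intro tendsto_intros)
      then have "(\<lambda>k. X k - ?p) \<longlonglongrightarrow> 0" by (simp add: tendsto_norm_zero_iff)
      then show "X \<longlonglongrightarrow> ?p" by (simp only: LIM_zero_iff)
    next
      assume "X \<longlonglongrightarrow> ?p"
      then have "(\<lambda>k. (norm (X k - ?p))\<^sup>2) \<longlonglongrightarrow> (norm (?p - ?p))\<^sup>2" by (intro tendsto_intros)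
      then show "(\<lambda>k. (norm (X k - ?p))\<^sup>2) \<longlonglongrightarrow> 0" by simp
    qed
    have "?lhs \<longleftrightarrow> (\<exists>\<phi>. (\<forall>k. \<phi> k \<in> test_functions \<Omega>) \<and> (\<lambda>k. h1_test (\<phi> k)) \<longlonglongrightarrow> ?p)"
      by (intro ex_cong1 conj_cong refl) (simp add: norm_eq conv)
    also have "\<dots> \<longleftrightarrow> (\<exists>X. (\<forall>k. X k \<in> h1_test ` test_functions \<Omega>) \<and> X \<longlonglongrightarrow> ?p)"
    proof
      assume "\<exists>X. (\<forall>k. X k \<in> h1_test ` test_functions \<Omega>) \<and> X \<longlonglongrightarrow> ?p"
      then obtain X where X: "\<forall>k. \<exists>\<phi>. \<phi> \<in> test_functions \<Omega> \<and> X k = h1_test \<phi>" "X \<longlonglongrightarrow> ?p" by blast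
      from choice[OF X(1)] obtain \<phi> where "\<And>k. \<phi> k \<in> test_functions \<Omega>" "\<And>k. X k = h1_test (\<phi> k)" by blast
      moreover from this have "X = (\<lambda>k. h1_test (\<phi> k))" by auto
      ultimately show "\<exists>\<phi>. (\<forall>k. \<phi> k \<in> test_functions \<Omega>) \<and> (\<lambda>k. h1_test (\<phi> k)) \<longlonglongrightarrow> ?p" using X(2) by auto
    next
      assume "\<exists>\<phi>. (\<forall>k. \<phi> k \<in> test_functions \<Omega>) \<and> (\<lambda>k. h1_test (\<phi> k)) \<longlonglongrightarrow> ?p"
      then obtain \<phi> where "\<And>k. \<phi> k \<in> test_functions \<Omega>" "(\<lambda>k. h1_test (\<phi> k)) \<longlonglongrightarrow> ?p" by blast
      then show "\<exists>X. (\<forall>k. X k \<in> h1_test ` test_functions \<Omega>) \<and> X \<longlonglongrightarrow> ?p"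
        by (intro exI[of _ "\<lambda>k. h1_test (\<phi> k)"]) auto
    qed
    finally show ?thesis by (simp add: h10_def closure_sequential)
  qed
  then show ?thesis unfolding H10_limit_def by blast
qed

text \<open>A limit class lives on the whole space and must be shown to vanish a.e. off \<Omega>.
  Test pairs are orthogonal to everything that vanishes on \<Omega>, and orthogonality passes to the
  closure.\<close>

lemma h10_cases:
  fixes \<Omega> :: "(real^'n) set"
  assumes \<Omega>: "open \<Omega>" and p: "p \<in> h10 \<Omega>"
  obtains u g where "H10_limit \<Omega> u g" "p = (to_l2 (ext0 \<Omega> u), to_l2 (ext0 \<Omega> g))"
proof -
  obtain u0 where u0: "square_integrable u0" "fst p = to_l2 u0" by (rule l2_cases)
  obtain g0 where g0: "square_integrable g0" "snd p = to_l2 g0" by (rule l2_cases)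
  note sq = square_integrable_ext0[OF \<Omega>]
  \<comment> \<open>The function w - ext0 \<Omega> w vanishes on \<Omega>, so it is an admissible
    choice in \<open>orth\<close>; it is then orthogonal to both of its terms, hence zero.\<close>
  have eq: "to_l2 w = to_l2 (ext0 \<Omega> w)" if w: "square_integrable w"
    and orth: "\<And>w'. square_integrable w' \<Longrightarrow> (\<And>x. x \<in> \<Omega> \<Longrightarrow> w' x = 0) \<Longrightarrow> to_l2 w \<bullet> to_l2 w' = 0"
    for w :: "real^'n \<Rightarrow> 'z::euclidean_space"
  proof -
    define d where "d x = w x - ext0 \<Omega> w x" for x
    have d: "square_integrable d" unfolding d_def by (intro square_integrable_diff w sq)
    have "to_l2 (ext0 \<Omega> w) \<bullet> to_l2 d = (LINT x|(lebesgue :: (real^'n) measure). 0)"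
      unfolding inner_to_l2[OF sq[OF w] d] by (intro Bochner_Integration.integral_cong) (auto simp: d_def ext0_def)
    moreover have "to_l2 w \<bullet> to_l2 d = 0" by (rule orth[OF d]) (simp add: d_def)
    moreover have "to_l2 d = to_l2 w - to_l2 (ext0 \<Omega> w)" unfolding d_def by (intro to_l2_diff w sq)
    ultimately have "to_l2 d \<bullet> to_l2 d = 0" by (metis diff_self inner_diff_left lebesgue_integral_const scaleR_zero_right)
    then show ?thesis using \<open>to_l2 d = _\<close> by simp
  qed
  have "to_l2 u0 = to_l2 (ext0 \<Omega> u0)"
  proof (rule eq[OF u0(1)])
    fix w' :: "real^'n \<Rightarrow> complex" assume w': "square_integrable w'" "\<And>x. x \<in> \<Omega> \<Longrightarrow> w' x = 0"
    have "fst p \<bullet> to_l2 w' = 0"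
      using p
    proof (rule h10_induct)
      show "closed {p. fst p \<bullet> to_l2 w' = 0}" by (intro closed_Collect_eq continuous_intros)
      fix \<phi> assume \<phi>: "\<phi> \<in> test_functions \<Omega>"
      have "\<phi> x \<bullet> w' x = 0" for x
        using w'(2)[of x] ext0_out[of x \<Omega> \<phi>] ext0_test_function(1)[OF \<phi>] by (cases "x \<in> \<Omega>") auto
      then show "fst (h1_test \<phi>) \<bullet> to_l2 w' = 0"
        by (simp add: h1_test_def inner_to_l2 square_integrable_test_function[OF \<phi>] w'(1))
    qed
    then show "to_l2 u0 \<bullet> to_l2 w' = 0" by (simp add: u0)
  qed
  moreover have "to_l2 g0 = to_l2 (ext0 \<Omega> g0)"
  proof (rule eq[OF g0(1)])
    fix w' :: "real^'n \<Rightarrow> complex^'n" assume w': "square_integrable w'" "\<And>x. x \<in> \<Omega> \<Longrightarrow> w' x = 0"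
    have "snd p \<bullet> to_l2 w' = 0"
      using p
    proof (rule h10_induct)
      show "closed {p. snd p \<bullet> to_l2 w' = 0}" by (intro closed_Collect_eq continuous_intros)
      fix \<phi> assume \<phi>: "\<phi> \<in> test_functions \<Omega>"
      have "classical_grad \<phi> x \<bullet> w' x = 0" for x
        using w'(2)[of x] ext0_out[of x \<Omega> "classical_grad \<phi>"] ext0_test_function(2)[OF \<phi>]
        by (cases "x \<in> \<Omega>") auto
      then show "snd (h1_test \<phi>) \<bullet> to_l2 w' = 0"
        by (simp add: h1_test_def inner_to_l2 square_integrable_test_function[OF \<phi>] w'(1))
    qed
    then show "to_l2 g0 \<bullet> to_l2 w' = 0" by (simp add: g0)
  qed
  ultimately have "p = (to_l2 (ext0 \<Omega> u0), to_l2 (ext0 \<Omega> g0))" by (simp add: prod_eq_iff u0 g0)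
  moreover from this p have "H10_limit \<Omega> u0 g0"
    by (simp add: H10_limit_iff[OF \<Omega>] L2_iff_square_integrable[OF \<Omega>] sq u0 g0)
  ultimately show ?thesis using that by blast
qed

lemma H10_limit_grad: "u \<in> H10 \<Omega> \<Longrightarrow> H10_limit \<Omega> u (grad \<Omega> u)"
  unfolding H10_def grad_def mem_Collect_eq by (rule someI_ex[of "H10_limit \<Omega> u"])

lemma H10_limit_imp_H10: "H10_limit \<Omega> u g \<Longrightarrow> u \<in> H10 \<Omega>"
  unfolding H10_def mem_Collect_eq by (rule exI)

text \<open>The difference of the two pairs lies in \<open>h10\<close> with first component zero, so
  closability applies.\<close>

lemma H10_limit_unique:
  assumes \<Omega>: "open \<Omega>" and "H10_limit \<Omega> u g" "H10_limit \<Omega> u' g'" "to_l2 (ext0 \<Omega> u) = to_l2 (ext0 \<Omega> u')"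
  shows "AE x in lebesgue_on \<Omega>. g x = g' x"
proof -
  have "(to_l2 (ext0 \<Omega> u), to_l2 (ext0 \<Omega> g)) \<in> h10 \<Omega>" "(to_l2 (ext0 \<Omega> u'), to_l2 (ext0 \<Omega> g')) \<in> h10 \<Omega>"
    using assms(2,3) unfolding H10_limit_iff[OF \<Omega>] by blast+
  from subspace_diff[OF subspace_h10 this]
  have "snd ((to_l2 (ext0 \<Omega> u), to_l2 (ext0 \<Omega> g)) - (to_l2 (ext0 \<Omega> u'), to_l2 (ext0 \<Omega> g'))) = 0"
    by (rule h10_gradient_unique) (simp add: assms(4))
  then have "to_l2 (ext0 \<Omega> g) = to_l2 (ext0 \<Omega> g')" by simp
  then show ?thesis using assms(2,3) by (simp add: to_l2_ext0_eq_iff[OF \<Omega>] H10_limit_def)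
qed

text \<open>Although \<open>grad\<close> is chosen arbitrarily, the class of the chosen gradient is
  determined by that of \<open>u\<close>.\<close>

definition h1_of :: "(real^'n) set \<Rightarrow> (real^'n \<Rightarrow> complex) \<Rightarrow> 'n h1" where
  "h1_of \<Omega> u = (to_l2 (ext0 \<Omega> u), to_l2 (ext0 \<Omega> (grad \<Omega> u)))"

lemma H10_L2:
  assumes "u \<in> H10 \<Omega>"
  shows "u \<in> L2 \<Omega>" "grad \<Omega> u \<in> L2 \<Omega>"
  using H10_limit_grad[OF assms] by (simp_all add: H10_limit_def)

lemma h1_of_in_h10: "open \<Omega> \<Longrightarrow> u \<in> H10 \<Omega> \<Longrightarrow> h1_of \<Omega> u \<in> h10 \<Omega>"
  unfolding h1_of_def using H10_limit_iff[THEN iffD1, OF _ H10_limit_grad] by blast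

lemma grad_eq:
  assumes "open \<Omega>" "H10_limit \<Omega> u g"
  shows "AE x in lebesgue_on \<Omega>. grad \<Omega> u x = g x"
  using H10_limit_unique[OF assms(1) H10_limit_grad[OF H10_limit_imp_H10[OF assms(2)]] assms(2)] by simp

lemma h10_eq_h1_of:
  assumes \<Omega>: "open \<Omega>" and p: "p \<in> h10 \<Omega>"
  shows "\<exists>u\<in>H10 \<Omega>. p = h1_of \<Omega> u"
proof -
  obtain u g where ug: "H10_limit \<Omega> u g" "p = (to_l2 (ext0 \<Omega> u), to_l2 (ext0 \<Omega> g))"
    by (rule h10_cases[OF \<Omega> p])
  have u: "u \<in> H10 \<Omega>" by (rule H10_limit_imp_H10[OF ug(1)])
  have "to_l2 (ext0 \<Omega> (grad \<Omega> u)) = to_l2 (ext0 \<Omega> g)"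
    using grad_eq[OF \<Omega> ug(1)] ug(1) H10_L2[OF u] by (simp add: to_l2_ext0_eq_iff[OF \<Omega>] H10_limit_def)
  with ug u show ?thesis by (auto simp: h1_of_def)
qed

section \<open>Eigenvalues and weak solutions\<close>

text \<open>A real-linear isometry of the complex plane maps test functions to test functions,
  commutes with differentiation and preserves both distances, so it carries an approximating
  sequence along. It is meant for conjugation and for multiplication by \<i>.\<close>

lemma H10_limit_isometry:
  fixes \<Omega> :: "(real^'n) set" and L :: "complex \<Rightarrow> complex"
  assumes L: "bounded_linear L" and iso: "\<And>z. norm (L z) = norm z" and u: "H10_limit \<Omega> u g"
  shows "H10_limit \<Omega> (\<lambda>x. L (u x)) (\<lambda>x. \<chi> i. L (g x $ i))"
proof -
  define \<Lambda> where "\<Lambda> y = (\<chi> i. L (y $ i))" for y :: "complex^'n"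
  have lin: "linear \<Lambda>"
    using bounded_linear.linear[OF L] by (intro linearI) (auto simp: \<Lambda>_def vec_eq_iff linear_add linear_scale)
  have \<Lambda>iso: "norm (\<Lambda> y) = norm y" for y by (simp add: \<Lambda>_def norm_vec_def iso)
  have Ldiff: "norm (L z - L z') = norm (z - z')" for z z'
    by (metis iso bounded_linear.linear[OF L] linear_diff)
  have \<Lambda>diff: "norm (\<Lambda> y - \<Lambda> y') = norm (y - y')" for y y'
    by (metis \<Lambda>iso lin linear_diff)
  have mL: "L \<in> borel_measurable borel" "\<Lambda> \<in> borel_measurable borel"
    using L lin by (auto intro!: borel_measurable_continuous_onI linear_continuous_on simp: linear_conv_bounded_linear)
  obtain \<phi> where \<phi>: "\<And>k. \<phi> k \<in> test_functions \<Omega>"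
    "(\<lambda>k. (LINT x|lebesgue_on \<Omega>. (norm (\<phi> k x - u x))\<^sup>2) +
             (LINT x|lebesgue_on \<Omega>. (norm (classical_grad (\<phi> k) x - g x))\<^sup>2)) \<longlonglongrightarrow> 0"
    using u unfolding H10_limit_def by blast
  have grad: "classical_grad (\<lambda>x. L (\<phi> k x)) = (\<lambda>x. \<Lambda> (classical_grad (\<phi> k) x))" for k
    unfolding \<Lambda>_def
    by (intro ext classical_grad_bounded_linear L c1_cpt_differentiable test_functions_c1_cpt[OF \<phi>(1)])
  have "(\<lambda>x. L (u x)) \<in> L2 \<Omega>" "(\<lambda>x. \<Lambda> (g x)) \<in> L2 \<Omega>"
    using u mL by (auto simp: H10_limit_def L2_def iso \<Lambda>iso intro: measurable_compose)
  moreover have "(\<lambda>k. (LINT x|lebesgue_on \<Omega>. (norm (L (\<phi> k x) - L (u x)))\<^sup>2) +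
             (LINT x|lebesgue_on \<Omega>. (norm (classical_grad (\<lambda>x. L (\<phi> k x)) x - \<Lambda> (g x)))\<^sup>2)) \<longlonglongrightarrow> 0"
    using \<phi>(2) by (simp add: grad Ldiff \<Lambda>diff)
  moreover have "(\<lambda>x. L (\<phi> k x)) \<in> test_functions \<Omega>" for k by (rule test_functions_bounded_linear[OF L \<phi>(1)])
  ultimately have "H10_limit \<Omega> (\<lambda>x. L (u x)) (\<lambda>x. \<Lambda> (g x))"
    unfolding H10_limit_def by (intro conjI exI[of _ "\<lambda>k x. L (\<phi> k x)"]) auto
  then show ?thesis by (simp add: \<Lambda>_def)
qed

lemma L2_integrable_product:
  fixes a b :: "'a::euclidean_space \<Rightarrow> complex"
  assumes "a \<in> L2 \<Omega>" "b \<in> L2 \<Omega>"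
  shows "integrable (lebesgue_on \<Omega>) (\<lambda>x. a x * b x)"
proof (rule Bochner_Integration.integrable_bound)
  show "integrable (lebesgue_on \<Omega>) (\<lambda>x. (norm (a x))\<^sup>2 + (norm (b x))\<^sup>2)"
    using assms by (auto simp: L2_def)
  show "(\<lambda>x. a x * b x) \<in> borel_measurable (lebesgue_on \<Omega>)" using assms by (auto simp: L2_def)
  have "norm (a x) * norm (b x) \<le> (norm (a x))\<^sup>2 + (norm (b x))\<^sup>2" for x
    using sum_squares_bound[of "norm (a x)" "norm (b x)"]
      mult_nonneg_nonneg[OF norm_ge_zero norm_ge_zero, of "a x" "b x"] by linarith
  then show "AE x in lebesgue_on \<Omega>. norm (a x * b x) \<le> norm ((norm (a x))\<^sup>2 + (norm (b x))\<^sup>2)"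
    by (simp add: norm_mult)
qed

lemma L2_component:
  fixes a :: "'a::euclidean_space \<Rightarrow> complex^'n"
  assumes "a \<in> L2 \<Omega>"
  shows "(\<lambda>x. a x $ i) \<in> L2 \<Omega>"
proof -
  have "(\<lambda>y::complex^'n. y $ i) \<in> borel_measurable borel"
    by (intro borel_measurable_continuous_onI continuous_intros)
  then have m: "(\<lambda>x. a x $ i) \<in> borel_measurable (lebesgue_on \<Omega>)"
    using assms by (auto simp: L2_def intro: measurable_compose)
  moreover have "integrable (lebesgue_on \<Omega>) (\<lambda>x. (norm (a x $ i))\<^sup>2)"
  proof (rule Bochner_Integration.integrable_bound)
    show "integrable (lebesgue_on \<Omega>) (\<lambda>x. (norm (a x))\<^sup>2)" using assms by (simp add: L2_def)
  qed (use m in \<open>auto intro!: power_mono Finite_Cartesian_Product.norm_nth_le\<close>)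
  ultimately show ?thesis by (simp add: L2_def)
qed

lemma L2_integrable_product_vec:
  fixes a b :: "'a::euclidean_space \<Rightarrow> complex^'n"
  assumes "a \<in> L2 \<Omega>" "b \<in> L2 \<Omega>"
  shows "integrable (lebesgue_on \<Omega>) (\<lambda>x. \<Sum>i\<in>UNIV. a x $ i * b x $ i)"
  by (rule Bochner_Integration.integrable_sum)
    (rule L2_integrable_product[OF L2_component[OF assms(1)] L2_component[OF assms(2)]])

lemma bounded_linear_times_ii: "bounded_linear (\<lambda>z::complex. \<i> * z)"
  by (rule bounded_linear_mult_right)

lemma H10_cnj:
  assumes "u \<in> H10 \<Omega>"
  shows "(\<lambda>x. cnj (u x)) \<in> H10 \<Omega>"
  by (rule H10_limit_imp_H10, rule H10_limit_isometry[OF bounded_linear_cnj _ H10_limit_grad[OF assms]]) simp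

lemma H10_ii:
  assumes "u \<in> H10 \<Omega>"
  shows "(\<lambda>x. \<i> * u x) \<in> H10 \<Omega>"
  by (rule H10_limit_imp_H10, rule H10_limit_isometry[OF bounded_linear_times_ii _ H10_limit_grad[OF assms]])
    (simp add: norm_mult)

lemma grad_cnj:
  assumes "open \<Omega>" "u \<in> H10 \<Omega>"
  shows "AE x in lebesgue_on \<Omega>. grad \<Omega> (\<lambda>x. cnj (u x)) x = (\<chi> i. cnj (grad \<Omega> u x $ i))"
  by (rule grad_eq[OF assms(1) H10_limit_isometry[OF bounded_linear_cnj _ H10_limit_grad[OF assms(2)]]]) simp

lemma grad_ii:
  assumes "open \<Omega>" "u \<in> H10 \<Omega>"
  shows "AE x in lebesgue_on \<Omega>. grad \<Omega> (\<lambda>x. \<i> * u x) x = (\<chi> i. \<i> * (grad \<Omega> u x $ i))"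
  by (rule grad_eq[OF assms(1) H10_limit_isometry[OF bounded_linear_times_ii _ H10_limit_grad[OF assms(2)]]])
    (simp add: norm_mult)

section \<open>The complex weak form and the real inner product\<close>

text \<open>The slot \<open>w\<close> takes F1(u) + F2(grad u) - f for the nonlinear equation and
  -\<mu>u for the eigenvalue problem, so that both ask for the vanishing of this form.\<close>

definition weak_form ::
    "(real^'n) set \<Rightarrow> (real^'n \<Rightarrow> complex) \<Rightarrow> (real^'n \<Rightarrow> complex) \<Rightarrow> (real^'n \<Rightarrow> complex) \<Rightarrow> complex" where
  "weak_form \<Omega> u w v = (LINT x|lebesgue_on \<Omega>. (\<Sum>i\<in>UNIV. grad \<Omega> u x $ i * grad \<Omega> v x $ i)) +
     (LINT x|lebesgue_on \<Omega>. w x * v x)"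

text \<open>Formulas for the gradient of a conjugate or of a multiple by \<i> hold only a.e.,
  \<open>grad\<close> being a choice; this substitutes them under the integral.\<close>

lemma integral_grad_product_cong:
  assumes "u \<in> H10 \<Omega>" "v \<in> H10 \<Omega>" and h: "h \<in> L2 \<Omega>" and eq: "AE x in lebesgue_on \<Omega>. grad \<Omega> v x = h x"
  shows "(LINT x|lebesgue_on \<Omega>. (\<Sum>i\<in>UNIV. grad \<Omega> u x $ i * grad \<Omega> v x $ i)) =
    (LINT x|lebesgue_on \<Omega>. (\<Sum>i\<in>UNIV. grad \<Omega> u x $ i * h x $ i))"
proof (rule integral_cong_AE)
  show "AE x in lebesgue_on \<Omega>. (\<Sum>i\<in>UNIV. grad \<Omega> u x $ i * grad \<Omega> v x $ i) = (\<Sum>i\<in>UNIV. grad \<Omega> u x $ i * h x $ i)"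
    using eq by eventually_elim simp
qed (intro borel_measurable_integrable L2_integrable_product_vec H10_L2(2)[OF assms(1)] H10_L2(2)[OF assms(2)] h)+

lemma grad_cnj_ii_L2:
  assumes "u \<in> H10 \<Omega>"
  shows "(\<lambda>x. \<chi> i. cnj (grad \<Omega> u x $ i)) \<in> L2 \<Omega>" "(\<lambda>x. \<chi> i. \<i> * (grad \<Omega> u x $ i)) \<in> L2 \<Omega>"
  using H10_limit_isometry[OF bounded_linear_cnj _ H10_limit_grad[OF assms]]
    H10_limit_isometry[OF bounded_linear_times_ii _ H10_limit_grad[OF assms]]
  by (simp_all add: H10_limit_def norm_mult)

lemma weak_form_cnj:
  assumes \<Omega>: "open \<Omega>" and u: "u \<in> H10 \<Omega>" and v: "v \<in> H10 \<Omega>"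
  shows "weak_form \<Omega> u w (\<lambda>x. cnj (v x)) =
    (LINT x|lebesgue_on \<Omega>. (\<Sum>i\<in>UNIV. grad \<Omega> u x $ i * cnj (grad \<Omega> v x $ i))) +
    (LINT x|lebesgue_on \<Omega>. w x * cnj (v x))"
  unfolding weak_form_def
  by (subst integral_grad_product_cong[OF u H10_cnj[OF v] grad_cnj_ii_L2(1)[OF v] grad_cnj[OF \<Omega> v]]) simp

lemma weak_form_ii:
  assumes \<Omega>: "open \<Omega>" and u: "u \<in> H10 \<Omega>" and v: "v \<in> H10 \<Omega>"
  shows "weak_form \<Omega> u w (\<lambda>x. \<i> * v x) = \<i> * weak_form \<Omega> u w v"
proof -
  have "weak_form \<Omega> u w (\<lambda>x. \<i> * v x) =
    (LINT x|lebesgue_on \<Omega>. \<i> * (\<Sum>i\<in>UNIV. grad \<Omega> u x $ i * grad \<Omega> v x $ i)) +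
    (LINT x|lebesgue_on \<Omega>. \<i> * (w x * v x))"
    unfolding weak_form_def
    by (subst integral_grad_product_cong[OF u H10_ii[OF v] grad_cnj_ii_L2(2)[OF v] grad_ii[OF \<Omega> v]])
      (simp add: sum_distrib_left mult.left_commute)
  then show ?thesis by (simp add: weak_form_def distrib_left)
qed

text \<open>The real part of a product with a conjugate is the real inner product of complex
  numbers; this links the bilinear form with the real Hilbert space of pairs.\<close>

lemma Re_weak_form_cnj:
  fixes \<Omega> :: "(real^'n) set"
  assumes \<Omega>: "open \<Omega>" and u: "u \<in> H10 \<Omega>" and w: "w \<in> L2 \<Omega>" and v: "v \<in> H10 \<Omega>"
  shows "Re (weak_form \<Omega> u w (\<lambda>x. cnj (v x))) =
    snd (h1_of \<Omega> u) \<bullet> snd (h1_of \<Omega> v) + to_l2 (ext0 \<Omega> w) \<bullet> fst (h1_of \<Omega> v)"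
proof -
  have "integrable (lebesgue_on \<Omega>) (\<lambda>x. \<Sum>i\<in>UNIV. grad \<Omega> u x $ i * cnj (grad \<Omega> v x $ i))"
    using L2_integrable_product_vec[OF H10_L2(2)[OF u] grad_cnj_ii_L2(1)[OF v]] by simp
  moreover have "integrable (lebesgue_on \<Omega>) (\<lambda>x. w x * cnj (v x))"
    by (intro L2_integrable_product w H10_L2(1) H10_cnj v)
  moreover have "Re (LINT x|lebesgue_on \<Omega>. k x) = (LINT x|lebesgue_on \<Omega>. Re (k x))"
    if "integrable (lebesgue_on \<Omega>) k" for k :: "real^'n \<Rightarrow> complex"
    by (rule integral_bounded_linear[OF bounded_linear_Re that, symmetric])
  ultimately have "Re (weak_form \<Omega> u w (\<lambda>x. cnj (v x))) =
    (LINT x|lebesgue_on \<Omega>. Re (\<Sum>i\<in>UNIV. grad \<Omega> u x $ i * cnj (grad \<Omega> v x $ i))) +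
    (LINT x|lebesgue_on \<Omega>. Re (w x * cnj (v x)))"
    by (simp only: weak_form_cnj[OF \<Omega> u v] plus_complex.sel)
  also have "\<dots> = (LINT x|lebesgue_on \<Omega>. grad \<Omega> u x \<bullet> grad \<Omega> v x) + (LINT x|lebesgue_on \<Omega>. w x \<bullet> v x)"
    by (simp add: inner_vec_def inner_complex_def)
  finally show ?thesis
    by (simp add: h1_of_def inner_to_l2_ext0[OF \<Omega>] H10_L2[OF u] H10_L2[OF v] w)
qed

text \<open>The real identity gives the vanishing of the real part for every test function;
  replacing v by \<i>v gives that of the imaginary part. Conjugating the test function, which stays
  in \<open>H10\<close>, passes between the two pairings.\<close>

lemma weak_form_zero_iff:
  assumes \<Omega>: "open \<Omega>" and u: "u \<in> H10 \<Omega>" and w: "w \<in> L2 \<Omega>"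
  shows "(\<forall>v\<in>H10 \<Omega>. weak_form \<Omega> u w v = 0) \<longleftrightarrow>
    (\<forall>q\<in>h10 \<Omega>. snd (h1_of \<Omega> u) \<bullet> snd q + to_l2 (ext0 \<Omega> w) \<bullet> fst q = 0)"
proof
  assume L: "\<forall>v\<in>H10 \<Omega>. weak_form \<Omega> u w v = 0"
  show "\<forall>q\<in>h10 \<Omega>. snd (h1_of \<Omega> u) \<bullet> snd q + to_l2 (ext0 \<Omega> w) \<bullet> fst q = 0"
  proof
    fix q assume "q \<in> h10 \<Omega>"
    then obtain v where v: "v \<in> H10 \<Omega>" "q = h1_of \<Omega> v" using h10_eq_h1_of[OF \<Omega>] by blast
    have "weak_form \<Omega> u w (\<lambda>x. cnj (v x)) = 0" using L H10_cnj[OF v(1)] by blast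
    then show "snd (h1_of \<Omega> u) \<bullet> snd q + to_l2 (ext0 \<Omega> w) \<bullet> fst q = 0"
      using Re_weak_form_cnj[OF \<Omega> u w v(1)] v(2) by simp
  qed
next
  assume R: "\<forall>q\<in>h10 \<Omega>. snd (h1_of \<Omega> u) \<bullet> snd q + to_l2 (ext0 \<Omega> w) \<bullet> fst q = 0"
  have Re0: "Re (weak_form \<Omega> u w v) = 0" if v: "v \<in> H10 \<Omega>" for v
    using Re_weak_form_cnj[OF \<Omega> u w H10_cnj[OF v]] R h1_of_in_h10[OF \<Omega> H10_cnj[OF v]] by simp
  show "\<forall>v\<in>H10 \<Omega>. weak_form \<Omega> u w v = 0"
  proof
    fix v assume v: "v \<in> H10 \<Omega>"
    \<comment> \<open>Re (\<i> z) = - Im z.\<close>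
    have "Re (\<i> * weak_form \<Omega> u w v) = 0"
      using Re0[OF H10_ii[OF v]] weak_form_ii[OF \<Omega> u v] by simp
    then show "weak_form \<Omega> u w v = 0" using Re0[OF v] by (simp add: complex_eq_iff)
  qed
qed

lemma L2_scaleR: "open \<Omega> \<Longrightarrow> u \<in> L2 \<Omega> \<Longrightarrow> (\<lambda>x. c *\<^sub>R u x) \<in> L2 \<Omega>"
  and to_l2_ext0_scaleR: "open \<Omega> \<Longrightarrow> u \<in> L2 \<Omega> \<Longrightarrow> to_l2 (ext0 \<Omega> (\<lambda>x. c *\<^sub>R u x)) = c *\<^sub>R to_l2 (ext0 \<Omega> u)"
proof -
  assume "open \<Omega>" "u \<in> L2 \<Omega>"
  moreover have "ext0 \<Omega> (\<lambda>x. c *\<^sub>R u x) = (\<lambda>x. c *\<^sub>R ext0 \<Omega> u x)" by (auto simp: ext0_def)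
  ultimately show "(\<lambda>x. c *\<^sub>R u x) \<in> L2 \<Omega>" "to_l2 (ext0 \<Omega> (\<lambda>x. c *\<^sub>R u x)) = c *\<^sub>R to_l2 (ext0 \<Omega> u)"
    by (simp_all add: L2_iff_square_integrable square_integrable_scaleR to_l2_scaleR)
qed

text \<open>The eigenvalue equation uses the Hermitian pairing. Conjugation is a bijection of
  \<open>H10\<close>, so it is equivalent to the bilinear condition with w = -\<mu>u, and then to
  the real one.\<close>

lemma dirichlet_eigenvalue_iff:
  assumes \<Omega>: "open \<Omega>"
  shows "dirichlet_eigenvalue \<Omega> \<mu> \<longleftrightarrow>
    (\<exists>p\<in>h10 \<Omega>. fst p \<noteq> 0 \<and> (\<forall>q\<in>h10 \<Omega>. snd p \<bullet> snd q = \<mu> * (fst p \<bullet> fst q)))"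
proof -
  have *: "(\<forall>v\<in>H10 \<Omega>. (LINT x|lebesgue_on \<Omega>. (\<Sum>i\<in>UNIV. grad \<Omega> u x $ i * cnj (grad \<Omega> v x $ i))) =
           of_real \<mu> * (LINT x|lebesgue_on \<Omega>. u x * cnj (v x))) \<longleftrightarrow>
      (\<forall>q\<in>h10 \<Omega>. snd (h1_of \<Omega> u) \<bullet> snd q = \<mu> * (fst (h1_of \<Omega> u) \<bullet> fst q))" (is "?lhs \<longleftrightarrow> ?rhs")
    if u: "u \<in> H10 \<Omega>" for u
  proof -
    define w where "w x = (- \<mu>) *\<^sub>R u x" for x
    have w: "w \<in> L2 \<Omega>" unfolding w_def by (intro L2_scaleR \<Omega> H10_L2 u)
    have "weak_form \<Omega> u w (\<lambda>x. cnj (v x)) = (LINT x|lebesgue_on \<Omega>. (\<Sum>i\<in>UNIV. grad \<Omega> u x $ i * cnj (grad \<Omega> v x $ i))) -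
           of_real \<mu> * (LINT x|lebesgue_on \<Omega>. u x * cnj (v x))" if v: "v \<in> H10 \<Omega>" for v
      unfolding weak_form_cnj[OF \<Omega> u v] w_def by (simp add: scaleR_conv_of_real mult.assoc)
    then have "?lhs \<longleftrightarrow> (\<forall>v\<in>H10 \<Omega>. weak_form \<Omega> u w (\<lambda>x. cnj (v x)) = 0)" by simp
    also have "\<dots> \<longleftrightarrow> (\<forall>v\<in>H10 \<Omega>. weak_form \<Omega> u w v = 0)"
    proof
      assume A: "\<forall>v\<in>H10 \<Omega>. weak_form \<Omega> u w (\<lambda>x. cnj (v x)) = 0"
      show "\<forall>v\<in>H10 \<Omega>. weak_form \<Omega> u w v = 0"
      proof
        fix v assume "v \<in> H10 \<Omega>"
        \<comment> \<open>The hypothesis is applied to the conjugate of \<open>v\<close>;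
          conjugating twice gives back \<open>v\<close>.\<close>
        with bspec[OF A H10_cnj] show "weak_form \<Omega> u w v = 0" by simp
      qed
    qed (simp add: H10_cnj)
    also have "\<dots> \<longleftrightarrow> ?rhs"
      unfolding weak_form_zero_iff[OF \<Omega> u w]
      by (simp add: w_def[abs_def] to_l2_ext0_scaleR[OF \<Omega> H10_L2(1)[OF u], of "- \<mu>", simplified] h1_of_def)
    finally show ?thesis .
  qed
  have **: "(AE x in lebesgue_on \<Omega>. u x = 0) \<longleftrightarrow> fst (h1_of \<Omega> u) = 0" if u: "u \<in> H10 \<Omega>" for u
  proof -
    have "ext0 \<Omega> (\<lambda>_. 0) = (\<lambda>_. 0 :: complex)" by (auto simp: ext0_def)
    then show ?thesis
      using to_l2_ext0_eq_iff[OF \<Omega> H10_L2(1)[OF u], of "\<lambda>_. 0"]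
      by (simp add: h1_of_def to_l2_0 L2_iff_square_integrable[OF \<Omega>] square_integrable_0)
  qed
  have "dirichlet_eigenvalue \<Omega> \<mu> \<longleftrightarrow> (\<exists>u\<in>H10 \<Omega>. fst (h1_of \<Omega> u) \<noteq> 0 \<and>
      (\<forall>q\<in>h10 \<Omega>. snd (h1_of \<Omega> u) \<bullet> snd q = \<mu> * (fst (h1_of \<Omega> u) \<bullet> fst q)))"
    unfolding dirichlet_eigenvalue_def using * ** by (intro bex_cong refl) simp
  also have "\<dots> \<longleftrightarrow> (\<exists>p\<in>h10 \<Omega>. fst p \<noteq> 0 \<and> (\<forall>q\<in>h10 \<Omega>. snd p \<bullet> snd q = \<mu> * (fst p \<bullet> fst q)))"
  proof
    assume "\<exists>p\<in>h10 \<Omega>. fst p \<noteq> 0 \<and> (\<forall>q\<in>h10 \<Omega>. snd p \<bullet> snd q = \<mu> * (fst p \<bullet> fst q))"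
    then obtain p where p: "p \<in> h10 \<Omega>" "fst p \<noteq> 0" "\<forall>q\<in>h10 \<Omega>. snd p \<bullet> snd q = \<mu> * (fst p \<bullet> fst q)"
      by blast
    obtain u where "u \<in> H10 \<Omega>" "p = h1_of \<Omega> u" using h10_eq_h1_of[OF \<Omega> p(1)] by blast
    with p show "\<exists>u\<in>H10 \<Omega>. fst (h1_of \<Omega> u) \<noteq> 0 \<and>
        (\<forall>q\<in>h10 \<Omega>. snd (h1_of \<Omega> u) \<bullet> snd q = \<mu> * (fst (h1_of \<Omega> u) \<bullet> fst q))" by blast
  qed (use h1_of_in_h10[OF \<Omega>] in blast)
  finally show ?thesis .
qed

text \<open>By its Euler-Lagrange equation the attained minimum \<open>m\<close> of the Rayleigh
  quotient is itself an eigenvalue, and it is a lower bound for all eigenvalues; hence the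
  \<open>LEAST\<close> is attained and equals \<open>m\<close>.\<close>

theorem first_dirichlet_eigenvalue_properties:
  fixes \<Omega> :: "(real^'n) set"
  assumes \<Omega>: "open \<Omega>" "bounded \<Omega>" "\<Omega> \<noteq> {}"
  shows "first_dirichlet_eigenvalue \<Omega> > 0"
    and "p \<in> h10 \<Omega> \<Longrightarrow> first_dirichlet_eigenvalue \<Omega> * (norm (fst p))\<^sup>2 \<le> (norm (snd p))\<^sup>2"
proof -
  obtain K where K: "K > 0" "\<And>p. p \<in> h10 \<Omega> \<Longrightarrow> norm (fst p) \<le> K * norm (snd p)"
    using poincare_h10[OF \<Omega>(2)] by metis
  obtain \<phi> where \<phi>: "\<phi> \<in> test_functions \<Omega>" "to_l2 \<phi> \<noteq> 0"
    using nontrivial_test_function[OF \<Omega>(1,3)] by blast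
  have nontriv: "\<exists>p\<in>h10 \<Omega>. fst p \<noteq> 0"
    using h1_test_in_h10[OF \<phi>(1)] \<phi>(2) by (intro bexI[of _ "h1_test \<phi>"]) (simp add: h1_test_def)
  obtain m p0 where m: "m > 0" "p0 \<in> h10 \<Omega>" "fst p0 \<noteq> 0"
    "\<And>q. q \<in> h10 \<Omega> \<Longrightarrow> m * (norm (fst q))\<^sup>2 \<le> (norm (snd q))\<^sup>2"
    "\<And>q. q \<in> h10 \<Omega> \<Longrightarrow> snd p0 \<bullet> snd q = m * (fst p0 \<bullet> fst q)"
    using rayleigh_minimizer[OF subspace_h10 closed_h10 K(2) rellich_h10[OF \<Omega>(2)] nontriv] by blast
  have "first_dirichlet_eigenvalue \<Omega> = m"
    unfolding first_dirichlet_eigenvalue_def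
  proof (rule Least_equality)
    show "dirichlet_eigenvalue \<Omega> m" unfolding dirichlet_eigenvalue_iff[OF \<Omega>(1)] using m by blast
    fix \<mu> assume "dirichlet_eigenvalue \<Omega> \<mu>"
    then obtain p where p: "p \<in> h10 \<Omega>" "fst p \<noteq> 0" "\<And>q. q \<in> h10 \<Omega> \<Longrightarrow> snd p \<bullet> snd q = \<mu> * (fst p \<bullet> fst q)"
      unfolding dirichlet_eigenvalue_iff[OF \<Omega>(1)] by blast
    \<comment> \<open>The eigenvector is tested against itself, so that \<mu> is its Rayleigh
      quotient.\<close>
    have "m * (norm (fst p))\<^sup>2 \<le> \<mu> * (norm (fst p))\<^sup>2"
      using m(4)[OF p(1)] p(3)[OF p(1)] by (simp add: power2_norm_eq_inner)
    then show "m \<le> \<mu>" using p(2) by simp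
  qed
  with m show "first_dirichlet_eigenvalue \<Omega> > 0"
    "p \<in> h10 \<Omega> \<Longrightarrow> first_dirichlet_eigenvalue \<Omega> * (norm (fst p))\<^sup>2 \<le> (norm (snd p))\<^sup>2" by auto
qed

section \<open>The nonlinearity as an operator on classes\<close>

lemma L2_add: "open \<Omega> \<Longrightarrow> u \<in> L2 \<Omega> \<Longrightarrow> v \<in> L2 \<Omega> \<Longrightarrow> (\<lambda>x. u x + v x) \<in> L2 \<Omega>"
proof -
  assume "open \<Omega>" "u \<in> L2 \<Omega>" "v \<in> L2 \<Omega>"
  moreover have "ext0 \<Omega> (\<lambda>x. u x + v x) = (\<lambda>x. ext0 \<Omega> u x + ext0 \<Omega> v x)" by (auto simp: ext0_def)
  ultimately show ?thesis by (simp add: L2_iff_square_integrable square_integrable_add)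
qed

text \<open>Linear growth: |F(a)| \<le> |F(0)| + C|a|. The constant F(0) is square-integrable
  because \<Omega> has finite measure.\<close>

lemma L2_lipschitz_comp:
  fixes F :: "'b::euclidean_space \<Rightarrow> 'c::euclidean_space" and a :: "'a::euclidean_space \<Rightarrow> 'b"
  assumes \<Omega>: "open \<Omega>" "bounded \<Omega>" and F: "C-lipschitz_on UNIV F" and a: "a \<in> L2 \<Omega>"
  shows "(\<lambda>x. F (a x)) \<in> L2 \<Omega>"
proof -
  have "F \<in> borel_measurable borel"
    using lipschitz_on_continuous_on[OF F] by (rule borel_measurable_continuous_onI)
  then have m: "(\<lambda>x. F (a x)) \<in> borel_measurable (lebesgue_on \<Omega>)"
    using a by (auto simp: L2_def intro: measurable_compose)
  have "\<Omega> \<in> lmeasurable" using \<Omega> by (simp add: lmeasurable_open)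
  then interpret finite_measure "lebesgue_on \<Omega>" by (rule finite_measure_lebesgue_on)
  have "integrable (lebesgue_on \<Omega>) (\<lambda>x. (norm (F (a x)))\<^sup>2)"
  proof (rule Bochner_Integration.integrable_bound)
    show "integrable (lebesgue_on \<Omega>) (\<lambda>x. 2 * (norm (F 0))\<^sup>2 + 2 * C\<^sup>2 * (norm (a x))\<^sup>2)"
      using a by (auto simp: L2_def)
    have "(norm (F (a x)))\<^sup>2 \<le> 2 * (norm (F 0))\<^sup>2 + 2 * C\<^sup>2 * (norm (a x))\<^sup>2" for x
    proof -
      have "norm (F (a x) - F 0) \<le> C * norm (a x)"
        using lipschitz_onD[OF F, of "a x" 0] by (simp add: dist_norm)
      then have "norm (F (a x)) \<le> norm (F 0) + C * norm (a x)"
        using norm_triangle_sub[of "F (a x)" "F 0"] by linarith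
      then have "(norm (F (a x)))\<^sup>2 \<le> (norm (F 0) + C * norm (a x))\<^sup>2" by (intro power_mono) auto
      also have "\<dots> \<le> 2 * (norm (F 0))\<^sup>2 + 2 * (C * norm (a x))\<^sup>2"
        using sum_squares_bound[of "norm (F 0)" "C * norm (a x)"] by (simp add: power2_sum)
      finally show ?thesis by (simp add: power_mult_distrib)
    qed
    then show "AE x in lebesgue_on \<Omega>. norm ((norm (F (a x)))\<^sup>2) \<le> norm (2 * (norm (F 0))\<^sup>2 + 2 * C\<^sup>2 * (norm (a x))\<^sup>2)"
      by (intro AE_I2) (simp add: order_trans[OF _ abs_ge_self])
  qed (use m in auto)
  with m show ?thesis by (simp add: L2_def)
qed

text \<open>A representative is chosen so that F1 and F2 can be evaluated pointwise on an arbitrary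
  class.\<close>

definition rep_fun :: "('a::euclidean_space, 'b::euclidean_space) l2 \<Rightarrow> 'a \<Rightarrow> 'b" where
  "rep_fun y = (SOME f. square_integrable f \<and> y = to_l2 f)"

lemma rep_fun: "square_integrable (rep_fun y)" "to_l2 (rep_fun y) = y"
proof -
  have "\<exists>f. square_integrable f \<and> y = to_l2 f" using l2_cases by metis
  from someI_ex[OF this] show "square_integrable (rep_fun y)" "to_l2 (rep_fun y) = y"
    by (auto simp: rep_fun_def)
qed

lemma square_integrable_L2:
  fixes f :: "'a::euclidean_space \<Rightarrow> 'b::euclidean_space"
  assumes "open \<Omega>" "square_integrable f"
  shows "f \<in> L2 \<Omega>"
  using square_integrable_ext0[OF assms] by (simp add: L2_iff_square_integrable assms)

lemma square_integrable_norm: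
  "square_integrable f \<Longrightarrow> square_integrable (\<lambda>x. norm (f x))"
  by (auto simp: square_integrable_def)

lemma norm_to_l2_norm: "square_integrable f \<Longrightarrow> norm (to_l2 (\<lambda>x. norm (f x))) = norm (to_l2 f)"
  by (intro antisym norm_to_l2_mono square_integrable_norm) auto

text \<open>The right-hand side \<open>f\<close> is absorbed with a minus sign, so that solutions
  satisfy a homogeneous identity. It is defined on all pairs, not only on \<open>h10\<close>,
  because the abstract theorem asks for a Lipschitz bound on the whole product.\<close>

definition nonlinearity ::
    "(real^'n) set \<Rightarrow> (complex \<Rightarrow> complex) \<Rightarrow> (complex^'n \<Rightarrow> complex) \<Rightarrow> (real^'n \<Rightarrow> complex) \<Rightarrow>
     'n h1 \<Rightarrow> (real^'n, complex) l2" where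
  "nonlinearity \<Omega> F1 F2 f p =
     to_l2 (ext0 \<Omega> (\<lambda>x. F1 (rep_fun (fst p) x) + F2 (rep_fun (snd p) x) - f x))"

context
  fixes \<Omega> :: "(real^'n) set" and F1 :: "complex \<Rightarrow> complex" and F2 :: "complex^'n \<Rightarrow> complex"
    and f :: "real^'n \<Rightarrow> complex" and C1 C2 :: real
  assumes \<Omega>: "open \<Omega>" "bounded \<Omega>"
    and F1: "C1-lipschitz_on UNIV F1" and F2: "C2-lipschitz_on UNIV F2" and f: "f \<in> L2 \<Omega>"
begin

lemma L2_nonlinearity:
  assumes "a \<in> L2 \<Omega>" "b \<in> L2 \<Omega>"
  shows "(\<lambda>x. F1 (a x) + F2 (b x) - f x) \<in> L2 \<Omega>"
  by (intro L2_diff L2_add L2_lipschitz_comp[OF \<Omega> F1] L2_lipschitz_comp[OF \<Omega> F2] assms \<Omega> f)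

text \<open>A pointwise Lipschitz estimate followed by the triangle inequality in L^2. Passing to
  the norms of the differences makes both terms real-valued, so that functions and gradients can be
  added in one space.\<close>

lemma nonlinearity_lipschitz:
  "norm (nonlinearity \<Omega> F1 F2 f p - nonlinearity \<Omega> F1 F2 f q)
    \<le> C1 * norm (fst p - fst q) + C2 * norm (snd p - snd q)"
proof -
  define a b a' b' where ab: "a = rep_fun (fst p)" "b = rep_fun (snd p)" "a' = rep_fun (fst q)" "b' = rep_fun (snd q)"
  have sq: "square_integrable a" "square_integrable b" "square_integrable a'" "square_integrable b'"
    by (simp_all add: ab rep_fun)
  note dsq = square_integrable_diff[OF sq(1,3)] square_integrable_diff[OF sq(2,4)]
  define w w' where "w x = F1 (a x) + F2 (b x) - f x" and "w' x = F1 (a' x) + F2 (b' x) - f x" for x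
  have w: "w \<in> L2 \<Omega>" "w' \<in> L2 \<Omega>"
    unfolding w_def w'_def by (intro L2_nonlinearity square_integrable_L2 \<Omega> sq)+
  have C: "C1 \<ge> 0" "C2 \<ge> 0" using F1 F2 by (auto dest: lipschitz_on_nonneg)
  have "norm (nonlinearity \<Omega> F1 F2 f p - nonlinearity \<Omega> F1 F2 f q) = norm (to_l2 (\<lambda>x. ext0 \<Omega> w x - ext0 \<Omega> w' x))"
    using w by (simp add: nonlinearity_def ab[symmetric] w_def[symmetric] w'_def[symmetric] to_l2_diff
        L2_iff_square_integrable \<Omega>)
  also have "\<dots> \<le> norm (to_l2 (\<lambda>x. C1 *\<^sub>R norm (a x - a' x) + C2 *\<^sub>R norm (b x - b' x)))"
  proof (rule norm_to_l2_mono)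
    show "square_integrable (\<lambda>x. ext0 \<Omega> w x - ext0 \<Omega> w' x)"
      using w by (intro square_integrable_diff) (auto simp: L2_iff_square_integrable \<Omega>)
    show "square_integrable (\<lambda>x. C1 *\<^sub>R norm (a x - a' x) + C2 *\<^sub>R norm (b x - b' x))"
      by (intro square_integrable_add square_integrable_scaleR square_integrable_norm dsq)
    fix x
    have "norm (w x - w' x) \<le> norm (F1 (a x) - F1 (a' x)) + norm (F2 (b x) - F2 (b' x))"
      unfolding w_def w'_def by (rule order_trans[OF _ norm_triangle_ineq]) (simp add: algebra_simps)
    also have "\<dots> \<le> C1 * norm (a x - a' x) + C2 * norm (b x - b' x)"
      using lipschitz_onD[OF F1, of "a x" "a' x"] lipschitz_onD[OF F2, of "b x" "b' x"]
      by (intro add_mono) (auto simp: dist_norm)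
    finally have "norm (ext0 \<Omega> w x - ext0 \<Omega> w' x) \<le> C1 * norm (a x - a' x) + C2 * norm (b x - b' x)"
      using C by (cases "x \<in> \<Omega>") auto
    then show "norm (ext0 \<Omega> w x - ext0 \<Omega> w' x) \<le> norm (C1 *\<^sub>R norm (a x - a' x) + C2 *\<^sub>R norm (b x - b' x))"
      by simp
  qed
  also have "\<dots> = norm (C1 *\<^sub>R to_l2 (\<lambda>x. norm (a x - a' x)) + C2 *\<^sub>R to_l2 (\<lambda>x. norm (b x - b' x)))"
    by (simp only: to_l2_add[OF square_integrable_scaleR[OF square_integrable_norm[OF dsq(1)]]
          square_integrable_scaleR[OF square_integrable_norm[OF dsq(2)]]]
        to_l2_scaleR[OF square_integrable_norm[OF dsq(1)]] to_l2_scaleR[OF square_integrable_norm[OF dsq(2)]])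
  also have "\<dots> \<le> C1 * norm (to_l2 (\<lambda>x. a x - a' x)) + C2 * norm (to_l2 (\<lambda>x. b x - b' x))"
    using C norm_triangle_ineq[of "C1 *\<^sub>R to_l2 (\<lambda>x. norm (a x - a' x))" "C2 *\<^sub>R to_l2 (\<lambda>x. norm (b x - b' x))"]
    by (simp add: norm_to_l2_norm dsq)
  also have "\<dots> = C1 * norm (fst p - fst q) + C2 * norm (snd p - snd q)"
    by (simp only: to_l2_diff[OF sq(1,3)] to_l2_diff[OF sq(2,4)]) (simp only: ab rep_fun)
  finally show ?thesis .
qed

text \<open>The chosen representatives agree a.e. on \<Omega> with \<open>u\<close> and its
  gradient, hence so do the compositions.\<close>

lemma nonlinearity_h1_of:
  assumes u: "u \<in> H10 \<Omega>"
  shows "nonlinearity \<Omega> F1 F2 f (h1_of \<Omega> u) = to_l2 (ext0 \<Omega> (\<lambda>x. F1 (u x) + F2 (grad \<Omega> u x) - f x))"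
proof -
  define a b where ab: "a = rep_fun (to_l2 (ext0 \<Omega> u))" "b = rep_fun (to_l2 (ext0 \<Omega> (grad \<Omega> u)))"
  have sq: "square_integrable a" "square_integrable b" by (simp_all add: ab rep_fun)
  have "to_l2 a = to_l2 (ext0 \<Omega> u)" "to_l2 b = to_l2 (ext0 \<Omega> (grad \<Omega> u))" by (simp_all add: ab rep_fun)
  then have "AE x in lebesgue. a x = ext0 \<Omega> u x" "AE x in lebesgue. b x = ext0 \<Omega> (grad \<Omega> u) x"
    using H10_L2[OF u] sq by (simp_all add: to_l2_eq_iff L2_iff_square_integrable \<Omega>)
  then have "AE x in lebesgue. x \<in> \<Omega> \<longrightarrow> F1 (a x) + F2 (b x) - f x = F1 (u x) + F2 (grad \<Omega> u x) - f x"
    by eventually_elim simp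
  then have "to_l2 (ext0 \<Omega> (\<lambda>x. F1 (a x) + F2 (b x) - f x)) = to_l2 (ext0 \<Omega> (\<lambda>x. F1 (u x) + F2 (grad \<Omega> u x) - f x))"
    using to_l2_ext0_eq_iff[OF \<Omega>(1) L2_nonlinearity[OF square_integrable_L2[OF \<Omega>(1) sq(1)] square_integrable_L2[OF \<Omega>(1) sq(2)]]
        L2_nonlinearity[OF H10_L2[OF u]]]
    by (simp add: AE_lebesgue_on_iff \<Omega>)
  then show ?thesis by (simp add: nonlinearity_def h1_of_def ab)
qed

text \<open>Bringing \<open>f\<close> to the left makes the weak formulation the vanishing of
  \<open>weak_form\<close>, which is equivalent to the real identity solved by the abstract
  theorem.\<close>

lemma weak_solution_iff:
  "weak_solution \<Omega> F1 F2 f u \<longleftrightarrow> u \<in> H10 \<Omega> \<and>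
    (\<forall>q\<in>h10 \<Omega>. snd (h1_of \<Omega> u) \<bullet> snd q + nonlinearity \<Omega> F1 F2 f (h1_of \<Omega> u) \<bullet> fst q = 0)"
proof (cases "u \<in> H10 \<Omega>")
  case True
  define w where "w x = F1 (u x) + F2 (grad \<Omega> u x) - f x" for x
  have w: "w \<in> L2 \<Omega>" unfolding w_def by (intro L2_nonlinearity H10_L2 True)
  have w0: "(\<lambda>x. F1 (u x) + F2 (grad \<Omega> u x)) \<in> L2 \<Omega>"
    by (intro L2_add L2_lipschitz_comp[OF \<Omega> F1] L2_lipschitz_comp[OF \<Omega> F2] H10_L2 True \<Omega>)
  have "(LINT x|lebesgue_on \<Omega>. w x * v x) =
      (LINT x|lebesgue_on \<Omega>. (F1 (u x) + F2 (grad \<Omega> u x)) * v x) - (LINT x|lebesgue_on \<Omega>. f x * v x)"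
    if v: "v \<in> H10 \<Omega>" for v
    unfolding w_def
    using L2_integrable_product[OF w0 H10_L2(1)[OF v]] L2_integrable_product[OF f H10_L2(1)[OF v]]
    by (simp only: left_diff_distrib Bochner_Integration.integral_diff)
  then have "weak_solution \<Omega> F1 F2 f u \<longleftrightarrow> (\<forall>v\<in>H10 \<Omega>. weak_form \<Omega> u w v = 0)"
    unfolding weak_solution_def weak_form_def using True by (simp add: add_diff_eq)
  also have "\<dots> \<longleftrightarrow> (\<forall>q\<in>h10 \<Omega>. snd (h1_of \<Omega> u) \<bullet> snd q + to_l2 (ext0 \<Omega> w) \<bullet> fst q = 0)"
    by (rule weak_form_zero_iff[OF \<Omega>(1) True w])
  also have "to_l2 (ext0 \<Omega> w) = nonlinearity \<Omega> F1 F2 f (h1_of \<Omega> u)"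
    by (simp add: nonlinearity_h1_of[OF True] w_def[abs_def])
  finally show ?thesis using True by simp
qed (simp add: weak_solution_def)

end

theorem theorem2p2:
  fixes \<Omega> :: "(real^'n) set"
    and F1 :: "complex \<Rightarrow> complex" and F2 :: "complex^'n \<Rightarrow> complex"
    and f :: "real^'n \<Rightarrow> complex"
    and C C1 C2 :: real
  assumes "open \<Omega>" and "connected \<Omega>" and "bounded \<Omega>" and "C1_boundary \<Omega>"
    and "C = first_dirichlet_eigenvalue \<Omega> powr (- (1/2))"
    and "C1-lipschitz_on UNIV F1" and "C2-lipschitz_on UNIV F2"
    and "C1 * C\<^sup>2 + C2 * C < 1"
    and "f \<in> L2 \<Omega>"
  shows "\<exists>u. weak_solution \<Omega> F1 F2 f u \<and>
             (\<forall>w. weak_solution \<Omega> F1 F2 f w \<longrightarrow> (AE x in lebesgue_on \<Omega>. w x = u x))"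
proof -
  note \<Omega> = assms(1,3) and F1 = assms(6) and F2 = assms(7) and f = assms(9)
  note ws = weak_solution_iff[OF \<Omega> F1 F2 f]
  define m where "m = first_dirichlet_eigenvalue \<Omega>"
  have bound: "norm (fst p) \<le> C * norm (snd p)" if p: "p \<in> h10 \<Omega>" for p
  proof (cases "\<Omega> = {}")
    \<comment> \<open>On the empty set there is no eigenvalue and \<open>C\<close> is an unspecified
      power, still nonnegative; the bound holds because every first component is zero.\<close>
    case True
    obtain u g where "fst p = to_l2 (ext0 \<Omega> u)" using h10_eq_h1_of[OF \<Omega>(1) p] by (auto simp: h1_of_def)
    moreover have "ext0 \<Omega> u = (\<lambda>_. 0)" using True by (auto simp: ext0_def)
    ultimately show ?thesis by (simp add: to_l2_0 assms(5))
  next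
    case False
    have pos: "m > 0" unfolding m_def by (rule first_dirichlet_eigenvalue_properties(1)[OF \<Omega> False])
    have C2: "C\<^sup>2 = 1 / m"
      using pos by (simp add: assms(5) m_def[symmetric] power2_eq_square powr_add[symmetric] powr_minus_divide)
    have "m * (norm (fst p))\<^sup>2 \<le> (norm (snd p))\<^sup>2"
      unfolding m_def by (rule first_dirichlet_eigenvalue_properties(2)[OF \<Omega> False p])
    then have "(norm (fst p))\<^sup>2 \<le> (C * norm (snd p))\<^sup>2"
      using pos by (simp add: power_mult_distrib C2 field_simps)
    then show ?thesis by (rule power2_le_imp_le) (simp add: assms(5))
  qed
  have "\<exists>!p. p \<in> h10 \<Omega> \<and> (\<forall>q\<in>h10 \<Omega>. snd p \<bullet> snd q + nonlinearity \<Omega> F1 F2 f p \<bullet> fst q = 0)"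
    using F1 F2 assms(5,8)
    by (intro lipschitz_perturbation_unique_solution[where C = C and ?C1.0 = C1 and ?C2.0 = C2]
        subspace_h10 closed_h10 bound nonlinearity_lipschitz[OF \<Omega> F1 F2 f]) (auto dest: lipschitz_on_nonneg)
  then obtain p where p: "p \<in> h10 \<Omega>" "\<forall>q\<in>h10 \<Omega>. snd p \<bullet> snd q + nonlinearity \<Omega> F1 F2 f p \<bullet> fst q = 0"
    and uniq: "\<And>p'. p' \<in> h10 \<Omega> \<Longrightarrow> \<forall>q\<in>h10 \<Omega>. snd p' \<bullet> snd q + nonlinearity \<Omega> F1 F2 f p' \<bullet> fst q = 0 \<Longrightarrow> p' = p"
    by (elim ex1E) blast
  \<comment> \<open>The solution pair is represented by an actual function, for which
    \<open>grad\<close> supplies the second component.\<close>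
  obtain u where u: "u \<in> H10 \<Omega>" "p = h1_of \<Omega> u" using h10_eq_h1_of[OF \<Omega>(1) p(1)] by blast
  show ?thesis
  proof (intro exI conjI allI impI)
    show "weak_solution \<Omega> F1 F2 f u" using p(2) u by (simp add: ws)
    fix w assume "weak_solution \<Omega> F1 F2 f w"
    then have w: "w \<in> H10 \<Omega>" and "h1_of \<Omega> w = p"
      using uniq h1_of_in_h10[OF \<Omega>(1)] by (auto simp: ws)
    \<comment> \<open>Uniqueness of the pair is equality of classes, that is, a.e. equality on
      \<Omega>.\<close>
    then have "to_l2 (ext0 \<Omega> w) = to_l2 (ext0 \<Omega> u)" using u by (simp add: h1_of_def)
    then show "AE x in lebesgue_on \<Omega>. w x = u x"
      using to_l2_ext0_eq_iff[OF \<Omega>(1) H10_L2(1)[OF w] H10_L2(1)[OF u(1)]] by simp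
  qed
qed

end
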